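(* Let $d\geq 1$ and let $X_1,X_2,\dots,X_n$ be i.i.d. $\mathbb{R}^d$-valued random vectors whose common law is absolutely continuous with respect to Lebesgue measure, with $\mathbb{E}X_1=0$, $\operatorname{Cov}(X_1)=I_d$, and finite Poincaré constant $C_P(X_1)=R<\infty$. Let $Z_n=\frac{1}{\sqrt n}\sum_{i=1}^n X_i$. Then for all $n\geq 1$, \[ J(Z_n)\leq \frac{2dR}{2dR+(n-1)}\,J(X_1). \]
   Context: $I_d$ is the $d\times d$ identity matrix and $p_X$ denotes the Lebesgue density of a random vector $X$ on $\mathbb{R}^d$. Poincaré constant: $C_P(X)$ is the infimum of all $C>0$ such that $\operatorname{Var}(f(X))\le C\,\mathbb{E}[|\nabla f(X)|^2]$ for all locally Lipschitz $f:\mathbb{R}^d\to\mathbb{R}$ with $\mathbb{E}[f(X)^2]<\infty$. (If $\operatorname{Cov}(X)=I_d$ then $C_P(X)\ge 1$.) Relative Fisher information: for $X$ with $\mathbb{E}X=0$, $\operatorname{Cov}(X)=I_d$, and $Z\sim\mathcal N(0,I_d)$, \[ J(X):=\int_{\mathbb{R}^d}\bigl|\nabla\log p_X(x)-\nabla\log p_Z(x)\bigr|^2p_X(x)\,dx\in[0,\infty], \] where $\nabla\log p_X=\nabla p_X/p_X$ with $\nabla p_X$ the weak gradient; $J(X)=\infty$ by convention if $p_X$ is not weakly differentiable (not in $W^{1,1}_{\mathrm{loc}}(\mathbb{R}^d)$). The inequality is trivially true if $J(X_1)=\infty$. *)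

theory Defs
  imports "HOL-Probability.Probability"
begin

text \<open>The zero value off the differentiability points of \<open>f\<close> is a mere totalisation: by Rademacher's
  theorem these points carry no Lebesgue mass when \<open>f\<close> is locally Lipschitz.\<close>

definition gradient :: "('b::euclidean_space \<Rightarrow> real) \<Rightarrow> 'b \<Rightarrow> 'b" where
  "gradient f x = (if \<exists>D. GDERIV f x :> D then (THE D. GDERIV f x :> D) else 0)"

definition locally_lipschitz :: "('b::euclidean_space \<Rightarrow> real) \<Rightarrow> bool" where
  "locally_lipschitz f \<longleftrightarrow> (\<forall>x. \<exists>u>0. \<exists>L. L-lipschitz_on (cball x u) f)"


text \<open>The right-hand side of the Poincare inequality may be infinite, so it is a
  nonnegative integral. The infimum over the empty set is \<open>\<infinity>\<close>. Using the pointwise gradient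
  is adequate for laws absolutely continuous with respect to Lebesgue measure.\<close>

definition poincare_constant :: "'a measure \<Rightarrow> ('a \<Rightarrow> 'b::euclidean_space) \<Rightarrow> ennreal" where
  "poincare_constant M X =
     Inf {ennreal C | C. C > 0 \<and>
       (\<forall>f. locally_lipschitz f \<and> integrable M (\<lambda>\<omega>. (f (X \<omega>))\<^sup>2) \<longrightarrow>
          ennreal (prob_space.variance M (\<lambda>\<omega>. f (X \<omega>)))
            \<le> ennreal C * (\<integral>\<^sup>+\<omega>. ennreal ((norm (gradient f (X \<omega>)))\<^sup>2) \<partial>M))}"


text \<open>Since a Bochner integral is zero when the integrand is not integrable, a covariance matrix
  with nonzero diagonal entries forces finite second moments.\<close>

definition covariance_matrix :: "'a measure \<Rightarrow> ('a \<Rightarrow> real ^ 'n) \<Rightarrow> real ^ 'n ^ 'n" where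
  "covariance_matrix M X =
     (\<chi> i j. \<integral>\<omega>. (X \<omega> $ i - (\<integral>\<omega>'. X \<omega>' $ i \<partial>M)) * (X \<omega> $ j - (\<integral>\<omega>'. X \<omega>' $ j \<partial>M)) \<partial>M)"


primrec k_times_cont_differentiable :: "nat \<Rightarrow> ('b::euclidean_space \<Rightarrow> real) \<Rightarrow> bool" where
  "k_times_cont_differentiable 0 f \<longleftrightarrow> continuous_on UNIV f"
| "k_times_cont_differentiable (Suc k) f \<longleftrightarrow>
     f differentiable_on UNIV \<and>
     (\<forall>b\<in>Basis. k_times_cont_differentiable k (\<lambda>x. frechet_derivative f (at x) b))"

definition test_function :: "('b::euclidean_space \<Rightarrow> real) \<Rightarrow> bool" where
  "test_function \<phi> \<longleftrightarrow>
     (\<forall>k. k_times_cont_differentiable k \<phi>) \<and> compact (closure {x. \<phi> x \<noteq> 0})"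

definition locally_integrable ::
    "('b::euclidean_space \<Rightarrow> 'c::{banach, second_countable_topology}) \<Rightarrow> bool" where
  "locally_integrable f \<longleftrightarrow> (\<forall>K. compact K \<longrightarrow> set_integrable lborel K f)"

definition has_weak_gradient :: "('b::euclidean_space \<Rightarrow> real) \<Rightarrow> ('b \<Rightarrow> 'b) \<Rightarrow> bool" where
  "has_weak_gradient p g \<longleftrightarrow> locally_integrable g \<and>
     (\<forall>\<phi>. test_function \<phi> \<longrightarrow>
       (\<integral>x. p x *\<^sub>R gradient \<phi> x \<partial>lborel) = - (\<integral>x. \<phi> x *\<^sub>R g x \<partial>lborel))"

definition W11_loc :: "('b::euclidean_space \<Rightarrow> real) set" where
  "W11_loc = {p. locally_integrable p \<and> (\<exists>g. has_weak_gradient p g)}"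

text \<open>Unique up to Lebesgue null sets.\<close>

definition weak_gradient :: "('b::euclidean_space \<Rightarrow> real) \<Rightarrow> 'b \<Rightarrow> 'b" where
  "weak_gradient p = (SOME g. has_weak_gradient p g)"


definition lebesgue_density :: "'a measure \<Rightarrow> ('a \<Rightarrow> 'b::euclidean_space) \<Rightarrow> 'b \<Rightarrow> real" where
  "lebesgue_density M X x = enn2real (RN_deriv lborel (distr M borel X) x)"

definition std_gaussian_density :: "'b::euclidean_space \<Rightarrow> real" where
  "std_gaussian_density x = (\<Prod>b\<in>Basis. std_normal_density (x \<bullet> b))"

text \<open>Where \<open>p\<close> vanishes, the quotient \<open>\<nabla>p / p\<close> takes the junk value zero, but there
  the integrand carries the factor \<open>p x = 0\<close>. Besides the case of a density outside \<open>W11_loc\<close>, the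
  value \<open>\<infinity>\<close> is also assigned to random vectors without a Lebesgue density.\<close>

definition relative_fisher_information ::
    "'a measure \<Rightarrow> ('a \<Rightarrow> 'b::euclidean_space) \<Rightarrow> ennreal" where
  "relative_fisher_information M X =
     (let p = lebesgue_density M X in
      if absolutely_continuous lborel (distr M borel X) \<and> p \<in> W11_loc
      then \<integral>\<^sup>+x. ennreal ((norm (weak_gradient p x /\<^sub>R p x
                     - gradient (\<lambda>z. ln (std_gaussian_density z)) x))\<^sup>2 * p x) \<partial>lborel
      else \<infinity>)"

end

theory Submission
  imports Defs
begin

text \<open>Write \<open>\<mu>\<close> for the law of \<open>X\<^sub>1\<close>, \<open>p\<close> for its density, \<open>\<rho> = \<nabla>p / p\<close> for its score, \<open>h x = \<rho> x + x\<close> and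
  \<open>J = E|h|\<^sup>2 = E|\<rho>|\<^sup>2 - d\<close>. The Poincare inequality and Riesz representation solve, for each basis vector
  \<open>k\<close>, the equation \<open>E[Q\<^sub>k \<bullet> \<nabla>\<phi>] = - E[(h \<bullet> k) \<phi>]\<close> by a centred field \<open>Q\<^sub>k\<close>; after a shift by a multiple of the
  score these satisfy \<open>E|\<rho>|\<^sup>2 * (\<Sum>k. E|Q\<^sub>k|\<^sup>2) \<le> R d J\<close>. Let \<open>W\<^sub>k\<close> be the combination with weights \<open>1 - l\<close> and \<open>l\<close> of
  \<open>(1 / sqrt n) * (\<Sum>i. h (X\<^sub>i) \<bullet> k)\<close> and \<open>(1 / (sqrt n * (n - 1))) * (\<Sum>i \<noteq> j. \<rho> (X\<^sub>i) \<bullet> Q\<^sub>k (X\<^sub>j))\<close>.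
  Integrating by parts in \<open>X\<^sub>i\<close> and then in \<open>X\<^sub>j\<close> shows that both represent the score of \<open>Z\<^sub>n\<close> relative to the
  Gaussian one, so \<open>J(Z\<^sub>n) \<le> E|W|\<^sup>2\<close> by projection onto functions of \<open>Z\<^sub>n\<close>. By independence the two are
  orthogonal and \<open>E|W|\<^sup>2 \<le> ((1 - l)\<^sup>2 + l\<^sup>2 * 2 d R / (n - 1)) J\<close>; the optimal \<open>l = (n - 1) / (2 d R + n - 1)\<close>
  gives the bound.\<close>

section \<open>Smooth functions and test functions\<close>

text \<open>The shift of the fields is what makes the bound linear in J. The normalised pair terms
  have total variance at most 2 E|\<rho>|^2 * (\<Sum>k. E|Q_k|^2) / (n - 1), and E|\<rho>|^2 = J +
  d. Solving directly with right side h gives only \<Sum>k. E|Q_k|^2 \<le> R J, and the product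
  would be quadratic in J. But the constant field k solves the equation with right side \<rho>
  \<bullet> k, so Riesz representation may start from s \<rho> + x for any real s and be corrected
  by a constant. The least value of E|s \<rho> + x|^2 is d J / (J + d), whose denominator cancels
  E|\<rho>|^2; this is the d in the final constant. The 2 comes from the two orderings of a pair of
  indices, the only distinct pair terms that can be correlated.

  Two obstacles come from the weak formulation. The score is a quotient with value zero where the
  density vanishes, so integration by parts against the law needs the weak gradient to vanish there
  almost everywhere. And the density of Z_n is not known beforehand to lie in
  \<open>W11_loc\<close>: the representer itself supplies the weak gradient, so membership and bound
  come out together.\<close>

abbreviation (input) "ktcd \<equiv> k_times_cont_differentiable"

definition smooth_function :: "('b::euclidean_space \<Rightarrow> real) \<Rightarrow> bool" where
  "smooth_function f \<longleftrightarrow> (\<forall>k. ktcd k f)"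

text \<open>By uniqueness of the Frechet derivative any explicit derivative may stand in for the
  chosen \<open>frechet_derivative\<close>, so the closure properties below follow by induction from
  the usual differentiation rules.\<close>

lemma ktcd_SucI:
  assumes "\<And>x. (f has_derivative f' x) (at x)"
    and "\<And>b. b \<in> Basis \<Longrightarrow> ktcd k (\<lambda>x. f' x b)"
  shows "ktcd (Suc k) f"
proof -
  have "frechet_derivative f (at x) = f' x" for x
    using frechet_derivative_at[OF assms(1)] by simp
  moreover have "f differentiable_on UNIV"
    using assms(1) by (auto simp: differentiable_on_def differentiable_def)
  ultimately show ?thesis using assms(2) by auto
qed

lemma ktcd_SucD:
  assumes "ktcd (Suc k) f"
  shows "(f has_derivative frechet_derivative f (at x)) (at x)"
    and "b \<in> Basis \<Longrightarrow> ktcd k (\<lambda>x. frechet_derivative f (at x) b)"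
  using assms by (auto simp: differentiable_on_def frechet_derivative_works)

lemma ktcd_continuous: "ktcd k f \<Longrightarrow> continuous_on UNIV f"
  by (cases k) (auto intro: differentiable_imp_continuous_on)

lemma ktcd_decrease: "ktcd (Suc k) f \<Longrightarrow> ktcd k f"
proof (induction k arbitrary: f)
  case 0
  then show ?case using ktcd_continuous by fastforce
next
  case (Suc k)
  show ?case
    by (rule ktcd_SucI[OF ktcd_SucD(1)[OF Suc.prems]]) (use Suc.IH ktcd_SucD(2)[OF Suc.prems] in blast)
qed

lemma ktcd_const: "ktcd k (\<lambda>x. c)"
proof (induction k arbitrary: c)
  case (Suc k)
  show ?case by (rule ktcd_SucI[where f' = "\<lambda>x h. 0"]) (auto intro: Suc)
qed auto

lemma ktcd_add: "ktcd k f \<Longrightarrow> ktcd k g \<Longrightarrow> ktcd k (\<lambda>x. f x + g x)"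
proof (induction k arbitrary: f g)
  case 0
  then show ?case by (auto intro: continuous_intros)
next
  case (Suc k)
  show ?case
    by (rule ktcd_SucI[OF has_derivative_add[OF ktcd_SucD(1)[OF Suc.prems(1)] ktcd_SucD(1)[OF Suc.prems(2)]]])
       (intro Suc.IH ktcd_SucD(2)[OF Suc.prems(1)] ktcd_SucD(2)[OF Suc.prems(2)])
qed

lemma ktcd_mult: "ktcd k f \<Longrightarrow> ktcd k g \<Longrightarrow> ktcd k (\<lambda>x. f x * g x)"
proof (induction k arbitrary: f g)
  case 0
  then show ?case by (auto intro: continuous_intros)
next
  case (Suc k)
  show ?case
    by (rule ktcd_SucI[OF has_derivative_mult[OF ktcd_SucD(1)[OF Suc.prems(1)] ktcd_SucD(1)[OF Suc.prems(2)]]])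
       (intro ktcd_add Suc.IH ktcd_SucD(2)[OF Suc.prems(1)] ktcd_SucD(2)[OF Suc.prems(2)]
         ktcd_decrease[OF Suc.prems(1)] ktcd_decrease[OF Suc.prems(2)])
qed

lemma ktcd_compose:
  fixes u :: "real \<Rightarrow> real"
  shows "ktcd k u \<Longrightarrow> ktcd k f \<Longrightarrow> ktcd k (\<lambda>x. u (f x))"
proof (induction k arbitrary: u f)
  case 0
  then show ?case by (auto intro: continuous_on_compose2)
next
  case (Suc k)
  note du = ktcd_SucD(1)[OF Suc.prems(1)] and df = ktcd_SucD(1)[OF Suc.prems(2)]
  \<comment> \<open>A linear map on the reals is multiplication by its value at 1. This turns the
    chain rule into a product of two functions of \<open>x\<close>, to which
    \<open>ktcd_mult\<close> applies.\<close>
  have lin: "frechet_derivative u (at y) z = frechet_derivative u (at y) 1 * z" for y z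
    using linear_scale[OF has_derivative_linear[OF du[of y]], of z 1] by simp
  have "((\<lambda>x. u (f x)) has_derivative
      (\<lambda>h. frechet_derivative u (at (f x)) 1 * frechet_derivative f (at x) h)) (at x)" for x
    using has_derivative_compose[OF df du] by (subst lin[symmetric])
  then show ?case
    by (rule ktcd_SucI)
       (intro ktcd_mult Suc.IH[of "\<lambda>y. frechet_derivative u (at y) 1"] ktcd_SucD(2)[OF Suc.prems(1)]
         ktcd_SucD(2)[OF Suc.prems(2)] ktcd_decrease[OF Suc.prems(2)]; simp)
qed

lemma ktcd_affine:
  "ktcd k f \<Longrightarrow> ktcd k (\<lambda>x. f (c *\<^sub>R x + a))"
proof (induction k arbitrary: f)
  case 0
  then show ?case by (auto intro!: continuous_on_compose2[of UNIV f] continuous_intros)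
next
  case (Suc k)
  note df = ktcd_SucD(1)[OF Suc.prems]
  have "((\<lambda>x. f (c *\<^sub>R x + a)) has_derivative
      (\<lambda>h. c * frechet_derivative f (at (c *\<^sub>R x + a)) h)) (at x)" for x
  proof -
    have "((\<lambda>x. f (c *\<^sub>R x + a)) has_derivative
        (\<lambda>h. frechet_derivative f (at (c *\<^sub>R x + a)) (c *\<^sub>R h))) (at x)"
      by (rule has_derivative_compose[OF _ df]) (auto intro!: derivative_eq_intros)
    then show ?thesis
      using linear_scale[OF has_derivative_linear[OF df]] by simp
  qed
  then show ?case
    by (rule ktcd_SucI) (intro ktcd_mult ktcd_const Suc.IH ktcd_SucD(2)[OF Suc.prems])
qed

lemma ktcd_inner: "ktcd k (\<lambda>x. x \<bullet> a)"
proof (cases k)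
  case (Suc k)
  show ?thesis unfolding Suc
    by (rule ktcd_SucI[where f' = "\<lambda>x h. h \<bullet> a"]) (auto intro!: derivative_eq_intros ktcd_const)
qed (auto intro: continuous_intros)

lemma smooth_const: "smooth_function (\<lambda>x. c)"
  and smooth_inner: "smooth_function (\<lambda>x. x \<bullet> a)"
  and smooth_add: "smooth_function f \<Longrightarrow> smooth_function g \<Longrightarrow> smooth_function (\<lambda>x. f x + g x)"
  and smooth_mult: "smooth_function f \<Longrightarrow> smooth_function g \<Longrightarrow> smooth_function (\<lambda>x. f x * g x)"
  and smooth_affine: "smooth_function f \<Longrightarrow> smooth_function (\<lambda>x. f (c *\<^sub>R x + a))"
  and smooth_compose: "smooth_function u \<Longrightarrow> smooth_function f \<Longrightarrow> smooth_function (\<lambda>x. u (f x))"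
  for f g :: "'b::euclidean_space \<Rightarrow> real" and u :: "real \<Rightarrow> real"
  by (auto simp: smooth_function_def ktcd_const ktcd_inner ktcd_add ktcd_mult ktcd_affine ktcd_compose)

lemma smooth_prod: "(\<And>i. i \<in> A \<Longrightarrow> smooth_function (f i)) \<Longrightarrow> smooth_function (\<lambda>x. \<Prod>i\<in>A. f i x)"
  by (induction A rule: infinite_finite_induct) (auto intro: smooth_const smooth_mult)

lemma smooth_sum: "(\<And>i. i \<in> A \<Longrightarrow> smooth_function (f i)) \<Longrightarrow> smooth_function (\<lambda>x. \<Sum>i\<in>A. f i x)"
  by (induction A rule: infinite_finite_induct) (auto intro: smooth_const smooth_add)

lemma smooth_continuous: "smooth_function f \<Longrightarrow> continuous_on UNIV f"
  unfolding smooth_function_def by (meson ktcd_continuous)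

lemma smooth_has_derivative:
  "smooth_function f \<Longrightarrow> (f has_derivative frechet_derivative f (at x)) (at x)"
  unfolding smooth_function_def by (metis ktcd_SucD(1))

section \<open>Gradients of smooth functions\<close>

lemma gradient_eqI: "GDERIV f x :> D \<Longrightarrow> gradient f x = D"
proof -
  assume D: "GDERIV f x :> D"
  have "D' = D" if "GDERIV f x :> D'" for D'
  proof -
    have "(\<lambda>h. h \<bullet> D') = (\<lambda>h. h \<bullet> D)"
      using that D has_derivative_unique unfolding gderiv_def by blast
    then have "(D' - D) \<bullet> D' = (D' - D) \<bullet> D" by meson
    then have "(D' - D) \<bullet> (D' - D) = 0" by (simp add: inner_diff_right)
    then show ?thesis by simp
  qed
  then show ?thesis using D unfolding gradient_def by (metis (no_types, lifting) the_equality)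
qed

lemma has_derivative_imp_GDERIV:
  fixes f :: "'b::euclidean_space \<Rightarrow> real"
  assumes "(f has_derivative f') (at x)"
  shows "GDERIV f x :> (\<Sum>b\<in>Basis. f' b *\<^sub>R b)"
proof -
  have lin: "linear f'" using assms has_derivative_linear by blast
  have "f' h = h \<bullet> (\<Sum>b\<in>Basis. f' b *\<^sub>R b)" for h
  proof -
    have "f' h = f' (\<Sum>b\<in>Basis. (h \<bullet> b) *\<^sub>R b)" by (simp add: euclidean_representation)
    also have "\<dots> = (\<Sum>b\<in>Basis. (h \<bullet> b) * f' b)"
      by (simp add: linear_sum[OF lin] linear_scale[OF lin])
    finally show ?thesis by (simp add: inner_sum_right mult.commute)
  qed
  then show ?thesis unfolding gderiv_def using assms by (metis (no_types, lifting) ext)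
qed

lemma smooth_GDERIV: "smooth_function f \<Longrightarrow> GDERIV f x :> gradient f x"
  by (metis smooth_has_derivative has_derivative_imp_GDERIV gradient_eqI)

lemma smooth_gradient_inner_Basis:
  assumes "smooth_function f" "b \<in> Basis"
  shows "gradient f x \<bullet> b = frechet_derivative f (at x) b"
  using smooth_GDERIV[OF assms(1), of x] unfolding gderiv_def
  using frechet_derivative_at by (metis inner_commute)

lemma smooth_gradient_continuous:
  assumes "smooth_function f" shows "continuous_on UNIV (gradient f)"
proof -
  have "continuous_on UNIV (\<lambda>x. gradient f x \<bullet> b)" if "b \<in> Basis" for b
  proof -
    have "ktcd (Suc 0) f" using assms by (simp only: smooth_function_def)
    from ktcd_SucD(2)[OF this that] show ?thesis
      by (simp add: smooth_gradient_inner_Basis[OF assms that])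
  qed
  then show ?thesis using continuous_on_componentwise by blast
qed

lemma gradient_add: "smooth_function f \<Longrightarrow> smooth_function g \<Longrightarrow>
    gradient (\<lambda>x. f x + g x) x = gradient f x + gradient g x"
  and gradient_mult: "smooth_function f \<Longrightarrow> smooth_function g \<Longrightarrow>
    gradient (\<lambda>x. f x * g x) x = f x *\<^sub>R gradient g x + g x *\<^sub>R gradient f x"
  by (auto intro!: gradient_eqI GDERIV_add GDERIV_mult smooth_GDERIV)

lemma gradient_const: "gradient (\<lambda>x. c) x = 0"
  and gradient_inner: "gradient (\<lambda>x. x \<bullet> a) x = a"
  by (auto intro!: gradient_eqI simp: gderiv_def intro!: derivative_eq_intros)

lemma gradient_scale: "smooth_function f \<Longrightarrow> gradient (\<lambda>x. c * f x) x = c *\<^sub>R gradient f x"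
  using gradient_mult[OF smooth_const, of f c x] by (simp add: gradient_const)

lemma gradient_affine:
  assumes "smooth_function f"
  shows "gradient (\<lambda>x. f (c *\<^sub>R x + a)) x = c *\<^sub>R gradient f (c *\<^sub>R x + a)"
proof (rule gradient_eqI, unfold gderiv_def)
  have "((\<lambda>x. f (c *\<^sub>R x + a)) has_derivative (\<lambda>h. (c *\<^sub>R h) \<bullet> gradient f (c *\<^sub>R x + a))) (at x)"
    by (rule has_derivative_compose[OF _ smooth_GDERIV[OF assms, unfolded gderiv_def]])
       (auto intro!: derivative_eq_intros)
  then show "((\<lambda>x. f (c *\<^sub>R x + a)) has_derivative (\<lambda>h. h \<bullet> (c *\<^sub>R gradient f (c *\<^sub>R x + a)))) (at x)"
    by simp
qed

section \<open>Test functions: closure, support and bounds\<close>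

lemma test_functionI:
  "smooth_function f \<Longrightarrow> bounded B \<Longrightarrow> (\<And>x. x \<notin> B \<Longrightarrow> f x = 0) \<Longrightarrow> test_function f"
  unfolding test_function_def smooth_function_def
  by (auto simp: compact_closure intro: bounded_subset)

lemma test_smooth: "test_function f \<Longrightarrow> smooth_function f"
  by (simp add: test_function_def smooth_function_def)

lemma gradient_zero_off_closed:
  assumes "closed K" "\<And>x. x \<notin> K \<Longrightarrow> f x = 0" "x \<notin> K"
  shows "gradient f x = 0"
proof (rule gradient_eqI)
  have "(f has_derivative (\<lambda>h. 0)) (at x)"
    by (rule has_derivative_transform_within_open[of "\<lambda>_. 0::real" _ x UNIV "- K"])
       (use assms in \<open>simp_all add: open_Compl\<close>)
  then show "GDERIV f x :> 0" by (simp add: gderiv_def)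
qed

lemma test_support:
  assumes "test_function f"
  obtains K where "compact K" "\<And>x. x \<notin> K \<Longrightarrow> f x = 0" "\<And>x. x \<notin> K \<Longrightarrow> gradient f x = 0"
proof -
  define K where "K = closure {x. f x \<noteq> 0}"
  have K: "compact K" using assms by (simp add: test_function_def K_def)
  have z: "f x = 0" if "x \<notin> K" for x
    using that subsetD[OF closure_subset[of "{x. f x \<noteq> 0}"], of x] unfolding K_def by auto
  show thesis
    by (rule that[of K]) (fact K, fact z, rule gradient_zero_off_closed[OF compact_imp_closed[OF K] z])
qed

lemma test_mult: "smooth_function f \<Longrightarrow> test_function g \<Longrightarrow> test_function (\<lambda>x. f x * g x)"
proof -
  assume f: "smooth_function f" and g: "test_function g"
  obtain K where K: "compact K" "\<And>x. x \<notin> K \<Longrightarrow> g x = 0" "\<And>x. x \<notin> K \<Longrightarrow> gradient g x = 0"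
    by (rule test_support[OF g]) (rule that)
  show ?thesis
    by (rule test_functionI[OF smooth_mult[OF f test_smooth[OF g]] compact_imp_bounded[OF K(1)]])
       (simp add: K(2))
qed

lemma test_scale: "test_function g \<Longrightarrow> test_function (\<lambda>x. c * g x)"
  by (rule test_mult[OF smooth_const])

lemma test_add:
  assumes "test_function f" "test_function g" shows "test_function (\<lambda>x. f x + g x)"
proof -
  obtain K where K: "compact K" "\<And>x. x \<notin> K \<Longrightarrow> f x = 0" "\<And>x. x \<notin> K \<Longrightarrow> gradient f x = 0"
    by (rule test_support[OF assms(1)]) (rule that)
  obtain L where L: "compact L" "\<And>x. x \<notin> L \<Longrightarrow> g x = 0" "\<And>x. x \<notin> L \<Longrightarrow> gradient g x = 0"
    by (rule test_support[OF assms(2)]) (rule that)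
  have "bounded (K \<union> L)" using K L by (simp add: compact_imp_bounded)
  from test_functionI[OF smooth_add[OF assms[THEN test_smooth]] this] show ?thesis
    by (simp add: K L)
qed

lemma test_zero: "test_function (\<lambda>x. 0)"
  by (rule test_functionI[of _ "{}"]) (auto intro: smooth_const)

lemma test_affine:
  assumes "test_function f" "c \<noteq> 0" shows "test_function (\<lambda>x. f (c *\<^sub>R x + a))"
proof -
  obtain K where K: "compact K" "\<And>x. x \<notin> K \<Longrightarrow> f x = 0" "\<And>x. x \<notin> K \<Longrightarrow> gradient f x = 0"
    by (rule test_support[OF assms(1)]) (rule that)
  have "bounded ((\<lambda>y. (1/c) *\<^sub>R (y - a)) ` K)"
    by (intro compact_imp_bounded compact_continuous_image K continuous_intros)
  then show ?thesis
  proof (rule test_functionI[rotated])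
    fix x assume x: "x \<notin> (\<lambda>y. (1/c) *\<^sub>R (y - a)) ` K"
    show "f (c *\<^sub>R x + a) = 0"
    proof (rule K(2))
      have "x = (1/c) *\<^sub>R ((c *\<^sub>R x + a) - a)" using assms(2) by simp
      then show "c *\<^sub>R x + a \<notin> K" using x by blast
    qed
  qed (intro smooth_affine test_smooth assms)
qed

lemma test_bounded:
  assumes "test_function f"
  obtains B where "\<And>x. \<bar>f x\<bar> \<le> B" "\<And>x. norm (gradient f x) \<le> B" "B \<ge> 0"
proof -
  obtain K where K: "compact K" "\<And>x. x \<notin> K \<Longrightarrow> f x = 0" "\<And>x. x \<notin> K \<Longrightarrow> gradient f x = 0"
    by (rule test_support[OF assms]) (rule that)
  have "bounded (f ` K)" "bounded (gradient f ` K)"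
    using smooth_continuous[OF test_smooth[OF assms]] smooth_gradient_continuous[OF test_smooth[OF assms]]
    by (auto intro!: compact_imp_bounded compact_continuous_image K intro: continuous_on_subset)
  then obtain B1 B2 where B: "\<And>x. x \<in> K \<Longrightarrow> \<bar>f x\<bar> \<le> B1" "\<And>x. x \<in> K \<Longrightarrow> norm (gradient f x) \<le> B2"
    unfolding bounded_iff by auto
  show thesis
  proof
    show "\<bar>f x\<bar> \<le> \<bar>B1\<bar> + \<bar>B2\<bar>" "norm (gradient f x) \<le> \<bar>B1\<bar> + \<bar>B2\<bar>" for x
      using B(1)[of x] B(2)[of x] K(2)[of x] K(3)[of x] by (cases "x \<in> K"; fastforce)+
  qed auto
qed

lemma test_measurable [measurable]:
  assumes "test_function f"
  shows "f \<in> borel_measurable borel" "gradient f \<in> borel_measurable borel"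
  using smooth_continuous[OF test_smooth[OF assms]] smooth_gradient_continuous[OF test_smooth[OF assms]]
  by (auto intro: borel_measurable_continuous_onI)

subsection \<open>Bumps and cutoffs\<close>

text \<open>The family is closed under differentiation up to linear combinations, which gives smoothness at \<open>0\<close>.\<close>

definition flat :: "nat \<Rightarrow> real \<Rightarrow> real" where
  "flat j x = (if x > 0 then exp (- 1 / x) / x ^ j else 0)"

text \<open>The term of order \<open>j + 2\<close> of the exponential series bounds exp (1/x) from
  below. After division by \<open>x ^ j\<close> a factor of order two in \<open>x\<close> is
  left.\<close>

lemma flat_bound: "\<bar>flat j x\<bar> \<le> fact (j + 2) * x\<^sup>2"
proof (cases "x > 0")
  case True
  have "(1/x) ^ (j+2) /\<^sub>R fact (j + 2) \<le> exp (1/x)"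
    unfolding exp_def
    using True sum_le_suminf[OF summable_exp_generic[of "1/x"], of "{j+2}"] by simp
  then have "inverse (exp (1/x)) \<le> inverse ((1/x) ^ (j+2) /\<^sub>R fact (j + 2))"
    using True by (intro le_imp_inverse_le) (auto intro!: mult_pos_pos)
  then have *: "exp (- 1 / x) \<le> fact (j + 2) * x ^ (j+2)"
    by (simp add: exp_minus power_inverse divide_inverse mult.commute del: fact_Suc power_Suc)
  have "exp (- 1 / x) / x ^ j \<le> fact (j + 2) * x\<^sup>2"
  proof -
    have "x ^ (j+2) = x\<^sup>2 * x ^ j" by (simp add: power2_eq_square)
    then show ?thesis using * True by (simp only: pos_divide_le_eq zero_less_power mult.assoc)
  qed
  then show ?thesis using True by (simp add: flat_def)
qed (simp add: flat_def)

lemma flat_deriv: "(flat j has_real_derivative (flat (j + 2) x - j * flat (j + 1) x)) (at x)"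
proof -
  consider "x > 0" | "x < 0" | "x = 0" by linarith
  then show ?thesis
  proof cases
    case 1
    have "((\<lambda>x. exp (- 1 / x) / x ^ j) has_real_derivative (flat (j + 2) x - j * flat (j + 1) x)) (at x)"
    proof (cases j)
      case 0
      then show ?thesis using 1 by (auto intro!: derivative_eq_intros simp: flat_def field_simps power2_eq_square)
    next
      case (Suc i)
      show ?thesis using 1 unfolding Suc
        by (auto intro!: derivative_eq_intros simp: flat_def field_simps power2_eq_square)
           (cases i; simp)
    qed
    then show ?thesis
      by (rule has_field_derivative_transform_within_open[of _ _ _ "{0<..}"]) (use 1 in \<open>auto simp: flat_def\<close>)
  next
    case 2
    have "((\<lambda>x. 0) has_real_derivative (flat (j + 2) x - j * flat (j + 1) x)) (at x)"
      using 2 by (simp add: flat_def)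
    then show ?thesis
      by (rule has_field_derivative_transform_within_open[of _ _ _ "{..<0}"]) (use 2 in \<open>auto simp: flat_def\<close>)
  next
    case 3
    \<comment> \<open>At 0 both terms of the claimed derivative vanish, so the difference quotient
      has to tend to 0; the quadratic bound leaves one factor of \<open>h\<close> for this.\<close>
    have "((\<lambda>h. flat j h / h) \<longlongrightarrow> 0) (at 0)"
    proof (rule Lim_null_comparison)
      show "\<forall>\<^sub>F h in at 0. norm (flat j h / h) \<le> fact (j + 2) * \<bar>h\<bar>"
      proof (rule always_eventually, rule allI)
        fix h :: real
        show "norm (flat j h / h) \<le> fact (j + 2) * \<bar>h\<bar>"
        proof (cases "h = 0")
          case False
          have "\<bar>flat j h\<bar> \<le> (fact (j + 2) * \<bar>h\<bar>) * \<bar>h\<bar>"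
            using flat_bound[of j h] by (simp add: power2_eq_square mult.assoc flip: abs_mult)
          then show ?thesis using False by (simp add: pos_divide_le_eq del: fact_Suc)
        qed simp
      qed
      show "((\<lambda>h. fact (j + 2) * \<bar>h\<bar>) \<longlongrightarrow> 0) (at (0::real))"
        by (auto intro!: tendsto_eq_intros)
    qed
    then show ?thesis using 3 by (simp add: DERIV_def flat_def)
  qed
qed

lemma smooth_flat: "smooth_function (flat j)"
proof -
  have "ktcd k (flat j)" for k
  proof (induction k arbitrary: j)
    case 0
    show ?case
      unfolding k_times_cont_differentiable.simps
      by (rule DERIV_continuous_on, rule has_field_derivative_at_within, rule flat_deriv)
  next
    case (Suc k)
    show ?case
    proof (rule ktcd_SucI)
      show "(flat j has_derivative (\<lambda>h. (flat (j + 2) x - j * flat (j + 1) x) * h)) (at x)" for x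
        using flat_deriv[of j x] by (simp add: has_field_derivative_def)
      have "ktcd k (\<lambda>x. flat (j + 2) x + (- j) * flat (j + 1) x)"
        by (intro ktcd_add ktcd_mult ktcd_const Suc)
      then show "ktcd k (\<lambda>x. (flat (j + 2) x - j * flat (j + 1) x) * b)" if "b \<in> Basis" for b
        using that by simp
    qed
  qed
  then show ?thesis by (simp add: smooth_function_def)
qed

text \<open>A smooth approximation of the indicator of \<open>box a c\<close> from below. Each
  factor is positive exactly on its side of a face, and the growing dilation \<open>Suc m\<close>
  drives its value there to 1.\<close>

definition bump :: "'b::euclidean_space \<Rightarrow> 'b \<Rightarrow> nat \<Rightarrow> 'b \<Rightarrow> real" where
  "bump a c m x = (\<Prod>b\<in>Basis. flat 0 (Suc m * (x \<bullet> b - a \<bullet> b)) * flat 0 (Suc m * (c \<bullet> b - x \<bullet> b)))"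

lemma flat0_bounds: "0 \<le> flat 0 x" "flat 0 x \<le> 1"
  by (auto simp: flat_def)

lemma bump_bounds: "0 \<le> bump a c m x" "bump a c m x \<le> 1"
  unfolding bump_def by (auto intro!: prod_nonneg prod_le_1 mult_nonneg_nonneg mult_le_one flat0_bounds)

lemma bump_zero: "x \<notin> box a c \<Longrightarrow> bump a c m x = 0"
proof -
  assume "x \<notin> box a c"
  then obtain b where b: "b \<in> Basis" "x \<bullet> b - a \<bullet> b \<le> 0 \<or> c \<bullet> b - x \<bullet> b \<le> 0"
    by (force simp: box_def not_less)
  have z: "flat 0 (Suc m * y) = 0" if "y \<le> 0" for y :: real
    using mult_nonneg_nonpos[OF of_nat_0_le_iff that, of "Suc m"] unfolding flat_def by simp
  have "flat 0 (Suc m * (x \<bullet> b - a \<bullet> b)) * flat 0 (Suc m * (c \<bullet> b - x \<bullet> b)) = 0"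
    using b(2) z by (metis mult_zero_left mult_zero_right)
  then show ?thesis unfolding bump_def using b(1) by (intro prod_zero) auto
qed

lemma test_bump: "test_function (bump a c m)"
proof (rule test_functionI[of _ "box a c"])
  have "smooth_function (\<lambda>x. flat 0 ((Suc m * (x \<bullet> b)) + (- Suc m * (a \<bullet> b))) *
      flat 0 ((- Suc m * (x \<bullet> b)) + Suc m * (c \<bullet> b)))" for b
    by (intro smooth_mult smooth_compose[OF smooth_flat] smooth_add smooth_const smooth_inner)
  then have "smooth_function (\<lambda>x. flat 0 (Suc m * (x \<bullet> b - a \<bullet> b)) * flat 0 (Suc m * (c \<bullet> b - x \<bullet> b)))" for b
    by (simp add: algebra_simps)
  then show "smooth_function (bump a c m)"
    unfolding bump_def[abs_def] by (intro smooth_prod)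
qed (auto simp: bump_zero)

lemma bump_tendsto: "(\<lambda>m. bump a c m x) \<longlonglongrightarrow> indicator (box a c) x"
proof (cases "x \<in> box a c")
  case True
  have lim: "(\<lambda>m. flat 0 (Suc m * y)) \<longlonglongrightarrow> 1" if "y > 0" for y :: real
  proof -
    have "(\<lambda>m. exp (- (1 / y) * inverse (real (Suc m)))) \<longlonglongrightarrow> exp (- (1 / y) * 0)"
      by (intro tendsto_intros LIMSEQ_inverse_real_of_nat)
    then show ?thesis using that by (simp add: flat_def divide_simps mult.commute)
  qed
  have "(\<lambda>m. bump a c m x) \<longlonglongrightarrow> (\<Prod>b\<in>(Basis::'a set). 1 * 1)"
    unfolding bump_def using True by (intro tendsto_prod tendsto_mult lim) (auto simp: box_def)
  then show ?thesis using True by simp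
qed (simp add: bump_zero)

text \<open>The profile is supported in the unit ball, and the factor \<open>exp 1\<close> gives it
  the value 1 at the centre. Dilation by \<open>Suc m\<close> spreads this value over the whole
  space in the limit.\<close>

definition cutoff :: "nat \<Rightarrow> 'b::euclidean_space \<Rightarrow> real" where
  "cutoff m x = exp 1 * flat 0 (1 - (inverse (Suc m) *\<^sub>R x) \<bullet> (inverse (Suc m) *\<^sub>R x))"

lemma smooth_inner_self: "smooth_function (\<lambda>x. x \<bullet> x)"
  by (subst euclidean_inner) (intro smooth_sum smooth_mult smooth_inner)

lemma smooth_cutoff0: "smooth_function (\<lambda>x. exp 1 * flat 0 (1 - x \<bullet> x))"
proof -
  have "smooth_function (\<lambda>x. exp 1 * flat 0 (1 + (-1) * (x \<bullet> x)))"
    by (intro smooth_mult smooth_const smooth_compose[OF smooth_flat] smooth_add smooth_inner_self)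
  then show ?thesis by simp
qed

lemma test_cutoff: "test_function (cutoff m)"
proof -
  have "test_function (\<lambda>x::'a. exp 1 * flat 0 (1 - x \<bullet> x))"
  proof (rule test_functionI[OF smooth_cutoff0 bounded_cball[of 0 1]])
    fix x :: 'a assume "x \<notin> cball 0 1"
    then have "1 < norm x * norm x" by (auto intro: less_1_mult)
    then show "exp 1 * flat 0 (1 - x \<bullet> x) = 0"
      by (simp add: flat_def dot_square_norm power2_eq_square)
  qed
  from test_affine[OF this, of "inverse (Suc m)" 0] show ?thesis
    by (simp add: cutoff_def[abs_def])
qed

lemma cutoff_bounds: "0 \<le> cutoff m x" "cutoff m x \<le> 1"
proof -
  show "0 \<le> cutoff m x" by (simp add: cutoff_def flat0_bounds)
  have "flat 0 (1 - y) \<le> exp (- 1)" if "y \<ge> 0" for y :: real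
    using that by (auto simp: flat_def field_simps)
  from this[of "(inverse (Suc m) *\<^sub>R x) \<bullet> (inverse (Suc m) *\<^sub>R x)"]
  have "exp 1 * flat 0 (1 - (inverse (Suc m) *\<^sub>R x) \<bullet> (inverse (Suc m) *\<^sub>R x)) \<le> exp 1 * exp (- 1)"
    by (intro mult_left_mono) auto
  then show "cutoff m x \<le> 1" unfolding cutoff_def by (simp flip: exp_add)
qed

lemma cutoff_tendsto: "(\<lambda>m. cutoff m x) \<longlonglongrightarrow> 1"
proof -
  have "isCont (flat 0) 1"
    using smooth_continuous[OF smooth_flat] by (simp add: continuous_on_eq_continuous_at)
  moreover have "(\<lambda>m. 1 - (inverse (real (Suc m)) *\<^sub>R x) \<bullet> (inverse (real (Suc m)) *\<^sub>R x)) \<longlonglongrightarrow> 1 - (0 *\<^sub>R x) \<bullet> (0 *\<^sub>R x)"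
    by (intro tendsto_intros LIMSEQ_inverse_real_of_nat)
  ultimately have "(\<lambda>m. cutoff m x) \<longlonglongrightarrow> exp 1 * flat 0 1"
    unfolding cutoff_def by (intro tendsto_intros isCont_tendsto_compose[of _ "flat 0"]) auto
  then show ?thesis by (simp add: flat_def flip: exp_add)
qed

text \<open>Dilation divides the gradient by \<open>Suc m\<close>, and the gradient vanishes beyond
  norm \<open>Suc m\<close>. The factor lost to \<open>norm x\<close> is thus at most the factor
  gained, and the second bound is uniform in \<open>m\<close>: it supplies the majorant when a
  cutoff is multiplied by a linear function.\<close>

lemma cutoff_gradient_bound:
  obtains C where "C \<ge> 0"
    "\<And>m (x::'b::euclidean_space). norm (gradient (cutoff m) x) \<le> C / Suc m"
    "\<And>m (x::'b::euclidean_space). norm x * norm (gradient (cutoff m) x) \<le> C"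
proof -
  let ?c = "\<lambda>x::'b. exp 1 * flat 0 (1 - x \<bullet> x)"
  have c0: "cutoff 0 = ?c" by (simp add: cutoff_def[abs_def])
  obtain C where C: "C \<ge> 0" "\<And>x. norm (gradient ?c x) \<le> C"
    by (rule test_bounded[OF test_cutoff[of 0, where ?'a = 'b], unfolded c0]) (rule that)
  have g: "gradient (cutoff m) x = inverse (Suc m) *\<^sub>R gradient ?c (inverse (Suc m) *\<^sub>R x)" for m x
    using gradient_affine[OF smooth_cutoff0, of "inverse (Suc m)" 0 x] by (simp add: cutoff_def[abs_def])
  have z: "gradient ?c y = 0" if "norm y > 1" for y
  proof -
    have z0: "?c x = 0" if "x \<notin> cball 0 1" for x
    proof -
      have "1 < norm x * norm x" using that by (auto intro: less_1_mult)
      then show ?thesis by (simp add: flat_def dot_square_norm power2_eq_square)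
    qed
    show ?thesis by (rule gradient_zero_off_closed[of "cball 0 1", OF closed_cball z0]) (use that in auto)
  qed
  show thesis
  proof
    show "norm (gradient (cutoff m) x) \<le> C / Suc m" for m and x :: 'b
      using mult_left_mono[OF C(2)[of "inverse (real (Suc m)) *\<^sub>R x"], of "inverse (real (Suc m))"]
      by (simp add: g divide_inverse mult.commute)
    show "norm x * norm (gradient (cutoff m) x) \<le> C" for m and x :: 'b
    proof (cases "norm (inverse (real (Suc m)) *\<^sub>R x) > 1")
      case True
      then show ?thesis using C(1) by (simp add: g z)
    next
      case False
      have "norm x * norm (gradient (cutoff m) x)
          = norm (inverse (Suc m) *\<^sub>R x) * norm (gradient ?c (inverse (Suc m) *\<^sub>R x))"
        by (simp add: g)
      also have "\<dots> \<le> 1 * C" using False C by (intro mult_mono) auto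
      finally show ?thesis by simp
    qed
  qed (rule C(1))
qed

section \<open>Locally integrable functions and weak gradients\<close>

text \<open>Integrability on balls gives measurability of the truncations only; \<open>f\<close> is
  their pointwise limit.\<close>

lemma locally_integrable_measurable:
  assumes "locally_integrable f" shows "f \<in> borel_measurable borel"
proof (rule borel_measurable_LIMSEQ_metric)
  show "(\<lambda>x. indicator (cball 0 (real n)) x *\<^sub>R f x) \<in> borel_measurable borel" for n
    using assms unfolding locally_integrable_def set_integrable_def
    by (metis borel_measurable_integrable compact_cball measurable_lborel2)
  show "(\<lambda>n. indicator (cball 0 (real n)) x *\<^sub>R f x) \<longlonglongrightarrow> f x" for x
  proof (rule tendsto_eventually)
    show "\<forall>\<^sub>F n in sequentially. indicator (cball 0 (real n)) x *\<^sub>R f x = f x"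
      using eventually_ge_at_top[of "nat \<lceil>norm x\<rceil>"]
      by eventually_elim (auto simp: indicator_def nat_ceiling_le_eq)
  qed
qed

lemma locally_integrable_dominated:
  fixes f :: "'b::euclidean_space \<Rightarrow> 'd::{banach, second_countable_topology}"
  assumes "locally_integrable g" "compact K" "f \<in> borel_measurable borel"
    and "\<And>x. norm (f x) \<le> B * (indicator K x * norm (g x))"
  shows "integrable lborel f"
proof (rule Bochner_Integration.integrable_bound)
  show "integrable lborel (\<lambda>x. B *\<^sub>R (indicator K x *\<^sub>R g x))"
    using assms(1,2) unfolding locally_integrable_def set_integrable_def
    by (intro integrable_scaleR_right) blast
  show "AE x in lborel. norm (f x) \<le> norm (B *\<^sub>R (indicator K x *\<^sub>R g x))"
  proof (rule AE_I2)
    fix x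
    have "norm (f x) \<le> B * (indicator K x * norm (g x))" by (rule assms)
    also have "\<dots> \<le> \<bar>B\<bar> * (indicator K x * norm (g x))" by (intro mult_right_mono) auto
    finally show "norm (f x) \<le> norm (B *\<^sub>R (indicator K x *\<^sub>R g x))" by (simp add: abs_mult mult.assoc)
  qed
qed (use assms(3) in auto)

lemma integrable_test_scaleR:
  assumes "locally_integrable g" "test_function \<phi>"
  shows "integrable lborel (\<lambda>x. \<phi> x *\<^sub>R g x)"
proof -
  obtain K where K: "compact K" "\<And>x. x \<notin> K \<Longrightarrow> \<phi> x = 0" "\<And>x. x \<notin> K \<Longrightarrow> gradient \<phi> x = 0"
    by (rule test_support[OF assms(2)]) (rule that)
  obtain B where B: "\<And>x. \<bar>\<phi> x\<bar> \<le> B" "\<And>x. norm (gradient \<phi> x) \<le> B" "B \<ge> 0"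
    by (rule test_bounded[OF assms(2)]) (rule that)
  note [measurable] = locally_integrable_measurable[OF assms(1)] test_measurable[OF assms(2)]
  show ?thesis
  proof (rule locally_integrable_dominated[OF assms(1) K(1)])
    show "norm (\<phi> x *\<^sub>R g x) \<le> B * (indicator K x * norm (g x))" for x
      using B(1)[of x] K(2)[of x] by (cases "x \<in> K") (auto intro: mult_right_mono)
  qed measurable
qed

lemma integrable_scaleR_test_gradient:
  assumes "locally_integrable p" "test_function \<phi>"
  shows "integrable lborel (\<lambda>x. p x *\<^sub>R gradient \<phi> x)"
proof -
  obtain K where K: "compact K" "\<And>x. x \<notin> K \<Longrightarrow> \<phi> x = 0" "\<And>x. x \<notin> K \<Longrightarrow> gradient \<phi> x = 0"
    by (rule test_support[OF assms(2)]) (rule that)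
  obtain B where B: "\<And>x. \<bar>\<phi> x\<bar> \<le> B" "\<And>x. norm (gradient \<phi> x) \<le> B" "B \<ge> 0"
    by (rule test_bounded[OF assms(2)]) (rule that)
  note [measurable] = locally_integrable_measurable[OF assms(1)] test_measurable[OF assms(2)]
  show ?thesis
  proof (rule locally_integrable_dominated[OF assms(1) K(1)])
    show "norm (p x *\<^sub>R gradient \<phi> x) \<le> B * (indicator K x * norm (p x))" for x
      using mult_left_mono[OF B(2)[of x], of "\<bar>p x\<bar>"] K(3)[of x]
      by (cases "x \<in> K") (auto simp: mult.commute)
  qed measurable
qed

lemma locally_integrable_integrable: "integrable lborel f \<Longrightarrow> locally_integrable f"
  unfolding locally_integrable_def set_integrable_def
  by (auto intro!: integrable_mult_indicator dest: compact_imp_closed)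

lemma locally_integrable_add:
  "locally_integrable f \<Longrightarrow> locally_integrable g \<Longrightarrow> locally_integrable (\<lambda>x. f x + g x)"
  and locally_integrable_diff:
  "locally_integrable f \<Longrightarrow> locally_integrable g \<Longrightarrow> locally_integrable (\<lambda>x. f x - g x)"
  by (auto simp: locally_integrable_def intro: set_integral_add set_integral_diff)

lemma locally_integrable_inner:
  "locally_integrable g \<Longrightarrow> locally_integrable (\<lambda>x. g x \<bullet> a)"
  unfolding locally_integrable_def set_integrable_def
  by (auto dest!: spec intro: integrable_inner_left simp flip: inner_scaleR_left)

text \<open>Integrals against the bumps determine the integrals over boxes, hence over Borel sets.\<close>

lemma test_functions_separate:
  fixes f :: "'b::euclidean_space \<Rightarrow> real"
  assumes f: "locally_integrable f" and z: "\<And>\<phi>. test_function \<phi> \<Longrightarrow> (\<integral>x. \<phi> x * f x \<partial>lborel) = 0"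
  shows "AE x in lborel. f x = 0"
proof -
  note fm [measurable] = locally_integrable_measurable[OF f]
  have sb: "set_integrable lborel (box a c) f" for a c
  proof -
    have "set_integrable lborel (cbox a c) f" using f by (simp add: locally_integrable_def)
    then show ?thesis by (rule set_integrable_subset) (auto simp: box_subset_cbox)
  qed
  have box0: "(LINT x:box a c|lborel. f x) = 0" for a c
  proof -
    have "(\<lambda>m. \<integral>x. bump a c m x * f x \<partial>lborel) \<longlonglongrightarrow> (\<integral>x. indicator (box a c) x * f x \<partial>lborel)"
    proof (rule integral_dominated_convergence)
      show "integrable lborel (\<lambda>x. norm (indicator (box a c) x *\<^sub>R f x))"
        using sb[of a c] unfolding set_integrable_def by (rule integrable_norm)
      show "AE x in lborel. (\<lambda>m. bump a c m x * f x) \<longlonglongrightarrow> indicator (box a c) x * f x"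
        by (intro AE_I2 tendsto_mult bump_tendsto tendsto_const)
      show "AE x in lborel. norm (bump a c m x * f x) \<le> norm (indicator (box a c) x *\<^sub>R f x)" for m
      proof (rule AE_I2)
        fix x
        show "norm (bump a c m x * f x) \<le> norm (indicator (box a c) x *\<^sub>R f x)"
          using bump_bounds[of a c m x] bump_zero[of x a c m]
          by (cases "x \<in> box a c") (auto simp: abs_mult intro!: mult_left_le_one_le)
      qed
      show "(\<lambda>x. bump a c m x * f x) \<in> borel_measurable lborel" for m
        using test_measurable(1)[OF test_bump[of a c m]] by measurable
    qed auto
    then show ?thesis using z[OF test_bump]
      by (simp add: set_lebesgue_integral_def LIMSEQ_const_iff)
  qed
  \<comment> \<open>Truncation to a large box makes \<open>?F\<close> integrable on the whole space.
    The complement step of the induction and \<open>density_unique_real\<close> both rely on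
    that.\<close>
  have AEn: "AE x in lborel. indicator (box (- real n *\<^sub>R One) (real n *\<^sub>R One)) x * f x = 0" for n
  proof -
    let ?B = "box (- real n *\<^sub>R One) (real n *\<^sub>R One) :: 'b set"
    let ?F = "\<lambda>x. indicator ?B x * f x"
    have FI: "integrable lborel ?F" using sb[of "- real n *\<^sub>R One" "real n *\<^sub>R One"] unfolding set_integrable_def by simp
    have FS: "set_integrable lborel A ?F" if "A \<in> sets borel" for A
      using FI that unfolding set_integrable_def by (intro integrable_mult_indicator) auto
    have "(LINT x:A|lborel. ?F x) = 0" if A: "A \<in> sets borel" for A
    proof -
      have SS: "A \<in> sigma_sets UNIV (range (\<lambda>(a, b). box a b))"
        using A by (subst (asm) borel_eq_box) auto
      have IS: "Int_stable (range (\<lambda>(a, b). box a b :: 'b set))"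
      proof (rule Int_stableI)
        fix S T :: "'b set" assume "S \<in> range (\<lambda>(a, b). box a b)" "T \<in> range (\<lambda>(a, b). box a b)"
        then obtain a b c d where ST: "S = box a b" "T = box c d" by auto
        obtain u v where "box a b \<inter> box c d = box u v" unfolding box_Int_box by blast
        then have "S \<inter> T = (\<lambda>(a, b). box a b) (u, v)" by (simp add: ST)
        then show "S \<inter> T \<in> range (\<lambda>(a, b). box a b)" by (rule range_eqI)
      qed
      have "range (\<lambda>(a, b). box a b :: 'b set) \<subseteq> Pow UNIV" by simp
      from IS this SS show ?thesis
      proof (induction rule: sigma_sets_induct_disjoint)
        case (basic A)
        then obtain a c where A: "A = box a c" by auto
        obtain a' c' where "A \<inter> ?B = box a' c'" unfolding A box_Int_box by blast
        then have "indicator A x *\<^sub>R ?F x = indicator (box a' c') x *\<^sub>R f x" for x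
          by (simp flip: indicator_inter_arith mult.assoc)
        then show ?case using box0[of a' c'] unfolding set_lebesgue_integral_def by presburger
      next
        case empty
        then show ?case by (simp add: set_lebesgue_integral_def)
      next
        case (compl A)
        then have A: "A \<in> sets borel" by (subst borel_eq_box) simp
        have "(LINT x:A|lborel. ?F x) + (LINT x:(UNIV - A)|lborel. ?F x) = (LINT x:A \<union> (UNIV - A)|lborel. ?F x)"
          using A by (intro set_integral_Un[symmetric] FS) auto
        also have "\<dots> = 0" using box0[of "- real n *\<^sub>R One" "real n *\<^sub>R One"] by (simp add: set_lebesgue_integral_def)
        finally show ?case using compl by simp
      next
        case (union A)
        then have A: "A i \<in> sets borel" for i by (subst borel_eq_box) auto
        have "(LINT x:(\<Union>i. A i)|lborel. ?F x) = (\<Sum>i. LINT x:A i|lborel. ?F x)"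
          using A union(1) by (intro lebesgue_integral_countable_add FS) (auto simp: disjoint_family_on_def)
        then show ?case using union by simp
      qed
    qed
    then have "AE x in lborel. ?F x = (\<lambda>x. 0) x"
      by (intro density_unique_real[OF FI]) (auto simp: set_lebesgue_integral_def)
    then show ?thesis by simp
  qed
  have "AE x in lborel. \<forall>n. indicator (box (- real n *\<^sub>R One) (real n *\<^sub>R One)) x * f x = 0"
    using AEn by (intro AE_all_countable[THEN iffD2] allI)
  then show ?thesis
  proof eventually_elim
    case (elim x)
    obtain n where n: "norm x < real n" using reals_Archimedean2 by blast
    have "x \<in> box (- real n *\<^sub>R One) (real n *\<^sub>R One)"
      using n Basis_le_norm[of _ x] unfolding box_def by (auto simp: abs_le_iff) (smt (verit))+
    then show ?case using elim[rule_format, of n] by simp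
  qed
qed

section \<open>Weak gradients: components and uniqueness\<close>

lemma weak_gradient_integral:
  assumes "has_weak_gradient p g" "locally_integrable p" "test_function \<phi>"
  shows "(\<integral>x. p x * (gradient \<phi> x \<bullet> e) \<partial>lborel) = - (\<integral>x. \<phi> x * (g x \<bullet> e) \<partial>lborel)"
proof -
  have g: "locally_integrable g" using assms(1) by (simp add: has_weak_gradient_def)
  have "(\<integral>x. p x *\<^sub>R gradient \<phi> x \<partial>lborel) \<bullet> e = (- (\<integral>x. \<phi> x *\<^sub>R g x \<partial>lborel)) \<bullet> e"
    using assms by (simp add: has_weak_gradient_def)
  then show ?thesis
    using integrable_scaleR_test_gradient[OF assms(2,3)] integrable_test_scaleR[OF g assms(3)]
    by (simp flip: integral_inner_left)
qed

text \<open>This makes the arbitrary choice in \<open>weak_gradient\<close> harmless. Each component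
  of the difference annihilates all test functions, so \<open>test_functions_separate\<close>
  applies.\<close>

lemma weak_gradient_unique:
  assumes "has_weak_gradient p g" "has_weak_gradient p g'"
  shows "AE x in lborel. g x = g' x"
proof -
  have l: "locally_integrable g" "locally_integrable g'"
    using assms by (auto simp: has_weak_gradient_def)
  have "AE x in lborel. \<forall>b\<in>Basis. (g x - g' x) \<bullet> b = 0"
  proof (rule AE_ball_countable'[OF _ countable_finite[OF finite_Basis]])
    fix b :: 'a assume "b \<in> Basis"
    show "AE x in lborel. (g x - g' x) \<bullet> b = 0"
    proof (rule test_functions_separate)
      show "locally_integrable (\<lambda>x. (g x - g' x) \<bullet> b)"
        by (intro locally_integrable_inner locally_integrable_diff l)
      fix \<phi> :: "'a \<Rightarrow> real" assume t: "test_function \<phi>"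
      have "(\<integral>x. \<phi> x *\<^sub>R g x \<partial>lborel) = (\<integral>x. \<phi> x *\<^sub>R g' x \<partial>lborel)"
        using assms t unfolding has_weak_gradient_def by (metis neg_equal_iff_equal)
      then have "(\<integral>x. (\<phi> x *\<^sub>R g x - \<phi> x *\<^sub>R g' x) \<bullet> b \<partial>lborel) = 0"
        using integrable_test_scaleR[OF l(1) t] integrable_test_scaleR[OF l(2) t] by simp
      then show "(\<integral>x. \<phi> x * ((g x - g' x) \<bullet> b) \<partial>lborel) = 0"
        by (simp add: algebra_simps)
    qed
  qed
  then show ?thesis by eventually_elim (metis euclidean_all_zero_iff right_minus_eq)
qed

section \<open>The weak gradient vanishes where the density does\<close>

lemma lborel_integrable_translate:
  fixes f :: "'b::euclidean_space \<Rightarrow> 'd::{banach, second_countable_topology}"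
  assumes "integrable lborel f" shows "integrable lborel (\<lambda>x. f (x + c))"
proof -
  have "f \<in> borel_measurable lborel" using assms by auto
  then have "integrable lborel f \<longleftrightarrow> integrable lborel (\<lambda>x. f (c + x))"
    by (subst lborel_distr_plus[of c, symmetric], subst integrable_distr_eq) auto
  then show ?thesis using assms by (simp add: add.commute)
qed

lemma lborel_integral_translate:
  fixes f :: "'b::euclidean_space \<Rightarrow> 'd::{banach, second_countable_topology}"
  assumes "f \<in> borel_measurable borel"
  shows "(\<integral>x. f (x + c) \<partial>lborel) = (\<integral>x. f x \<partial>lborel)"
  using assms by (subst (2) lborel_distr_plus[of c, symmetric], subst integral_distr) (auto simp: add.commute)

lemma lborel_nn_integral_translate:
  fixes f :: "'b::euclidean_space \<Rightarrow> ennreal"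
  assumes "f \<in> borel_measurable borel"
  shows "(\<integral>\<^sup>+x. f (x + c) \<partial>lborel) = (\<integral>\<^sup>+x. f x \<partial>lborel)"
  using assms by (subst (2) lborel_distr_plus[of c, symmetric], subst nn_integral_distr) (auto simp: add.commute)

text \<open>This justifies the exchanges of position and shift length below. For fixed
  \<open>s\<close>, translating by \<open>s *\<^sub>R v\<close> leaves \<open>a\<close> unshifted
  and moves \<open>\<psi>\<close> alone by a multiple of \<open>u - v\<close>. For all
  \<open>s\<close> in \<open>{0..t}\<close> the support of the moved \<open>\<psi>\<close> stays in
  the one ball \<open>K'\<close>, on which \<open>a\<close> is integrable.\<close>

lemma integrable_shift_pair:
  fixes a \<psi> :: "'b::euclidean_space \<Rightarrow> real"
  assumes a: "locally_integrable a" and m[measurable]: "\<psi> \<in> borel_measurable borel"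
    and B: "\<And>x. \<bar>\<psi> x\<bar> \<le> B" and K: "compact K" "\<And>x. x \<notin> K \<Longrightarrow> \<psi> x = 0"
  shows "integrable (lborel \<Otimes>\<^sub>M lborel) (\<lambda>(x, s). indicator {0..t} s * (\<psi> (x + s *\<^sub>R u) * a (x + s *\<^sub>R v)))"
proof (rule integrableI_bounded)
  note [measurable] = locally_integrable_measurable[OF a]
  obtain r where r: "K \<subseteq> cball 0 r" using compact_imp_bounded[OF K(1)] by (auto simp: bounded_iff subset_iff)
  define K' where "K' = cball (0::'b) (r + \<bar>t\<bar> * norm (u - v))"
  have B0: "B \<ge> 0" using B[of 0] by linarith
  have L: "integrable lborel (\<lambda>x. indicator K' x *\<^sub>R a x)"
    using a unfolding locally_integrable_def set_integrable_def K'_def by auto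
  have bnd: "\<bar>\<psi> (x + s *\<^sub>R (u - v)) * a x\<bar> \<le> B * \<bar>indicator K' x *\<^sub>R a x\<bar>" if s: "s \<in> {0..t}" for x s
  proof (cases "x \<in> K'")
    case True
    then show ?thesis using B[of "x + s *\<^sub>R (u - v)"] by (auto simp: abs_mult intro: mult_right_mono)
  next
    case False
    have "norm (s *\<^sub>R (u - v)) \<le> \<bar>t\<bar> * norm (u - v)" using s by (auto intro!: mult_right_mono)
    then have "norm (x + s *\<^sub>R (u - v)) > r"
      using False norm_diff_ineq[of x "s *\<^sub>R (u - v)"] by (simp add: K'_def)
    then have "x + s *\<^sub>R (u - v) \<notin> K" using r by auto
    then show ?thesis using B0 by (simp add: K(2))
  qed
  let ?F = "\<lambda>x s. indicator {0..t} s * (\<psi> (x + s *\<^sub>R u) * a (x + s *\<^sub>R v))"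
  have inner: "(\<integral>\<^sup>+x. ennreal (norm (?F x s)) \<partial>lborel)
      \<le> indicator {0..t} s * (\<integral>\<^sup>+x. ennreal (B * \<bar>indicator K' x *\<^sub>R a x\<bar>) \<partial>lborel)" for s
  proof (cases "s \<in> {0..t}")
    case True
    have "(\<integral>\<^sup>+x. ennreal (norm (?F x s)) \<partial>lborel)
        = (\<integral>\<^sup>+x. ennreal \<bar>\<psi> ((x + s *\<^sub>R v) + s *\<^sub>R (u - v)) * a (x + s *\<^sub>R v)\<bar> \<partial>lborel)"
      using True by (simp add: algebra_simps)
    also have "\<dots> = (\<integral>\<^sup>+x. ennreal \<bar>\<psi> (x + s *\<^sub>R (u - v)) * a x\<bar> \<partial>lborel)"
      by (rule lborel_nn_integral_translate) measurable
    also have "\<dots> \<le> (\<integral>\<^sup>+x. ennreal (B * \<bar>indicator K' x *\<^sub>R a x\<bar>) \<partial>lborel)"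
      by (intro nn_integral_mono ennreal_leI bnd True)
    finally show ?thesis using True by simp
  qed simp
  have fin: "(\<integral>\<^sup>+x. ennreal (B * \<bar>indicator K' x *\<^sub>R a x\<bar>) \<partial>lborel) < \<infinity>"
    using integrable_mult_right[OF integrable_abs[OF L], of B] B0
    by (simp add: nn_integral_eq_integral)
  show me: "(\<lambda>(x, s). ?F x s) \<in> borel_measurable (lborel \<Otimes>\<^sub>M lborel)" by measurable
  have "(\<integral>\<^sup>+z. ennreal (norm (case z of (x, s) \<Rightarrow> ?F x s)) \<partial>(lborel \<Otimes>\<^sub>M lborel))
      = (\<integral>\<^sup>+s. (\<integral>\<^sup>+x. ennreal (norm (?F x s)) \<partial>lborel) \<partial>lborel)"
    by (subst lborel_pair.nn_integral_snd[symmetric]) measurable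
  also have "\<dots> \<le> (\<integral>\<^sup>+s. indicator {0..t} s * (\<integral>\<^sup>+x. ennreal (B * \<bar>indicator K' x *\<^sub>R a x\<bar>) \<partial>lborel) \<partial>lborel)"
    by (intro nn_integral_mono inner)
  also have "\<dots> = emeasure lborel {0..t} * (\<integral>\<^sup>+x. ennreal (B * \<bar>indicator K' x *\<^sub>R a x\<bar>) \<partial>lborel)"
    by (subst nn_integral_multc) auto
  also have "\<dots> < \<infinity>"
    using fin by (cases "t \<ge> 0") (auto simp: ennreal_mult_less_top)
  finally show "(\<integral>\<^sup>+z. ennreal (norm (case z of (x, s) \<Rightarrow> ?F x s)) \<partial>(lborel \<Otimes>\<^sub>M lborel)) < \<infinity>" .
qed

text \<open>Compare the two sides against a test function and apply the fundamental theorem of calculus to it.\<close>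

lemma weak_gradient_line_integral:
  fixes p :: "'b::euclidean_space \<Rightarrow> real"
  assumes p: "locally_integrable p" and g: "has_weak_gradient p g" and t: "t \<ge> 0"
  shows "AE x in lborel. p (x - t *\<^sub>R e) - p x = - (\<integral>s. indicator {0..t} s * (g (x - s *\<^sub>R e) \<bullet> e) \<partial>lborel)"
proof -
  have gl: "locally_integrable (\<lambda>x. g x \<bullet> e)"
    using g by (intro locally_integrable_inner) (simp add: has_weak_gradient_def)
  note [measurable] = locally_integrable_measurable[OF p] locally_integrable_measurable[OF gl]
  let ?G = "\<lambda>x. \<integral>s. indicator {0..t} s * (g (x - s *\<^sub>R e) \<bullet> e) \<partial>lborel"
  have lt: "locally_integrable (\<lambda>x. p (x - t *\<^sub>R e))"
    unfolding locally_integrable_def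
  proof (intro allI impI)
    fix K :: "'b set" assume "compact K"
    then have "compact ((\<lambda>x. x - t *\<^sub>R e) ` K)"
      by (intro compact_continuous_image continuous_intros)
    then have "integrable lborel (\<lambda>x. indicator ((\<lambda>x. x - t *\<^sub>R e) ` K) x *\<^sub>R p x)"
      using p unfolding locally_integrable_def set_integrable_def by blast
    from lborel_integrable_translate[OF this, of "- t *\<^sub>R e"]
    show "set_integrable lborel K (\<lambda>x. p (x - t *\<^sub>R e))"
      unfolding set_integrable_def
      by (rule Bochner_Integration.integrable_cong[THEN iffD1, OF refl, rotated])
         (auto simp: indicator_def)
  qed
  have swap: "integrable (lborel \<Otimes>\<^sub>M lborel) (\<lambda>(x, s). indicator {0..t} s * (\<psi> x * (g (x - s *\<^sub>R e) \<bullet> e)))"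
    if "\<psi> \<in> borel_measurable borel" "\<And>x. \<bar>\<psi> x\<bar> \<le> B" "compact K" "\<And>x. x \<notin> K \<Longrightarrow> \<psi> x = 0" for \<psi> B K
    using integrable_shift_pair[OF gl that, where u = 0 and v = "- e"] by simp
  have Gl: "locally_integrable ?G"
    unfolding locally_integrable_def set_integrable_def
  proof (intro allI impI)
    fix K :: "'b set" assume K: "compact K"
    then have [measurable]: "K \<in> sets borel" by (simp add: compact_imp_closed)
    have "integrable (lborel \<Otimes>\<^sub>M lborel) (\<lambda>(x, s). indicator {0..t} s * (indicator K x * (g (x - s *\<^sub>R e) \<bullet> e)))"
      by (rule swap[of _ 1 K]) (auto simp: K)
    from lborel_pair.integrable_fst[OF this]
    show "integrable lborel (\<lambda>x. indicator K x *\<^sub>R ?G x)"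
      by (simp add: mult.left_commute)
  qed
  have "AE x in lborel. p (x - t *\<^sub>R e) - p x + ?G x = 0"
  proof (rule test_functions_separate)
    show "locally_integrable (\<lambda>x. p (x - t *\<^sub>R e) - p x + ?G x)"
      by (intro locally_integrable_add locally_integrable_diff lt p Gl)
    fix \<phi> :: "'b \<Rightarrow> real" assume T: "test_function \<phi>"
    note [measurable] = test_measurable[OF T]
    obtain K where K: "compact K" "\<And>x. x \<notin> K \<Longrightarrow> \<phi> x = 0" "\<And>x. x \<notin> K \<Longrightarrow> gradient \<phi> x = 0"
      by (rule test_support[OF T]) (rule that)
    obtain B where B: "\<And>x. \<bar>\<phi> x\<bar> \<le> B" "\<And>x. norm (gradient \<phi> x) \<le> B" "B \<ge> 0"
      by (rule test_bounded[OF T]) (rule that)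
    have Ts: "test_function (\<lambda>x. \<phi> (x + c))" for c
      using test_affine[OF T, of 1 c] by simp
    have gs: "gradient (\<lambda>x. \<phi> (x + c)) x = gradient \<phi> (x + c)" for c x
      using gradient_affine[OF test_smooth[OF T], of 1 c x] by simp
    have ftc: "(\<integral>s. indicator {0..t} s * (gradient \<phi> (x + s *\<^sub>R e) \<bullet> e) \<partial>lborel) = \<phi> (x + t *\<^sub>R e) - \<phi> x" for x
    proof -
      have "(\<integral>s. (gradient \<phi> (x + s *\<^sub>R e) \<bullet> e) * indicator {0..t} s \<partial>lborel) = \<phi> (x + t *\<^sub>R e) - \<phi> (x + 0 *\<^sub>R e)"
      proof (rule integral_FTC_Icc_real[OF t])
        fix s :: real
        have "((\<lambda>s. \<phi> (x + s *\<^sub>R e)) has_derivative (\<lambda>h. (h *\<^sub>R e) \<bullet> gradient \<phi> (x + s *\<^sub>R e))) (at s)"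
          by (rule has_derivative_compose[OF _ smooth_GDERIV[OF test_smooth[OF T], unfolded gderiv_def]])
             (auto intro!: derivative_eq_intros)
        then show "((\<lambda>s. \<phi> (x + s *\<^sub>R e)) has_real_derivative gradient \<phi> (x + s *\<^sub>R e) \<bullet> e) (at s)"
          by (simp add: has_field_derivative_def inner_commute mult_commute_abs)
        show "isCont (\<lambda>s. gradient \<phi> (x + s *\<^sub>R e) \<bullet> e) s"
        proof -
          have "continuous_on UNIV (\<lambda>s. gradient \<phi> (x + s *\<^sub>R e))"
            by (rule continuous_on_compose2[OF smooth_gradient_continuous[OF test_smooth[OF T]]])
               (auto intro!: continuous_intros)
          then have "isCont (\<lambda>s. gradient \<phi> (x + s *\<^sub>R e)) s"
            by (simp add: continuous_on_eq_continuous_at)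
          then show ?thesis by (rule continuous_inner[OF _ continuous_const])
        qed
      qed
      then show ?thesis by (simp add: mult.commute)
    qed
    have P: "integrable lborel (\<lambda>x. \<phi> x * p (x - t *\<^sub>R e))" "integrable lborel (\<lambda>x. \<phi> x * p x)"
        "integrable lborel (\<lambda>x. \<phi> (x + t *\<^sub>R e) * p x)" "integrable lborel (\<lambda>x. \<phi> x * ?G x)"
      using integrable_test_scaleR[OF lt T] integrable_test_scaleR[OF p T]
        integrable_test_scaleR[OF p Ts] integrable_test_scaleR[OF Gl T] by simp_all
    have "(\<integral>x. \<phi> x * p (x - t *\<^sub>R e) \<partial>lborel) = (\<integral>x. \<phi> (x + t *\<^sub>R e) * p x \<partial>lborel)"
      using lborel_integral_translate[of "\<lambda>x. \<phi> x * p (x - t *\<^sub>R e)" "t *\<^sub>R e"] by simp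
    then have "(\<integral>x. \<phi> x * p (x - t *\<^sub>R e) - \<phi> x * p x \<partial>lborel) = (\<integral>x. (\<phi> (x + t *\<^sub>R e) - \<phi> x) * p x \<partial>lborel)"
      using P by (simp add: left_diff_distrib)
    also have "\<dots> = (\<integral>x. (\<integral>s. indicator {0..t} s * ((gradient \<phi> (x + s *\<^sub>R e) \<bullet> e) * p x) \<partial>lborel) \<partial>lborel)"
      by (simp only: ftc[symmetric] integral_mult_left_zero[symmetric] mult.assoc)
    also have "\<dots> = (\<integral>s. (\<integral>x. indicator {0..t} s * ((gradient \<phi> (x + s *\<^sub>R e) \<bullet> e) * p x) \<partial>lborel) \<partial>lborel)"
    proof (rule lborel_pair.Fubini_integral[symmetric])
      have bd: "\<bar>gradient \<phi> x \<bullet> e\<bar> \<le> B * norm e" for x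
        using Cauchy_Schwarz_ineq2[of "gradient \<phi> x" e] mult_right_mono[OF B(2), of "norm e" x] by simp
      have "(\<lambda>x. gradient \<phi> x \<bullet> e) \<in> borel_measurable borel" by measurable
      from integrable_shift_pair[OF p this bd K(1), where u = e and v = 0 and t = t]
      show "integrable (lborel \<Otimes>\<^sub>M lborel) (\<lambda>(x, s). indicator {0..t} s * ((gradient \<phi> (x + s *\<^sub>R e) \<bullet> e) * p x))"
        by (simp add: K(3))
    qed
    \<comment> \<open>The weak gradient is tested with the translate of \<open>\<phi>\<close>;
      translating back moves the shift from \<open>\<phi>\<close> to \<open>g\<close>.\<close>
    also have "\<dots> = (\<integral>s. (\<integral>x. indicator {0..t} s * (- (\<phi> x * (g (x - s *\<^sub>R e) \<bullet> e))) \<partial>lborel) \<partial>lborel)"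
    proof -
      have "(\<integral>x. (gradient \<phi> (x + s *\<^sub>R e) \<bullet> e) * p x \<partial>lborel) = - (\<integral>x. \<phi> x * (g (x - s *\<^sub>R e) \<bullet> e) \<partial>lborel)" for s
        using weak_gradient_integral[OF g p Ts, of "s *\<^sub>R e" e]
          lborel_integral_translate[of "\<lambda>x. \<phi> x * (g (x - s *\<^sub>R e) \<bullet> e)" "s *\<^sub>R e"]
        by (simp add: gs mult.commute)
      then show ?thesis by simp
    qed
    also have "\<dots> = - (\<integral>s. (\<integral>x. indicator {0..t} s * (\<phi> x * (g (x - s *\<^sub>R e) \<bullet> e)) \<partial>lborel) \<partial>lborel)"
      by simp
    also have "(\<integral>s. (\<integral>x. indicator {0..t} s * (\<phi> x * (g (x - s *\<^sub>R e) \<bullet> e)) \<partial>lborel) \<partial>lborel)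
        = (\<integral>x. (\<integral>s. indicator {0..t} s * (\<phi> x * (g (x - s *\<^sub>R e) \<bullet> e)) \<partial>lborel) \<partial>lborel)"
      by (rule lborel_pair.Fubini_integral, rule swap[of _ B K]) (auto simp: B K)
    also have "\<dots> = (\<integral>x. \<phi> x * ?G x \<partial>lborel)"
      by (simp add: mult.left_commute)
    finally show "(\<integral>x. \<phi> x * (p (x - t *\<^sub>R e) - p x + ?G x) \<partial>lborel) = 0"
      using P by (simp add: ring_distribs)
  qed
  then show ?thesis by eventually_elim simp
qed

text \<open>If the set had positive measure, it would contain a compact \<open>K\<close> of positive measure. Continuity of
  translations makes the integral of \<open>g (x - s e) \<bullet> e\<close> over \<open>K\<close> positive for small \<open>s\<close>, so by the line
  integral formula \<open>p\<close> would have negative mass on \<open>K - t e\<close>.\<close>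

lemma weak_gradient_nonpos_on_zero_set:
  fixes p :: "'b::euclidean_space \<Rightarrow> real"
  assumes p: "locally_integrable p" and g: "has_weak_gradient p g" and p0: "\<And>x. p x \<ge> 0" and c: "c > 0"
  shows "AE x in lborel. \<not> (p x = 0 \<and> norm x \<le> r \<and> c \<le> g x \<bullet> e)"
proof (rule ccontr)
  let ?g = "\<lambda>x. g x \<bullet> e"
  have gl: "locally_integrable ?g"
    using g by (intro locally_integrable_inner) (simp add: has_weak_gradient_def)
  note [measurable] = locally_integrable_measurable[OF p] locally_integrable_measurable[OF gl]
  define A where "A = {x. p x = 0 \<and> norm x \<le> r \<and> c \<le> ?g x}"
  have [measurable]: "A \<in> sets borel" unfolding A_def by measurable
  have Ab: "A \<subseteq> cball 0 r" by (auto simp: A_def)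
  assume "\<not> (AE x in lborel. \<not> (p x = 0 \<and> norm x \<le> r \<and> c \<le> g x \<bullet> e))"
  then have "emeasure lborel A \<noteq> 0"
    by (subst (asm) AE_iff_measurable[of A]) (auto simp: A_def)
  moreover have "emeasure lborel A \<le> emeasure lborel (cball (0::'b) r)" by (rule emeasure_mono[OF Ab]) simp
  then have Af: "emeasure lborel A < \<infinity>" using emeasure_lborel_cball_finite[of "0::'b" r] by (simp add: order.strict_trans1)
  ultimately have mA: "measure lborel A > 0"
    by (simp add: measure_def enn2real_positive_iff zero_less_iff_neq_zero)
  have "A \<in> sets lebesgue" by simp
  \<comment> \<open>Inner regularity. The removed part has measure strictly below that of
    \<open>A\<close>, so \<open>K\<close> keeps positive measure; its closedness is what lets small
    translations be controlled.\<close>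
  then obtain K where
    K: "closed K" "K \<subseteq> A" "A - K \<in> lmeasurable" "emeasure lebesgue (A - K) < ennreal (measure lborel A)"
    by (rule sets_lebesgue_inner_closed[OF _ mA]) (rule that)
  have cK: "compact K" using K(1) bounded_subset[OF bounded_cball subset_trans[OF K(2) Ab]] by (simp add: compact_eq_bounded_closed)
  have [measurable]: "K \<in> sets borel" using K(1) by simp
  have "emeasure lborel (A - K) < emeasure lborel A"
    using K(4) Af by (simp add: emeasure_eq_ennreal_measure less_top)
  moreover have "emeasure lborel A = emeasure lborel K + emeasure lborel (A - K)"
    using K(2) by (subst plus_emeasure) (auto intro!: arg_cong[where f = "emeasure lborel"])
  ultimately have "emeasure lborel K \<noteq> 0" by auto
  moreover have "emeasure lborel K < \<infinity>"
    using Af emeasure_mono[OF K(2), of lborel] by (simp add: order.strict_trans1)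
  ultimately have mK: "measure lborel K > 0"
    by (simp add: measure_def enn2real_positive_iff zero_less_iff_neq_zero)
  have gK: "p y = 0" "c \<le> ?g y" if "y \<in> K" for y using that K(2) by (auto simp: A_def)
  have Kr: "norm y \<le> r" if "y \<in> K" for y using that K(2) by (auto simp: A_def)
  have li: "integrable lborel (\<lambda>y. indicator (cball 0 q) y * (c + \<bar>?g y\<bar>))" for q
  proof -
    have "integrable lborel (\<lambda>y. c * indicator (cball 0 q) y + \<bar>indicator (cball 0 q) y *\<^sub>R ?g y\<bar>)"
      using gl emeasure_lborel_cball_finite[of "0::'b" q] unfolding locally_integrable_def set_integrable_def
      by (intro Bochner_Integration.integrable_add integrable_mult_right integrable_abs) (auto simp: top.not_eq_extremum)
    then show ?thesis by (simp add: abs_mult algebra_simps)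
  qed
  have Kball: "indicator K (y + s *\<^sub>R e) \<le> (indicator (cball 0 (r + norm e)) y :: real)" if "s \<in> {0..1}" for y s
  proof (cases "y + s *\<^sub>R e \<in> K")
    case True
    have "norm y \<le> norm (y + s *\<^sub>R e) + norm (s *\<^sub>R e)" using norm_triangle_ineq4[of "y + s *\<^sub>R e" "s *\<^sub>R e"] by simp
    also have "norm (s *\<^sub>R e) \<le> norm e" using that by (simp add: mult_left_le_one_le)
    finally show ?thesis using Kr[OF True] True by simp
  qed simp
  \<comment> \<open>The loss from points \<open>y\<close> outside \<open>K\<close> that the shift
    carries into \<open>K\<close>. On \<open>K\<close> the component \<open>?g\<close> is at least
    \<open>c\<close>, while elsewhere replacing \<open>c\<close> by \<open>?g y\<close> costs at
    most \<open>c + \<bar>?g y\<bar>\<close>. Hence \<open>h s\<close> below is at least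
    \<open>c * measure lborel K - \<rho> s\<close>.\<close>
  define \<rho> where "\<rho> s = (\<integral>y. indicator (- K) y * indicator K (y + s *\<^sub>R e) * (c + \<bar>?g y\<bar>) \<partial>lborel)" for s
  have \<rho>_int: "integrable lborel (\<lambda>y. indicator (- K) y * indicator K (y + s *\<^sub>R e) * (c + \<bar>?g y\<bar>))"
    and \<rho>_bd: "norm (indicator (- K) y * indicator K (y + s *\<^sub>R e) * (c + \<bar>?g y\<bar>)) \<le> indicator (cball 0 (r + norm e)) y * (c + \<bar>?g y\<bar>)"
    if "s \<in> {0..1}" for s y
  proof -
    have *: "norm (indicator (- K) y * indicator K (y + s *\<^sub>R e) * (c + \<bar>?g y\<bar>)) \<le> indicator (cball 0 (r + norm e)) y * (c + \<bar>?g y\<bar>)" for y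
      using Kball[OF that, of y] c by (auto simp: abs_mult indicator_def split: if_splits)
    then show "norm (indicator (- K) y * indicator K (y + s *\<^sub>R e) * (c + \<bar>?g y\<bar>)) \<le> indicator (cball 0 (r + norm e)) y * (c + \<bar>?g y\<bar>)" .
    show "integrable lborel (\<lambda>y. indicator (- K) y * indicator K (y + s *\<^sub>R e) * (c + \<bar>?g y\<bar>))"
      by (rule Bochner_Integration.integrable_bound[OF li[of "r + norm e"]]) (use * c in \<open>auto intro!: AE_I2 order_trans[OF *]\<close>)
  qed
  \<comment> \<open>A point outside the closed set \<open>K\<close> stays outside under small
    shifts, so by dominated convergence \<open>\<rho>\<close> tends to 0 along any sequence of
    shifts tending to 0. A sequence of counterexamples contradicts this.\<close>
  have "\<exists>n. \<forall>s\<in>{0..1 / real (Suc n)}. \<rho> s < c * measure lborel K / 2"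
  proof (rule ccontr)
    assume "\<not> ?thesis"
    then have "\<forall>n. \<exists>s. s \<in> {0..1 / real (Suc n)} \<and> \<rho> s \<ge> c * measure lborel K / 2" by (metis not_less)
    then obtain S where S: "\<And>n. S n \<in> {0..1 / real (Suc n)}" "\<And>n. \<rho> (S n) \<ge> c * measure lborel K / 2" by metis
    have S1: "S n \<in> {0..1}" for n
    proof -
      have "1 / real (Suc n) \<le> 1" by simp
      with S(1)[of n] show ?thesis unfolding atLeastAtMost_iff by (meson order_trans)
    qed
    have S0: "S \<longlonglongrightarrow> 0"
      by (rule tendsto_sandwich[OF _ _ tendsto_const LIMSEQ_inverse_real_of_nat])
         (use S(1) in \<open>auto intro!: always_eventually simp: inverse_eq_divide\<close>)
    have "(\<lambda>n. \<rho> (S n)) \<longlonglongrightarrow> (\<integral>y. 0 \<partial>(lborel :: 'b measure))"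
      unfolding \<rho>_def
    proof (rule integral_dominated_convergence[OF _ _ li[of "r + norm e"]])
      show "AE y in lborel. (\<lambda>n. indicator (- K) y * indicator K (y + S n *\<^sub>R e) * (c + \<bar>?g y\<bar>)) \<longlonglongrightarrow> 0"
      proof (rule AE_I2)
        fix y :: 'b
        show "(\<lambda>n. indicator (- K) y * indicator K (y + S n *\<^sub>R e) * (c + \<bar>?g y\<bar>)) \<longlonglongrightarrow> 0"
        proof (cases "y \<in> K")
          case False
          have "(\<lambda>n. y + S n *\<^sub>R e) \<longlonglongrightarrow> y + 0 *\<^sub>R e" by (intro tendsto_intros S0)
          then have "\<forall>\<^sub>F n in sequentially. y + S n *\<^sub>R e \<in> - K"
            using False K(1) by (intro topological_tendstoD) (auto simp: open_Compl)
          then show ?thesis by (intro tendsto_eventually) (auto elim: eventually_mono)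
        qed simp
      qed
      show "AE y in lborel. norm (indicator (- K) y * indicator K (y + S n *\<^sub>R e) * (c + \<bar>?g y\<bar>)) \<le> indicator (cball 0 (r + norm e)) y * (c + \<bar>?g y\<bar>)" for n
        by (intro AE_I2 \<rho>_bd S1)
    qed measurable
    then have "c * measure lborel K / 2 \<le> 0"
      by (intro LIMSEQ_le_const) (use S(2) in auto)
    then show False using c mK by (simp add: mult_le_0_iff)
  qed
  then obtain n where n: "\<And>s. s \<in> {0..1 / real (Suc n)} \<Longrightarrow> \<rho> s < c * measure lborel K / 2" by blast
  define t where "t = 1 / real (Suc n)"
  have t: "0 < t" "t \<le> 1" by (auto simp: t_def)
  define h where "h s = (\<integral>x. indicator K x * ?g (x - s *\<^sub>R e) \<partial>lborel)" for s
  have h: "h s \<ge> c * measure lborel K / 2" if s: "s \<in> {0..t}" for s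
  proof -
    have s1: "s \<in> {0..1}" using s t by auto
    have iK: "integrable lborel (\<lambda>y. indicator K y :: real)"
      using mK by (intro integrable_real_indicator) (auto simp: measure_def top.not_eq_extremum dest: enn2real_positive_iff[THEN iffD1])
    have "c * measure lborel K = (\<integral>y. c * indicator K (y + s *\<^sub>R e) \<partial>lborel)"
      using lborel_integral_translate[of "\<lambda>y. indicator K y :: real" "s *\<^sub>R e"] by simp
    then have "c * measure lborel K - \<rho> s
        = (\<integral>y. c * indicator K (y + s *\<^sub>R e) - indicator (- K) y * indicator K (y + s *\<^sub>R e) * (c + \<bar>?g y\<bar>) \<partial>lborel)"
      unfolding \<rho>_def using \<rho>_int[OF s1] lborel_integrable_translate[OF iK, of "s *\<^sub>R e"]
      by (subst Bochner_Integration.integral_diff) auto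
    also have "\<dots> \<le> (\<integral>y. indicator K (y + s *\<^sub>R e) * ?g y \<partial>lborel)"
    proof (rule integral_mono)
      show "integrable lborel (\<lambda>y. c * indicator K (y + s *\<^sub>R e) - indicator (- K) y * indicator K (y + s *\<^sub>R e) * (c + \<bar>?g y\<bar>))"
        using \<rho>_int[OF s1] lborel_integrable_translate[OF iK, of "s *\<^sub>R e"] by auto
      show "integrable lborel (\<lambda>y. indicator K (y + s *\<^sub>R e) * ?g y)"
        by (rule Bochner_Integration.integrable_bound[OF li[of "r + norm e"]])
           (use c Kball[OF s1] in \<open>auto intro!: AE_I2 mult_mono simp: abs_mult\<close>)
      fix y
      show "c * indicator K (y + s *\<^sub>R e) - indicator (- K) y * indicator K (y + s *\<^sub>R e) * (c + \<bar>?g y\<bar>)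
          \<le> indicator K (y + s *\<^sub>R e) * ?g y"
        using gK(2)[of y] by (cases "y \<in> K"; cases "y + s *\<^sub>R e \<in> K") auto
    qed
    also have "\<dots> = h s"
      unfolding h_def using lborel_integral_translate[of "\<lambda>x. indicator K x * ?g (x - s *\<^sub>R e)" "s *\<^sub>R e"] by simp
    finally show ?thesis using n[of s] s by (simp add: t_def)
  qed
  have sw: "integrable (lborel \<Otimes>\<^sub>M lborel) (\<lambda>(x, s). indicator {0..t} s * (indicator K x * ?g (x - s *\<^sub>R e)))"
    using integrable_shift_pair[OF gl, of "indicator K" 1 K t 0 "- e"] cK by simp
  have "0 \<le> (\<integral>x. indicator K x * p (x - t *\<^sub>R e) \<partial>lborel)" using p0 by (intro integral_nonneg_AE) auto
  also have "\<dots> = (\<integral>x. - (\<integral>s. indicator {0..t} s * (indicator K x * ?g (x - s *\<^sub>R e)) \<partial>lborel) \<partial>lborel)"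
  proof (rule integral_cong_AE)
    show "AE x in lborel. indicator K x * p (x - t *\<^sub>R e) = - (\<integral>s. indicator {0..t} s * (indicator K x * ?g (x - s *\<^sub>R e)) \<partial>lborel)"
      using weak_gradient_line_integral[OF p g less_imp_le[OF t(1)], of e]
    proof eventually_elim
      case (elim x)
      show ?case using elim gK(1)[of x] by (cases "x \<in> K") auto
    qed
  qed measurable
  also have "\<dots> = - (\<integral>s. (\<integral>x. indicator {0..t} s * (indicator K x * ?g (x - s *\<^sub>R e)) \<partial>lborel) \<partial>lborel)"
    by (simp only: Bochner_Integration.integral_minus lborel_pair.Fubini_integral[OF sw])
  also have "\<dots> = - (\<integral>s. indicator {0..t} s * h s \<partial>lborel)" by (simp add: h_def)
  also have "\<dots> \<le> - (\<integral>s. indicator {0..t} s * (c * measure lborel K / 2) \<partial>lborel)"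
  proof (intro le_imp_neg_le integral_mono)
    show "integrable lborel (\<lambda>s. indicator {0..t} s * h s)"
      using lborel_pair.integrable_snd[OF sw] by (simp add: h_def)
    show "indicator {0..t} s * (c * measure lborel K / 2) \<le> indicator {0..t} s * h s" for s
      using h[of s] by (cases "s \<in> {0..t}") auto
    show "integrable lborel (\<lambda>s. indicator {0..t} s * (c * measure lborel K / 2))"
      by (intro integrable_mult_left integrable_real_indicator) (use t in auto)
  qed
  also have "\<dots> = - (t * (c * measure lborel K / 2))" using t by simp
  also have "\<dots> < 0" using t c mK by simp
  finally show False by simp
qed

text \<open>Where \<open>g\<close> is nonzero, some signed basis direction has a component of at
  least \<open>1 / real (Suc k)\<close> for some \<open>k\<close>. So countably many null sets from
  the previous lemma cover the exceptional set. The purpose is to recover \<open>g\<close> as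
  \<open>p\<close> times the quotient of \<open>g\<close> by \<open>p\<close>, although that
  quotient is 0 where \<open>p\<close> vanishes.\<close>

lemma has_weak_gradient_zero_set:
  fixes p :: "'b::euclidean_space \<Rightarrow> real"
  assumes "locally_integrable p" "has_weak_gradient p g" "\<And>x. p x \<ge> 0"
  shows "AE x in lborel. p x = 0 \<longrightarrow> g x = 0"
proof -
  have "AE x in lborel. \<forall>k n. \<forall>b\<in>Basis. \<not> (p x = 0 \<and> norm x \<le> real n \<and> 1 / real (Suc k) \<le> g x \<bullet> b)
      \<and> \<not> (p x = 0 \<and> norm x \<le> real n \<and> 1 / real (Suc k) \<le> g x \<bullet> (- b))"
    by (intro AE_all_countable[THEN iffD2] allI AE_ball_countable'[OF _ countable_finite[OF finite_Basis]] AE_conjI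
        weak_gradient_nonpos_on_zero_set assms) auto
  then show ?thesis
  proof eventually_elim
    case (elim x)
    obtain n where n: "norm x \<le> real n" using real_arch_simple by blast
    show ?case
    proof
      assume "p x = 0"
      have "g x \<bullet> b = 0" if b: "b \<in> Basis" for b
      proof (rule ccontr)
        assume "g x \<bullet> b \<noteq> 0"
        then have "0 < \<bar>g x \<bullet> b\<bar>" by simp
        then obtain k where "1 / real (Suc k) < \<bar>g x \<bullet> b\<bar>" using nat_approx_posE by blast
        then have "1 / real (Suc k) \<le> g x \<bullet> b \<or> 1 / real (Suc k) \<le> g x \<bullet> (- b)" by (auto simp: abs_if split: if_splits)
        then show False using elim b n \<open>p x = 0\<close> by blast
      qed
      then show "g x = 0" using euclidean_all_zero_iff by blast
    qed
  qed
qed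

section \<open>Square-integrable functions and Riesz representation\<close>

definition square_integrable :: "'a measure \<Rightarrow> ('a \<Rightarrow> 'b::euclidean_space) \<Rightarrow> bool" where
  "square_integrable N f \<longleftrightarrow> f \<in> borel_measurable N \<and> integrable N (\<lambda>z. (norm (f z))\<^sup>2)"

lemma L2_inner:
  assumes "square_integrable N f" "square_integrable N g"
  shows "integrable N (\<lambda>z. f z \<bullet> g z)"
proof (rule Bochner_Integration.integrable_bound)
  show "integrable N (\<lambda>z. (norm (f z))\<^sup>2 + (norm (g z))\<^sup>2)" "(\<lambda>z. f z \<bullet> g z) \<in> borel_measurable N"
    using assms by (auto simp: square_integrable_def)
  have "\<bar>x \<bullet> y\<bar> \<le> (norm x)\<^sup>2 + (norm y)\<^sup>2" for x y :: 'b
  proof -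
    have "0 \<le> (norm x - norm y)\<^sup>2" by simp
    then have "norm x * norm y \<le> (norm x)\<^sup>2 + (norm y)\<^sup>2"
      using mult_nonneg_nonneg[OF norm_ge_zero[of x] norm_ge_zero[of y]]
      unfolding power2_diff by linarith
    then show ?thesis using Cauchy_Schwarz_ineq2[of x y] by linarith
  qed
  then show "AE z in N. norm (f z \<bullet> g z) \<le> norm ((norm (f z))\<^sup>2 + (norm (g z))\<^sup>2)"
    by (simp add: abs_of_nonneg)
qed

lemma L2_scale:
  "square_integrable N f \<Longrightarrow> square_integrable N (\<lambda>z. c *\<^sub>R f z)"
  by (auto simp: square_integrable_def power_mult_distrib)

lemma L2_add:
  assumes "square_integrable N f" "square_integrable N g"
  shows "square_integrable N (\<lambda>z. f z + g z)"
proof -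
  have "(norm (f z + g z))\<^sup>2 = (norm (f z))\<^sup>2 + 2 * (f z \<bullet> g z) + (norm (g z))\<^sup>2" for z
    by (simp add: power2_norm_eq_inner inner_add_left inner_add_right inner_commute)
  then show ?thesis
    using assms L2_inner[OF assms] by (auto simp: square_integrable_def)
qed

lemma L2_diff:
  "square_integrable N f \<Longrightarrow> square_integrable N g \<Longrightarrow> square_integrable N (\<lambda>z. f z - g z)"
  using L2_add[of N f "\<lambda>z. (-1) *\<^sub>R g z"] L2_scale[of N g "-1"] by simp

lemma L2_sum:
  "(\<And>i. i \<in> A \<Longrightarrow> square_integrable N (f i)) \<Longrightarrow> square_integrable N (\<lambda>z. \<Sum>i\<in>A. f i z)"
proof (induction A rule: infinite_finite_induct)
  case (insert x F)
  then show ?case by (simp add: L2_add)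
qed (simp_all add: square_integrable_def)

lemma L2_bound:
  assumes "square_integrable N f" "g \<in> borel_measurable N" "\<And>z. norm (g z) \<le> norm (f z)"
  shows "square_integrable N g"
  unfolding square_integrable_def
proof
  show "integrable N (\<lambda>z. (norm (g z))\<^sup>2)"
    by (rule Bochner_Integration.integrable_bound[of _ "\<lambda>z. (norm (f z))\<^sup>2"])
       (use assms in \<open>auto simp: square_integrable_def intro!: AE_I2 power_mono\<close>)
qed (rule assms)

lemma L2_inner_const:
  assumes "square_integrable N f" shows "square_integrable N (\<lambda>z. f z \<bullet> b)"
proof (rule L2_bound[OF L2_scale[OF assms, of "norm b"]])
  show "norm (f z \<bullet> b) \<le> norm (norm b *\<^sub>R f z)" for z
    using Cauchy_Schwarz_ineq2[of "f z" b] by (simp add: mult.commute)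
qed (use assms in \<open>auto simp: square_integrable_def\<close>)

lemma (in finite_measure) L2_bounded:
  assumes "f \<in> borel_measurable M" "\<And>z. norm (f z) \<le> B"
  shows "square_integrable M f"
\<comment> \<open>The majorant must live in the arbitrary Euclidean target type; a multiple of some
  basis vector is a constant of norm \<open>\<bar>B\<bar>\<close>.\<close>
proof (rule L2_bound[of _ "\<lambda>_. B *\<^sub>R (SOME i. i \<in> Basis)"])
  have "(SOME i. i \<in> (Basis :: 'b set)) \<in> Basis" by (rule some_in_eq[THEN iffD2, OF nonempty_Basis])
  then show "norm (f z) \<le> norm (B *\<^sub>R (SOME i. i \<in> Basis) :: 'b)" for z
    using assms(2)[of z] by simp
qed (use assms in \<open>auto simp: square_integrable_def\<close>)

lemma (in finite_measure) L2_integrable: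
  assumes "square_integrable M f" shows "integrable M f"
proof (rule Bochner_Integration.integrable_bound[of _ "\<lambda>z. 1 + (norm (f z))\<^sup>2"])
  have "norm x \<le> 1 + (norm x)\<^sup>2" for x :: 'b
  proof -
    have "2 * norm x \<le> (norm x)\<^sup>2 + 1" using zero_le_power2[of "norm x - 1"] by (simp add: power2_diff)
    then show ?thesis using norm_ge_zero[of x] by linarith
  qed
  then show "AE z in M. norm (f z) \<le> norm (1 + (norm (f z))\<^sup>2)" by (simp add: abs_of_nonneg)
qed (use assms in \<open>auto simp: square_integrable_def\<close>)

lemma quadratic_nonneg_discriminant:
  fixes a b c :: real
  assumes "\<And>t. 0 \<le> a * t\<^sup>2 + 2 * b * t + c" "a \<ge> 0"
  shows "b\<^sup>2 \<le> a * c"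
proof (cases "a = 0")
  case True
  have "b = 0"
  proof (rule ccontr)
    assume "b \<noteq> 0"
    \<comment> \<open>With \<open>a = 0\<close> the expression is affine in \<open>t\<close>; at
      this \<open>t\<close> it equals -1.\<close>
    then show False using assms(1)[of "- (c + 1) / (2 * b)"] True by simp
  qed
  then show ?thesis by (simp add: True)
next
  case False
  then have "a > 0" using assms(2) by simp
  \<comment> \<open>The minimiser of the quadratic.\<close>
  have "0 \<le> a * (- b / a)\<^sup>2 + 2 * b * (- b / a) + c" by (rule assms)
  also have "\<dots> = (a * c - b\<^sup>2) / a" using \<open>a > 0\<close> by (simp add: field_simps power2_eq_square)
  finally show ?thesis using \<open>a > 0\<close> by (simp add: zero_le_divide_iff)
qed

lemma norm_add_scaleR_integral:
  assumes f: "square_integrable N f" and g: "square_integrable N g"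
  shows "(\<integral>z. (norm (f z + t *\<^sub>R g z))\<^sup>2 \<partial>N)
    = (\<integral>z. (norm (f z))\<^sup>2 \<partial>N) + 2 * t * (\<integral>z. f z \<bullet> g z \<partial>N) + t\<^sup>2 * (\<integral>z. (norm (g z))\<^sup>2 \<partial>N)"
proof -
  have "(norm (f z + t *\<^sub>R g z))\<^sup>2 = (norm (f z))\<^sup>2 + 2 * t * (f z \<bullet> g z) + t\<^sup>2 * (norm (g z))\<^sup>2" for z
    by (simp only: power2_norm_eq_inner)
       (simp add: inner_add_left inner_add_right inner_commute power2_eq_square)
  then show ?thesis
    using f g L2_inner[OF f g] by (simp add: square_integrable_def)
qed

lemma integral_Cauchy_Schwarz:
  assumes f: "square_integrable N f" and g: "square_integrable N g"
  shows "(\<integral>z. f z \<bullet> g z \<partial>N)\<^sup>2 \<le> (\<integral>z. (norm (f z))\<^sup>2 \<partial>N) * (\<integral>z. (norm (g z))\<^sup>2 \<partial>N)"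
proof -
  have "0 \<le> (\<integral>z. (norm (g z))\<^sup>2 \<partial>N) * t\<^sup>2 + 2 * (\<integral>z. f z \<bullet> g z \<partial>N) * t + (\<integral>z. (norm (f z))\<^sup>2 \<partial>N)" for t
  proof -
    have "0 \<le> (\<integral>z. (norm (f z + t *\<^sub>R g z))\<^sup>2 \<partial>N)" by simp
    then show ?thesis unfolding norm_add_scaleR_integral[OF f g] by (simp add: algebra_simps)
  qed
  from quadratic_nonneg_discriminant[OF this] show ?thesis by (simp add: mult.commute)
qed

text \<open>Completeness with the rate kept. On a probability space the geometric bound on the
  squares bounds the \<open>L\<^sup>1\<close> norms of consecutive differences by
  \<open>(1/2) ^ n\<close>. These are summable, which forces pointwise convergence almost
  everywhere, and Fatou carries each quadratic bound over to the limit.\<close>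

lemma (in prob_space) L2_rapidly_Cauchy_limit:
  fixes u :: "nat \<Rightarrow> 'a \<Rightarrow> 'b::euclidean_space"
  assumes u: "\<And>n. square_integrable M (u n)"
    and C: "\<And>m n. n \<le> m \<Longrightarrow> (\<integral>z. (norm (u m z - u n z))\<^sup>2 \<partial>M) \<le> (1/4) ^ n"
  obtains q where "square_integrable M q" "\<And>n. (\<integral>z. (norm (q z - u n z))\<^sup>2 \<partial>M) \<le> (1/4) ^ n"
proof -
  have [measurable]: "u n \<in> borel_measurable M" for n using u by (simp add: square_integrable_def)
  have d: "square_integrable M (\<lambda>z. u m z - u n z)" for m n by (intro L2_diff u)
  have E1: "(\<integral>z. norm (u (Suc n) z - u n z) \<partial>M) \<le> (1/2) ^ n" for n
  proof -
    have "square_integrable M (\<lambda>z. norm (u (Suc n) z - u n z))"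
      using d[of "Suc n" n] by (auto simp: square_integrable_def)
    from integral_Cauchy_Schwarz[OF this L2_bounded[of "\<lambda>_. 1::real" 1]]
    have "(\<integral>z. norm (u (Suc n) z - u n z) \<partial>M)\<^sup>2 \<le> (\<integral>z. (norm (u (Suc n) z - u n z))\<^sup>2 \<partial>M)"
      by (simp add: prob_space)
    also have "\<dots> \<le> (1/4) ^ n" by (rule C) simp
    also have "\<dots> = ((1/2) ^ n)\<^sup>2" by (simp add: power2_eq_square flip: power_mult_distrib)
    finally show ?thesis by (rule power2_le_imp_le) simp
  qed
  have "AE z in M. summable (\<lambda>n. norm (u (Suc n) z - u n z))"
  proof -
    have "(\<integral>\<^sup>+z. (\<Sum>n. ennreal (norm (u (Suc n) z - u n z))) \<partial>M)
        = (\<Sum>n. \<integral>\<^sup>+z. ennreal (norm (u (Suc n) z - u n z)) \<partial>M)"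
      by (rule nn_integral_suminf) measurable
    also have "\<dots> \<le> (\<Sum>n. ennreal ((1/2) ^ n))"
      using d[THEN L2_integrable] E1
      by (intro suminf_le) (auto simp: nn_integral_eq_integral intro!: ennreal_leI)
    also have "\<dots> < \<infinity>" by (subst suminf_ennreal2) (auto simp: summable_geometric)
    finally have "AE z in M. (\<Sum>n. ennreal (norm (u (Suc n) z - u n z))) \<noteq> \<infinity>"
      by (intro nn_integral_PInf_AE) auto
    then show ?thesis
      by eventually_elim (rule summable_suminf_not_top, auto)
  qed
  then have conv: "AE z in M. convergent (\<lambda>n. u n z)"
  proof eventually_elim
    case (elim z)
    have "summable (\<lambda>n. u (Suc n) z - u n z)" using elim by (rule summable_norm_cancel)
    then have "convergent (\<lambda>n. \<Sum>k<n. u (Suc k) z - u k z)" by (simp add: summable_iff_convergent)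
    then have "convergent (\<lambda>n. u n z - u 0 z)" using sum_lessThan_telescope[of "\<lambda>k. u k z"] by simp
    from convergent_add[OF this convergent_const[of "u 0 z"]] show ?case by simp
  qed
  define q where "q z = lim (\<lambda>n. u n z)" for z
  have [measurable]: "q \<in> borel_measurable M" unfolding q_def by (rule borel_measurable_lim_metric) measurable
  have qn: "(\<integral>\<^sup>+z. ennreal ((norm (q z - u n z))\<^sup>2) \<partial>M) \<le> ennreal ((1/4) ^ n)" for n
  proof -
    have "(\<integral>\<^sup>+z. ennreal ((norm (q z - u n z))\<^sup>2) \<partial>M)
        = (\<integral>\<^sup>+z. liminf (\<lambda>m. ennreal ((norm (u m z - u n z))\<^sup>2)) \<partial>M)"
    proof (rule nn_integral_cong_AE)
      show "AE z in M. ennreal ((norm (q z - u n z))\<^sup>2) = liminf (\<lambda>m. ennreal ((norm (u m z - u n z))\<^sup>2))"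
        using conv
      proof eventually_elim
        case (elim z)
        then have "(\<lambda>m. u m z) \<longlonglongrightarrow> q z" by (simp add: q_def convergent_LIMSEQ_iff)
        then have "(\<lambda>m. ennreal ((norm (u m z - u n z))\<^sup>2)) \<longlonglongrightarrow> ennreal ((norm (q z - u n z))\<^sup>2)"
          by (intro tendsto_intros)
        from lim_imp_Liminf[OF sequentially_bot this] show ?case by (rule sym)
      qed
    qed
    also have "\<dots> \<le> liminf (\<lambda>m. \<integral>\<^sup>+z. ennreal ((norm (u m z - u n z))\<^sup>2) \<partial>M)"
      by (rule nn_integral_liminf) measurable
    also have "\<dots> \<le> limsup (\<lambda>m. \<integral>\<^sup>+z. ennreal ((norm (u m z - u n z))\<^sup>2) \<partial>M)"
      by (rule Liminf_le_Limsup) simp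
    also have "\<dots> \<le> ennreal ((1/4) ^ n)"
    proof (rule Limsup_bounded)
      show "\<forall>\<^sub>F m in sequentially. (\<integral>\<^sup>+z. ennreal ((norm (u m z - u n z))\<^sup>2) \<partial>M) \<le> ennreal ((1/4) ^ n)"
        using eventually_ge_at_top[of n]
      proof eventually_elim
        case (elim m)
        have "integrable M (\<lambda>z. (norm (u m z - u n z))\<^sup>2)" using d by (simp add: square_integrable_def)
        then show ?case using C[OF elim] by (simp add: nn_integral_eq_integral ennreal_leI)
      qed
    qed
    finally show ?thesis .
  qed
  have qi: "integrable M (\<lambda>z. (norm (q z - u n z))\<^sup>2)" for n
  proof (rule integrableI_bounded)
    show "(\<integral>\<^sup>+z. ennreal (norm ((norm (q z - u n z))\<^sup>2)) \<partial>M) < \<infinity>"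
      using qn[of n] by (simp add: order.strict_trans1 ennreal_less_top)
  qed measurable
  show thesis
  proof (rule that)
    have "square_integrable M (\<lambda>z. (q z - u 0 z) + u 0 z)"
      using qi by (intro L2_add u) (simp add: square_integrable_def)
    then show "square_integrable M q" by simp
    show "(\<integral>z. (norm (q z - u n z))\<^sup>2 \<partial>M) \<le> (1/4) ^ n" for n
      using qn[of n] qi[of n] by (simp add: nn_integral_eq_integral)
  qed
qed

text \<open>Riesz representation on the closure of the range of \<open>D\<close>: the representer is the \<open>L\<^sup>2\<close> limit of a minimising
  sequence of \<open>\<phi> \<mapsto> E|D \<phi>|\<^sup>2 - 2 L \<phi>\<close>.\<close>

lemma (in prob_space) Riesz_test_functions:
  fixes D :: "('c::euclidean_space \<Rightarrow> real) \<Rightarrow> 'a \<Rightarrow> 'b::euclidean_space" and L :: "('c \<Rightarrow> real) \<Rightarrow> real"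
  assumes D: "\<And>\<phi>. test_function \<phi> \<Longrightarrow> square_integrable M (D \<phi>)"
    and Dlin: "\<And>\<phi> \<psi> c. test_function \<phi> \<Longrightarrow> test_function \<psi> \<Longrightarrow> D (\<lambda>x. \<phi> x + c * \<psi> x) = (\<lambda>z. D \<phi> z + c *\<^sub>R D \<psi> z)"
    and Llin: "\<And>\<phi> \<psi> c. test_function \<phi> \<Longrightarrow> test_function \<psi> \<Longrightarrow> L (\<lambda>x. \<phi> x + c * \<psi> x) = L \<phi> + c * L \<psi>"
    and bd: "\<And>\<phi>. test_function \<phi> \<Longrightarrow> (L \<phi>)\<^sup>2 \<le> C * (\<integral>z. (norm (D \<phi> z))\<^sup>2 \<partial>M)" and C: "C \<ge> 0"
  obtains q where "square_integrable M q" "(\<integral>z. (norm (q z))\<^sup>2 \<partial>M) \<le> C"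
    "\<And>\<phi>. test_function \<phi> \<Longrightarrow> (\<integral>z. q z \<bullet> D \<phi> z \<partial>M) = L \<phi>"
proof -
  define A where "A \<phi> = (\<integral>z. (norm (D \<phi> z))\<^sup>2 \<partial>M)" for \<phi>
  define F where "F \<phi> = A \<phi> - 2 * L \<phi>" for \<phi>
  have A0: "A \<phi> \<ge> 0" for \<phi> by (simp add: A_def)
  have T: "test_function (\<lambda>x. \<phi> x + c * \<psi> x)" if "test_function \<phi>" "test_function \<psi>" for \<phi> \<psi> :: "'c \<Rightarrow> real" and c
    by (intro test_add test_scale that)
  have Fexp: "F (\<lambda>x. \<phi> x + t * \<psi> x) = F \<phi> + 2 * t * ((\<integral>z. D \<phi> z \<bullet> D \<psi> z \<partial>M) - L \<psi>) + t\<^sup>2 * A \<psi>"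
    if "test_function \<phi>" "test_function \<psi>" for \<phi> \<psi> t
    using that by (simp add: F_def A_def Dlin Llin norm_add_scaleR_integral[OF D D] algebra_simps)
  \<comment> \<open>From \<open>bd\<close> and the inequality of arithmetic and geometric means, 2 L
    \<phi> is at most C + A \<phi>.\<close>
  have Flow: "F \<phi> \<ge> - C" if "test_function \<phi>" for \<phi>
  proof -
    have "(2 * L \<phi>)\<^sup>2 \<le> 4 * (C * A \<phi>)" using bd[OF that] by (simp add: A_def power_mult_distrib)
    also have "\<dots> \<le> (C + A \<phi>)\<^sup>2" using zero_le_power2[of "C - A \<phi>"] by (simp add: power2_sum power2_diff)
    finally have "2 * L \<phi> \<le> C + A \<phi>" by (rule power2_le_imp_le) (simp add: C A0)
    then show ?thesis by (simp add: F_def)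
  qed
  let ?S = "F ` Collect test_function"
  have bdd: "bdd_below ?S" using Flow by (intro bdd_belowI[of _ "- C"]) auto
  have ne: "?S \<noteq> {}" using test_zero by auto
  define I where "I = Inf ?S"
  have FI: "I \<le> F \<phi>" if "test_function \<phi>" for \<phi> unfolding I_def using that bdd by (intro cInf_lower) auto
  have "\<exists>\<phi>. test_function \<phi> \<and> F \<phi> < I + (1/4) ^ n / 4" for n :: nat
  proof -
    have "\<exists>y\<in>?S. y < I + (1/4) ^ n / 4" unfolding I_def by (rule cInf_lessD[OF ne, THEN bexE]) auto
    then show ?thesis by auto
  qed
  then obtain \<Phi> where \<Phi>: "\<And>n. test_function (\<Phi> n)" "\<And>n. F (\<Phi> n) < I + (1/4) ^ n / 4" by metis
  have Cau: "(\<integral>z. (norm (D (\<Phi> m) z - D (\<Phi> n) z))\<^sup>2 \<partial>M) \<le> (1/4) ^ n" if "n \<le> m" for m n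
  proof -
    define \<delta> where "\<delta> = (\<lambda>x. \<Phi> m x + (-1) * \<Phi> n x)"
    have \<delta>: "test_function \<delta>" unfolding \<delta>_def by (intro T \<Phi>)
    have "(\<lambda>x. \<Phi> n x + 1 * \<delta> x) = \<Phi> m" by (simp add: \<delta>_def)
    then have m: "F (\<Phi> m) = F (\<Phi> n) + 2 * ((\<integral>z. D (\<Phi> n) z \<bullet> D \<delta> z \<partial>M) - L \<delta>) + A \<delta>"
      using Fexp[OF \<Phi>(1)[of n] \<delta>, of 1] by simp
    \<comment> \<open>Evaluation at the midpoint of \<open>\<Phi> n\<close> and
      \<open>\<Phi> m\<close>. Eliminating the cross term with \<open>m\<close> gives A \<delta> / 4
      \<le> (F (\<Phi> n) + F (\<Phi> m)) / 2 - I. The tolerance with its extra factor 1/4 was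
      chosen so that this yields exactly A \<delta> \<le> \<open>(1/4) ^ n\<close>.\<close>
    have h: "I \<le> F (\<Phi> n) + ((\<integral>z. D (\<Phi> n) z \<bullet> D \<delta> z \<partial>M) - L \<delta>) + A \<delta> / 4"
      using FI[OF T[OF \<Phi>(1)[of n] \<delta>, of "1/2"]] unfolding Fexp[OF \<Phi>(1) \<delta>] by (simp add: power2_eq_square)
    have "(1/4::real) ^ m \<le> (1/4) ^ n" using that by (intro power_decreasing) auto
    moreover have "a \<le> e" if "fm = fn + 2 * b + a" "I \<le> fn + b + a / 4" "fn < I + e / 4" "fm < I + e' / 4" "e' \<le> e"
      for a b e e' fm fn :: real using that by argo
    ultimately have "A \<delta> \<le> (1/4) ^ n" using m h \<Phi>(2)[of n] \<Phi>(2)[of m] by blast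
    then show ?thesis by (simp add: A_def \<delta>_def Dlin[OF \<Phi>(1) \<Phi>(1), of _ "-1" , simplified])
  qed
  obtain q where q: "square_integrable M q"
    "\<And>n. (\<integral>z. (norm (q z - D (\<Phi> n) z))\<^sup>2 \<partial>M) \<le> (1/4) ^ n"
    by (rule L2_rapidly_Cauchy_limit[of "\<lambda>n. D (\<Phi> n)", OF D[OF \<Phi>(1)]]) (rule Cau, assumption, rule that)
  have lim4: "(\<lambda>n. (1/4::real) ^ n * K) \<longlonglongrightarrow> 0" for K
    using tendsto_mult_left_zero[OF LIMSEQ_realpow_zero[of "1/4::real"]] by simp
  have lim: "(\<lambda>n. \<integral>z. D (\<Phi> n) z \<bullet> f z \<partial>M) \<longlonglongrightarrow> (\<integral>z. q z \<bullet> f z \<partial>M)" if f: "square_integrable M f" for f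
  proof -
    have "(\<lambda>n. ((\<integral>z. q z \<bullet> f z \<partial>M) - (\<integral>z. D (\<Phi> n) z \<bullet> f z \<partial>M))\<^sup>2) \<longlonglongrightarrow> 0"
    proof (rule tendsto_sandwich[OF _ _ tendsto_const lim4])
      have "((\<integral>z. q z \<bullet> f z \<partial>M) - (\<integral>z. D (\<Phi> n) z \<bullet> f z \<partial>M))\<^sup>2 \<le> (1/4) ^ n * (\<integral>z. (norm (f z))\<^sup>2 \<partial>M)" for n
      proof -
        have "(\<integral>z. q z \<bullet> f z \<partial>M) - (\<integral>z. D (\<Phi> n) z \<bullet> f z \<partial>M) = (\<integral>z. (q z - D (\<Phi> n) z) \<bullet> f z \<partial>M)"
          using L2_inner[OF q(1) f] L2_inner[OF D[OF \<Phi>(1)] f]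
          by (simp add: inner_diff_left)
        then show ?thesis
          using integral_Cauchy_Schwarz[OF L2_diff[OF q(1) D[OF \<Phi>(1)]] f, of n]
            mult_right_mono[OF q(2)[of n], of "\<integral>z. (norm (f z))\<^sup>2 \<partial>M"] by simp
      qed
      then show "\<forall>\<^sub>F n in sequentially. ((\<integral>z. q z \<bullet> f z \<partial>M) - (\<integral>z. D (\<Phi> n) z \<bullet> f z \<partial>M))\<^sup>2 \<le> (1/4) ^ n * (\<integral>z. (norm (f z))\<^sup>2 \<partial>M)"
        by (intro always_eventually allI)
    qed simp
    from tendsto_real_sqrt[OF this]
    have "(\<lambda>n. (\<integral>z. q z \<bullet> f z \<partial>M) - (\<integral>z. D (\<Phi> n) z \<bullet> f z \<partial>M)) \<longlonglongrightarrow> 0"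
      unfolding real_sqrt_abs real_sqrt_zero by (rule tendsto_rabs_zero_cancel)
    from tendsto_diff[OF tendsto_const[of "\<integral>z. q z \<bullet> f z \<partial>M"] this] show ?thesis by simp
  qed
  have rep: "(\<integral>z. q z \<bullet> D \<phi> z \<partial>M) = L \<phi>" if \<phi>: "test_function \<phi>" for \<phi>
  proof -
    have "((\<integral>z. D (\<Phi> n) z \<bullet> D \<phi> z \<partial>M) - L \<phi>)\<^sup>2 \<le> (1/4) ^ n * A \<phi>" for n
    proof -
      \<comment> \<open>Moving from the near minimiser \<open>\<Phi> n\<close> by t times
        \<open>\<phi>\<close> cannot lower \<open>F\<close> below \<open>I\<close>. The discriminant
        of this quadratic in \<open>t\<close> then bounds the first variation, which must vanish in
        the limit.\<close>
      have "0 \<le> A \<phi> * t\<^sup>2 + 2 * ((\<integral>z. D (\<Phi> n) z \<bullet> D \<phi> z \<partial>M) - L \<phi>) * t + (1/4) ^ n / 4" for t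
        using FI[OF T[OF \<Phi>(1)[of n] \<phi>, of t]] \<Phi>(2)[of n] unfolding Fexp[OF \<Phi>(1) \<phi>] by (simp add: mult_ac)
      from quadratic_nonneg_discriminant[OF this A0]
      have "((\<integral>z. D (\<Phi> n) z \<bullet> D \<phi> z \<partial>M) - L \<phi>)\<^sup>2 \<le> A \<phi> * ((1/4) ^ n / 4)" .
      also have "\<dots> \<le> A \<phi> * (1/4) ^ n" using A0 by (intro mult_left_mono) auto
      finally show ?thesis by (simp add: mult.commute)
    qed
    then have "(\<lambda>n. ((\<integral>z. D (\<Phi> n) z \<bullet> D \<phi> z \<partial>M) - L \<phi>)\<^sup>2) \<longlonglongrightarrow> 0"
      by (intro tendsto_sandwich[OF _ _ tendsto_const lim4[of "A \<phi>"]]) (auto intro!: always_eventually)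
    moreover have "(\<lambda>n. ((\<integral>z. D (\<Phi> n) z \<bullet> D \<phi> z \<partial>M) - L \<phi>)\<^sup>2) \<longlonglongrightarrow> ((\<integral>z. q z \<bullet> D \<phi> z \<partial>M) - L \<phi>)\<^sup>2"
      by (intro tendsto_intros lim D \<phi>)
    ultimately have "((\<integral>z. q z \<bullet> D \<phi> z \<partial>M) - L \<phi>)\<^sup>2 = 0" using LIMSEQ_unique by blast
    then show ?thesis by simp
  qed
  have qC: "(\<integral>z. (norm (q z))\<^sup>2 \<partial>M) \<le> C"
  proof -
    let ?Q = "\<integral>z. (norm (q z))\<^sup>2 \<partial>M"
    have "(\<lambda>n. \<integral>z. D (\<Phi> n) z \<bullet> q z \<partial>M) \<longlonglongrightarrow> (\<integral>z. q z \<bullet> q z \<partial>M)" by (rule lim[OF q(1)])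
    then have l1: "(\<lambda>n. L (\<Phi> n)) \<longlonglongrightarrow> ?Q" using rep[OF \<Phi>(1)] by (simp add: inner_commute power2_norm_eq_inner)
    have An: "A (\<Phi> n) \<le> (1/4) ^ n * 1 + 2 * L (\<Phi> n) - ?Q" for n
    proof -
      have "(\<integral>z. (norm (q z + (-1) *\<^sub>R D (\<Phi> n) z))\<^sup>2 \<partial>M) = ?Q - 2 * L (\<Phi> n) + A (\<Phi> n)"
        unfolding norm_add_scaleR_integral[OF q(1) D[OF \<Phi>(1)]] rep[OF \<Phi>(1)] by (simp add: A_def)
      then show ?thesis using q(2)[of n] by simp
    qed
    \<comment> \<open>Both L (\<Phi> n) and the upper bound on A (\<Phi> n) tend to
      \<open>?Q\<close>. So \<open>bd\<close> becomes \<open>?Q * ?Q \<le> C * ?Q\<close>, and one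
      factor can be cancelled.\<close>
    have "(L (\<Phi> n))\<^sup>2 \<le> C * ((1/4) ^ n * 1 + 2 * L (\<Phi> n) - ?Q)" for n
      by (rule order_trans[OF bd[OF \<Phi>(1)] mult_left_mono[OF An[unfolded A_def] C]])
    then have "?Q\<^sup>2 \<le> C * (0 + 2 * ?Q - ?Q)"
      by (intro LIMSEQ_le[of "\<lambda>n. (L (\<Phi> n))\<^sup>2" _ "\<lambda>n. C * ((1/4) ^ n * 1 + 2 * L (\<Phi> n) - ?Q)"] tendsto_intros l1 lim4) auto
    then have "?Q * ?Q \<le> C * ?Q" by (simp add: power2_eq_square)
    moreover have "?Q \<ge> 0" by simp
    ultimately show ?thesis using C by (cases "?Q = 0") (auto dest: mult_right_le_imp_le)
  qed
  show thesis by (rule that[OF q(1) qC rep])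
qed

section \<open>Laws with a score function\<close>

text \<open>All that the variance argument needs of the law, without a density. The score is any
  square-integrable field that satisfies integration by parts against test functions, and the
  Poincare inequality is asked for on the same class.\<close>

locale score_law = prob_space \<mu> for \<mu> :: "'b::euclidean_space measure" +
  fixes \<rho> :: "'b \<Rightarrow> 'b" and R :: real
  assumes sets_law [simp, measurable_cong]: "sets \<mu> = sets borel"
    and score_L2: "square_integrable \<mu> \<rho>"
    and position_L2: "square_integrable \<mu> (\<lambda>x. x)"
    and mean_zero: "(\<integral>x. x \<partial>\<mu>) = 0"
    and covariance: "\<And>b c. b \<in> Basis \<Longrightarrow> c \<in> Basis \<Longrightarrow> (\<integral>x. (x \<bullet> b) * (x \<bullet> c) \<partial>\<mu>) = (if b = c then 1 else 0)"
    and score: "\<And>\<phi> e. test_function \<phi> \<Longrightarrow> (\<integral>x. gradient \<phi> x \<bullet> e \<partial>\<mu>) = - (\<integral>x. \<phi> x * (\<rho> x \<bullet> e) \<partial>\<mu>)"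
    and poincare: "\<And>\<phi>. test_function \<phi> \<Longrightarrow>
      (\<integral>x. (\<phi> x)\<^sup>2 \<partial>\<mu>) - (\<integral>x. \<phi> x \<partial>\<mu>)\<^sup>2 \<le> R * (\<integral>x. (norm (gradient \<phi> x))\<^sup>2 \<partial>\<mu>)"
    and R_nonneg: "R \<ge> 0"
begin

lemma borel_measurable_law [simp]: "borel_measurable \<mu> = borel_measurable borel"
  by (rule measurable_cong_sets) auto

lemma score_measurable [measurable]: "\<rho> \<in> borel_measurable borel"
  using score_L2 by (simp add: square_integrable_def)

lemma test_L2: "test_function \<phi> \<Longrightarrow> square_integrable \<mu> \<phi>"
  and test_gradient_L2: "test_function \<phi> \<Longrightarrow> square_integrable \<mu> (gradient \<phi>)"
proof -
  assume t: "test_function \<phi>"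
  note [measurable] = test_measurable[OF t]
  obtain B where "\<And>x. \<bar>\<phi> x\<bar> \<le> B" "\<And>x. norm (gradient \<phi> x) \<le> B" "B \<ge> 0"
    by (rule test_bounded[OF t]) (rule that)
  then show "square_integrable \<mu> \<phi>" "square_integrable \<mu> (gradient \<phi>)"
    by (auto intro!: L2_bounded[of _ B])
qed

lemma const_L2: "square_integrable \<mu> (\<lambda>x. c)"
  by (rule L2_bounded[of _ "norm c"]) auto

lemmas L2_mult_integrable = L2_inner[where 'b = real, unfolded inner_real_def]

text \<open>Test the equation with \<open>cutoff m x\<close> and \<open>(x \<bullet> b) * cutoff m x\<close> and let \<open>m\<close> tend to infinity.\<close>

lemma divergence_moments:
  fixes f :: "'b \<Rightarrow> real"
  assumes G: "square_integrable \<mu> G" and f: "square_integrable \<mu> f"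
    and w: "\<And>\<phi>. test_function \<phi> \<Longrightarrow> (\<integral>x. G x \<bullet> gradient \<phi> x \<partial>\<mu>) = - (\<integral>x. f x * \<phi> x \<partial>\<mu>)"
  shows "(\<integral>x. f x \<partial>\<mu>) = 0" and "(\<integral>x. G x \<bullet> b \<partial>\<mu>) = - (\<integral>x. f x * (x \<bullet> b) \<partial>\<mu>)"
proof -
  have [measurable]: "G \<in> borel_measurable borel" "f \<in> borel_measurable borel"
    using G f by (auto simp: square_integrable_def)
  obtain C where C: "C \<ge> 0" "\<And>m (x::'b). norm (gradient (cutoff m) x) \<le> C / Suc m"
    "\<And>m (x::'b). norm x * norm (gradient (cutoff m) x) \<le> C"
    by (rule cutoff_gradient_bound) (rule that)
  note [measurable] = test_measurable[OF test_cutoff]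
  have iG: "integrable \<mu> (\<lambda>x. norm (G x))" and iff: "integrable \<mu> (\<lambda>x. \<bar>f x\<bar>)"
    using L2_integrable[OF G] L2_integrable[OF f] by auto
  have xL2: "square_integrable \<mu> (\<lambda>x. x \<bullet> b)" by (rule L2_inner_const[OF position_L2])
  have ifx: "integrable \<mu> (\<lambda>x. f x * (x \<bullet> b))" by (rule L2_mult_integrable[OF f xL2])
  have Cm: "C / Suc m \<le> C" for m using C(1) by (simp add: field_simps)
  have CN: "(\<lambda>m. K * (C / Suc m)) \<longlonglongrightarrow> 0" for K
    using tendsto_mult_right_zero[OF LIMSEQ_inverse_real_of_nat, of "K * C"] by (simp add: divide_inverse mult.assoc)
  have l1: "(\<lambda>m. \<integral>x. f x * cutoff m x \<partial>\<mu>) \<longlonglongrightarrow> (\<integral>x. f x \<partial>\<mu>)"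
  proof (rule integral_dominated_convergence[OF _ _ iff])
    show "AE x in \<mu>. (\<lambda>m. f x * cutoff m x) \<longlonglongrightarrow> f x"
      by (intro AE_I2) (use tendsto_mult[OF tendsto_const cutoff_tendsto] in simp)
    show "AE x in \<mu>. norm (f x * cutoff m x) \<le> \<bar>f x\<bar>" for m
      by (intro AE_I2) (auto simp: abs_mult cutoff_bounds intro: mult_right_le_one_le)
  qed measurable
  have gb: "\<bar>G x \<bullet> gradient (cutoff m) x\<bar> \<le> norm (G x) * (C / Suc m)" for m x
    by (rule order_trans[OF Cauchy_Schwarz_ineq2]) (intro mult_left_mono C norm_ge_zero)
  have "(\<lambda>m. \<integral>x. G x \<bullet> gradient (cutoff m) x \<partial>\<mu>) \<longlonglongrightarrow> (\<integral>x. 0 \<partial>\<mu>)"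
  proof (rule integral_dominated_convergence[OF _ _ integrable_mult_left[OF iG]])
    show "AE x in \<mu>. (\<lambda>m. G x \<bullet> gradient (cutoff m) x) \<longlonglongrightarrow> 0"
    proof (rule AE_I2)
      fix x show "(\<lambda>m. G x \<bullet> gradient (cutoff m) x) \<longlonglongrightarrow> 0"
        by (rule Lim_null_comparison[OF _ CN[of "norm (G x)"]])
           (intro always_eventually allI, unfold real_norm_def, rule gb)
    qed
    show "AE x in \<mu>. norm (G x \<bullet> gradient (cutoff m) x) \<le> norm (G x) * C" for m
      by (intro AE_I2) (use gb Cm mult_left_mono[OF Cm norm_ge_zero] in \<open>fastforce intro: order_trans\<close>)
  qed measurable
  then have "(\<lambda>m. - (\<integral>x. f x * cutoff m x \<partial>\<mu>)) \<longlonglongrightarrow> 0" by (simp add: w[OF test_cutoff])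
  from tendsto_minus[OF this] have "(\<lambda>m. \<integral>x. f x * cutoff m x \<partial>\<mu>) \<longlonglongrightarrow> 0" by simp
  from LIMSEQ_unique[OF l1 this] show "(\<integral>x. f x \<partial>\<mu>) = 0" .
  have tb: "test_function (\<lambda>x. (x \<bullet> b) * cutoff m x)" for m
    by (intro test_mult smooth_inner test_cutoff)
  have gtb: "gradient (\<lambda>x. (x \<bullet> b) * cutoff m x) x = (x \<bullet> b) *\<^sub>R gradient (cutoff m) x + cutoff m x *\<^sub>R b" for m x
    using gradient_mult[OF smooth_inner[of b] test_smooth[OF test_cutoff[of m]], of x] by (simp add: gradient_inner)
  have l2: "(\<lambda>m. \<integral>x. f x * ((x \<bullet> b) * cutoff m x) \<partial>\<mu>) \<longlonglongrightarrow> (\<integral>x. f x * (x \<bullet> b) \<partial>\<mu>)"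
  proof (rule integral_dominated_convergence[OF _ _ integrable_abs[OF ifx]])
    show "AE x in \<mu>. (\<lambda>m. f x * ((x \<bullet> b) * cutoff m x)) \<longlonglongrightarrow> f x * (x \<bullet> b)"
      by (intro AE_I2 tendsto_mult tendsto_const) (use tendsto_mult[OF tendsto_const cutoff_tendsto] in simp)
    show "AE x in \<mu>. norm (f x * ((x \<bullet> b) * cutoff m x)) \<le> \<bar>f x * (x \<bullet> b)\<bar>" for m
      by (intro AE_I2) (auto simp: abs_mult cutoff_bounds mult.assoc[symmetric] intro: mult_right_le_one_le)
  qed measurable
  \<comment> \<open>The first bound yields pointwise convergence to 0; the second is free of
    \<open>m\<close> and serves as the integrable majorant.\<close>
  have xg: "\<bar>(x \<bullet> b) * (G x \<bullet> gradient (cutoff m) x)\<bar> \<le> (norm x * norm b * norm (G x)) * (C / Suc m)"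
    and xg': "\<bar>(x \<bullet> b) * (G x \<bullet> gradient (cutoff m) x)\<bar> \<le> norm (G x) * (norm b * C)" for m x
  proof -
    have *: "\<bar>(x \<bullet> b) * (G x \<bullet> gradient (cutoff m) x)\<bar> \<le> (norm x * norm b) * (norm (G x) * norm (gradient (cutoff m) x))"
      unfolding abs_mult by (intro mult_mono Cauchy_Schwarz_ineq2) auto
    also have "\<dots> \<le> (norm x * norm b) * (norm (G x) * (C / Suc m))"
      by (intro mult_left_mono C) auto
    finally show "\<bar>(x \<bullet> b) * (G x \<bullet> gradient (cutoff m) x)\<bar> \<le> (norm x * norm b * norm (G x)) * (C / Suc m)"
      by (simp add: mult.assoc)
    have "(norm x * norm b) * (norm (G x) * norm (gradient (cutoff m) x))
        = (norm (G x) * norm b) * (norm x * norm (gradient (cutoff m) x))" by simp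
    also have "\<dots> \<le> (norm (G x) * norm b) * C" by (intro mult_left_mono C) auto
    finally show "\<bar>(x \<bullet> b) * (G x \<bullet> gradient (cutoff m) x)\<bar> \<le> norm (G x) * (norm b * C)"
      using * by (simp add: mult.assoc)
  qed
  have "(\<lambda>m. \<integral>x. G x \<bullet> gradient (\<lambda>x. (x \<bullet> b) * cutoff m x) x \<partial>\<mu>) \<longlonglongrightarrow> (\<integral>x. G x \<bullet> b \<partial>\<mu>)"
    unfolding gtb inner_add_right inner_scaleR_right
  proof (rule integral_dominated_convergence[OF _ _ integrable_mult_left[OF iG, of "norm b * C + norm b"]])
    show "AE x in \<mu>. (\<lambda>m. (x \<bullet> b) * (G x \<bullet> gradient (cutoff m) x) + cutoff m x * (G x \<bullet> b)) \<longlonglongrightarrow> G x \<bullet> b"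
    proof (rule AE_I2)
      fix x
      have "(\<lambda>m. (x \<bullet> b) * (G x \<bullet> gradient (cutoff m) x)) \<longlonglongrightarrow> 0"
        by (rule Lim_null_comparison[OF _ CN[of "norm x * norm b * norm (G x)"]])
           (intro always_eventually allI, unfold real_norm_def, rule xg)
      from tendsto_add[OF this tendsto_mult[OF cutoff_tendsto tendsto_const]]
      show "(\<lambda>m. (x \<bullet> b) * (G x \<bullet> gradient (cutoff m) x) + cutoff m x * (G x \<bullet> b)) \<longlonglongrightarrow> G x \<bullet> b" by simp
    qed
    show "AE x in \<mu>. norm ((x \<bullet> b) * (G x \<bullet> gradient (cutoff m) x) + cutoff m x * (G x \<bullet> b)) \<le> norm (G x) * (norm b * C + norm b)" for m
    proof (rule AE_I2)
      fix x
      have "\<bar>cutoff m x * (G x \<bullet> b)\<bar> \<le> 1 * (norm (G x) * norm b)"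
        unfolding abs_mult by (intro mult_mono Cauchy_Schwarz_ineq2) (auto simp: cutoff_bounds)
      then show "norm ((x \<bullet> b) * (G x \<bullet> gradient (cutoff m) x) + cutoff m x * (G x \<bullet> b)) \<le> norm (G x) * (norm b * C + norm b)"
        using xg'[of x m] unfolding real_norm_def distrib_left by linarith
    qed
  qed measurable
  then have "(\<lambda>m. - (\<integral>x. f x * ((x \<bullet> b) * cutoff m x) \<partial>\<mu>)) \<longlonglongrightarrow> (\<integral>x. G x \<bullet> b \<partial>\<mu>)" by (simp only: w[OF tb])
  from LIMSEQ_unique[OF this tendsto_minus[OF l2]]
  show "(\<integral>x. G x \<bullet> b \<partial>\<mu>) = - (\<integral>x. f x * (x \<bullet> b) \<partial>\<mu>)" .
qed

text \<open>Apply the moment lemma to the constant field \<open>e\<close>: the defining property of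
  the score is the equation that it requires.\<close>

lemma score_mean: "(\<integral>x. \<rho> x \<bullet> e \<partial>\<mu>) = 0"
  and score_position: "(\<integral>x. (\<rho> x \<bullet> e) * (x \<bullet> b) \<partial>\<mu>) = - (e \<bullet> b)"
proof -
  have w: "(\<integral>x. e \<bullet> gradient \<phi> x \<partial>\<mu>) = - (\<integral>x. (\<rho> x \<bullet> e) * \<phi> x \<partial>\<mu>)" if "test_function \<phi>" for \<phi>
    using score[OF that, of e] by (simp add: inner_commute mult.commute)
  note d = divergence_moments[OF const_L2[of e] L2_inner_const[OF score_L2] w]
  show "(\<integral>x. \<rho> x \<bullet> e \<partial>\<mu>) = 0" by (rule d(1))
  show "(\<integral>x. (\<rho> x \<bullet> e) * (x \<bullet> b) \<partial>\<mu>) = - (e \<bullet> b)" using d(2)[of b] by (simp add: prob_space)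
qed

lemma position_mean: "(\<integral>x. x \<bullet> e \<partial>\<mu>) = 0"
  using L2_integrable[OF position_L2] mean_zero by simp

lemma sum_norm_Basis: "(\<Sum>b\<in>Basis. (v \<bullet> b)\<^sup>2) = (norm v)\<^sup>2" for v :: 'b
  unfolding power2_norm_eq_inner euclidean_inner[of v v] by (simp add: power2_eq_square)

lemma integral_norm_square_Basis:
  fixes f :: "'b \<Rightarrow> 'b"
  assumes "square_integrable \<mu> f"
  shows "(\<integral>x. (norm (f x))\<^sup>2 \<partial>\<mu>) = (\<Sum>b\<in>Basis. \<integral>x. (f x \<bullet> b)\<^sup>2 \<partial>\<mu>)"
  using L2_inner_const[OF assms]
  by (subst Bochner_Integration.integral_sum[symmetric]) (auto simp: square_integrable_def sum_norm_Basis)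

section \<open>The relative score and its divergence equation\<close>

definition h :: "'b \<Rightarrow> 'b" where "h x = \<rho> x + x"

lemma h_L2: "square_integrable \<mu> h"
  unfolding h_def by (intro L2_add score_L2 position_L2)

text \<open>The cross term E[x \<bullet> \<rho>] is minus the dimension by
  \<open>score_position\<close>, and E|x|^2 is the dimension by \<open>covariance\<close>. The case
  s = 1 relates \<open>h\<close> to the score; a general \<open>s\<close> is needed for the
  minimisation.\<close>

lemma norm_affine_score:
  "(\<integral>x. (norm (s *\<^sub>R \<rho> x + x))\<^sup>2 \<partial>\<mu>) = s\<^sup>2 * (\<integral>x. (norm (\<rho> x))\<^sup>2 \<partial>\<mu>) - 2 * s * DIM('b) + DIM('b)"
proof -
  have x2: "(\<integral>x. (norm x)\<^sup>2 \<partial>\<mu>) = DIM('b)"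
    using covariance by (subst integral_norm_square_Basis[OF position_L2]) (simp add: power2_eq_square)
  have "(\<integral>x. x \<bullet> \<rho> x \<partial>\<mu>) = (\<integral>x. (\<Sum>b\<in>Basis. (\<rho> x \<bullet> b) * (x \<bullet> b)) \<partial>\<mu>)"
    by (subst euclidean_inner) (simp add: mult.commute)
  also have "\<dots> = (\<Sum>b\<in>Basis. \<integral>x. (\<rho> x \<bullet> b) * (x \<bullet> b) \<partial>\<mu>)"
    by (intro Bochner_Integration.integral_sum L2_mult_integrable L2_inner_const score_L2 position_L2)
  also have "\<dots> = - real DIM('b)" by (simp add: score_position sum_negf)
  finally have xr: "(\<integral>x. x \<bullet> \<rho> x \<partial>\<mu>) = - real DIM('b)" .
  show ?thesis
    using norm_add_scaleR_integral[OF position_L2 score_L2, of s] by (simp add: x2 xr add.commute)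
qed

lemma norm_score: "(\<integral>x. (norm (\<rho> x))\<^sup>2 \<partial>\<mu>) = (\<integral>x. (norm (h x))\<^sup>2 \<partial>\<mu>) + DIM('b)"
  using norm_affine_score[of 1] by (simp add: h_def)

lemma h_mean: "(\<integral>x. h x \<bullet> e \<partial>\<mu>) = 0"
  using score_mean[of e] position_mean[of e]
    L2_integrable[OF L2_inner_const[OF score_L2]]
    L2_integrable[OF L2_inner_const[OF position_L2]]
  by (simp add: h_def inner_add_left)

text \<open>The Riesz step is applied to \<open>f\<close>, the component of s \<rho> + x along
  \<open>k\<close>, rather than to that of \<open>h\<close>. Since \<open>f\<close> is centred,
  E[f \<phi>] sees only \<phi> minus its mean. Cauchy-Schwarz and the Poincare inequality then bound
  the functional by the gradient norm, with constant R E[f^2]. The parameter \<open>s\<close> stays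
  free and is optimised later.\<close>

lemma divergence_equation:
  assumes k: "k \<in> Basis"
  obtains Q where "square_integrable \<mu> Q" "\<And>b. (\<integral>x. Q x \<bullet> b \<partial>\<mu>) = 0"
    "\<And>\<phi>. test_function \<phi> \<Longrightarrow> (\<integral>x. Q x \<bullet> gradient \<phi> x \<partial>\<mu>) = - (\<integral>x. (h x \<bullet> k) * \<phi> x \<partial>\<mu>)"
    "(\<integral>x. (norm (Q x))\<^sup>2 \<partial>\<mu>) \<le> R * (\<integral>x. ((s *\<^sub>R \<rho> x + x) \<bullet> k)\<^sup>2 \<partial>\<mu>)"
proof -
  define f where "f x = (s *\<^sub>R \<rho> x + x) \<bullet> k" for x
  have fL2: "square_integrable \<mu> f"
    unfolding f_def by (intro L2_inner_const L2_add L2_scale score_L2 position_L2)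
  have f0: "(\<integral>x. f x \<partial>\<mu>) = 0"
    using score_mean[of k] position_mean[of k]
      L2_integrable[OF L2_inner_const[OF score_L2]]
      L2_integrable[OF L2_inner_const[OF position_L2]]
    by (simp add: f_def inner_add_left)
  have bd: "(- (\<integral>x. f x * \<phi> x \<partial>\<mu>))\<^sup>2 \<le> (R * (\<integral>x. (f x)\<^sup>2 \<partial>\<mu>)) * (\<integral>x. (norm (gradient \<phi> x))\<^sup>2 \<partial>\<mu>)"
    if t: "test_function \<phi>" for \<phi>
  proof -
    define m where "m = (\<integral>x. \<phi> x \<partial>\<mu>)"
    have i\<phi>: "integrable \<mu> \<phi>" "integrable \<mu> (\<lambda>x. (\<phi> x)\<^sup>2)"
      using L2_integrable[OF test_L2[OF t]] test_L2[OF t] by (auto simp: square_integrable_def)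
    have "(\<integral>x. f x * \<phi> x \<partial>\<mu>) = (\<integral>x. f x * (\<phi> x - m) \<partial>\<mu>)"
      using L2_mult_integrable[OF fL2 test_L2[OF t]] L2_integrable[OF fL2] f0
      by (simp add: right_diff_distrib)
    moreover have "(\<integral>x. f x * (\<phi> x - m) \<partial>\<mu>)\<^sup>2 \<le> (\<integral>x. (f x)\<^sup>2 \<partial>\<mu>) * (\<integral>x. (\<phi> x - m)\<^sup>2 \<partial>\<mu>)"
      using integral_Cauchy_Schwarz[OF fL2 L2_diff[OF test_L2[OF t] const_L2[of m]]] by simp
    moreover have "(\<integral>x. (\<phi> x - m)\<^sup>2 \<partial>\<mu>) = (\<integral>x. (\<phi> x)\<^sup>2 \<partial>\<mu>) - m\<^sup>2"
    proof -
      have "(\<integral>x. (\<phi> x - m)\<^sup>2 \<partial>\<mu>) = (\<integral>x. (\<phi> x)\<^sup>2 - (2 * m) * \<phi> x + m\<^sup>2 \<partial>\<mu>)"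
        by (simp add: power2_diff algebra_simps)
      also have "\<dots> = (\<integral>x. (\<phi> x)\<^sup>2 \<partial>\<mu>) - (2 * m) * m + m\<^sup>2"
        using i\<phi> by (simp add: prob_space flip: m_def)
      finally show ?thesis by (simp add: power2_eq_square)
    qed
    moreover have "(\<integral>x. (f x)\<^sup>2 \<partial>\<mu>) * ((\<integral>x. (\<phi> x)\<^sup>2 \<partial>\<mu>) - m\<^sup>2) \<le> (\<integral>x. (f x)\<^sup>2 \<partial>\<mu>) * (R * (\<integral>x. (norm (gradient \<phi> x))\<^sup>2 \<partial>\<mu>))"
      unfolding m_def by (intro mult_left_mono poincare t) simp
    ultimately show ?thesis by (simp add: mult_ac)
  qed
  obtain Q' where Q': "square_integrable \<mu> Q'" "(\<integral>x. (norm (Q' x))\<^sup>2 \<partial>\<mu>) \<le> R * (\<integral>x. (f x)\<^sup>2 \<partial>\<mu>)"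
    "\<And>\<phi>. test_function \<phi> \<Longrightarrow> (\<integral>x. Q' x \<bullet> gradient \<phi> x \<partial>\<mu>) = - (\<integral>x. f x * \<phi> x \<partial>\<mu>)"
  proof (rule Riesz_test_functions[of gradient "\<lambda>\<phi>. - (\<integral>x. f x * \<phi> x \<partial>\<mu>)" "R * (\<integral>x. (f x)\<^sup>2 \<partial>\<mu>)"])
    fix \<phi> \<psi> :: "'b \<Rightarrow> real" and c :: real
    assume t: "test_function \<phi>" "test_function \<psi>"
    show "gradient (\<lambda>x. \<phi> x + c * \<psi> x) = (\<lambda>x. gradient \<phi> x + c *\<^sub>R gradient \<psi> x)"
      using t[THEN test_smooth] by (intro ext) (simp add: gradient_add smooth_mult smooth_const gradient_scale)
    show "- (\<integral>x. f x * (\<phi> x + c * \<psi> x) \<partial>\<mu>) = - (\<integral>x. f x * \<phi> x \<partial>\<mu>) + c * - (\<integral>x. f x * \<psi> x \<partial>\<mu>)"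
      using L2_mult_integrable[OF fL2 test_L2[OF t(1)]] L2_mult_integrable[OF fL2 test_L2[OF t(2)]]
      by (simp add: distrib_left mult.left_commute)
  next
    show "R * (\<integral>x. (f x)\<^sup>2 \<partial>\<mu>) \<ge> 0" using R_nonneg by simp
  qed (use test_gradient_L2 bd that in \<open>blast+\<close>)
  \<comment> \<open>The right sides differ by h \<bullet> k - f = (1 - s) (\<rho> \<bullet> k), and
    by the score identity this is the right side produced by the constant field (1 - s) k.\<close>
  define Q where "Q x = Q' x + (1 - s) *\<^sub>R k" for x
  have QL2: "square_integrable \<mu> Q" unfolding Q_def by (intro L2_add Q' const_L2)
  have Qw: "(\<integral>x. Q x \<bullet> gradient \<phi> x \<partial>\<mu>) = - (\<integral>x. (h x \<bullet> k) * \<phi> x \<partial>\<mu>)" if t: "test_function \<phi>" for \<phi>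
  proof -
    have "integrable \<mu> (\<lambda>x. k \<bullet> gradient \<phi> x)"
      using L2_inner[OF const_L2 test_gradient_L2[OF t]] .
    then have "(\<integral>x. Q x \<bullet> gradient \<phi> x \<partial>\<mu>) = (\<integral>x. Q' x \<bullet> gradient \<phi> x \<partial>\<mu>) + (1 - s) * (\<integral>x. k \<bullet> gradient \<phi> x \<partial>\<mu>)"
      using L2_inner[OF Q'(1) test_gradient_L2[OF t]]
      by (simp add: Q_def inner_add_left)
    also have "\<dots> = - ((\<integral>x. f x * \<phi> x \<partial>\<mu>) + (1 - s) * (\<integral>x. \<phi> x * (\<rho> x \<bullet> k) \<partial>\<mu>))"
      by (simp add: Q'(3)[OF t] score[OF t] inner_commute[of k "gradient _ _"])
    also have "\<dots> = - (\<integral>x. f x * \<phi> x + (1 - s) * (\<phi> x * (\<rho> x \<bullet> k)) \<partial>\<mu>)"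
      using L2_mult_integrable[OF fL2 test_L2[OF t]]
        L2_mult_integrable[OF test_L2[OF t] L2_inner_const[OF score_L2]] by simp
    also have "(\<lambda>x. f x * \<phi> x + (1 - s) * (\<phi> x * (\<rho> x \<bullet> k))) = (\<lambda>x. (h x \<bullet> k) * \<phi> x)"
      by (auto simp: f_def h_def inner_add_left algebra_simps)
    finally show ?thesis .
  qed
  \<comment> \<open>The mean is minus the correlation of h \<bullet> k with x \<bullet> b. The score
    contributes - (k \<bullet> b) to it and the position contributes + (k \<bullet> b), so they
    cancel.\<close>
  have Q0: "(\<integral>x. Q x \<bullet> b \<partial>\<mu>) = 0" for b
  proof -
    have "(\<integral>x. Q x \<bullet> b \<partial>\<mu>) = - (\<integral>x. (h x \<bullet> k) * (x \<bullet> b) \<partial>\<mu>)"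
      by (rule divergence_moments(2)[OF QL2 L2_inner_const[OF h_L2] Qw])
    also have "(\<integral>x. (h x \<bullet> k) * (x \<bullet> b) \<partial>\<mu>) = (\<integral>x. (\<rho> x \<bullet> k) * (x \<bullet> b) \<partial>\<mu>) + (\<integral>x. (x \<bullet> k) * (x \<bullet> b) \<partial>\<mu>)"
      using L2_mult_integrable[OF L2_inner_const[OF score_L2] L2_inner_const[OF position_L2]]
        L2_mult_integrable[OF L2_inner_const[OF position_L2] L2_inner_const[OF position_L2]]
      by (simp add: h_def inner_add_left distrib_right)
    also have "(\<integral>x. (x \<bullet> k) * (x \<bullet> b) \<partial>\<mu>) = (\<integral>x. (\<Sum>c\<in>Basis. (b \<bullet> c) * ((x \<bullet> k) * (x \<bullet> c))) \<partial>\<mu>)"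
      by (subst (2) euclidean_inner) (simp add: sum_distrib_left mult_ac)
    also have "\<dots> = (\<Sum>c\<in>Basis. (b \<bullet> c) * (\<integral>x. (x \<bullet> k) * (x \<bullet> c) \<partial>\<mu>))"
      using L2_mult_integrable[OF L2_inner_const[OF position_L2] L2_inner_const[OF position_L2]]
      by (subst Bochner_Integration.integral_sum) auto
    also have "\<dots> = b \<bullet> k" using k by (simp add: covariance if_distrib[of "\<lambda>z. _ * z"] cong: if_cong)
    finally show ?thesis by (simp add: score_position inner_commute[of k b])
  qed
  \<comment> \<open>\<open>Q\<close> is the centred version of \<open>Q'\<close>, so its second
    moment is the smaller one and the Riesz bound is inherited.\<close>
  have "(\<integral>x. (norm (Q' x))\<^sup>2 \<partial>\<mu>) = (\<integral>x. (norm (Q x + (s - 1) *\<^sub>R k))\<^sup>2 \<partial>\<mu>)"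
    by (simp add: Q_def algebra_simps)
  also have "\<dots> = (\<integral>x. (norm (Q x))\<^sup>2 \<partial>\<mu>) + (s - 1)\<^sup>2"
    using k by (subst norm_add_scaleR_integral[OF QL2 const_L2]) (simp add: Q0 prob_space)
  finally have "(\<integral>x. (norm (Q x))\<^sup>2 \<partial>\<mu>) \<le> R * (\<integral>x. (f x)\<^sup>2 \<partial>\<mu>)"
    using Q'(2) zero_le_power2[of "s - 1"] by linarith
  then show thesis by (intro that[OF QL2 Q0 Qw]) (auto simp: f_def)
qed

text \<open>The choice \<open>s = d / E|\<rho>|^2\<close> minimises \<open>E|s \<rho> + x|^2\<close>.\<close>

lemma divergence_equations:
  obtains Q where "\<And>k. k \<in> Basis \<Longrightarrow> square_integrable \<mu> (Q k)"
    "\<And>k b. k \<in> Basis \<Longrightarrow> (\<integral>x. Q k x \<bullet> b \<partial>\<mu>) = 0"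
    "\<And>k \<phi>. k \<in> Basis \<Longrightarrow> test_function \<phi> \<Longrightarrow> (\<integral>x. Q k x \<bullet> gradient \<phi> x \<partial>\<mu>) = - (\<integral>x. (h x \<bullet> k) * \<phi> x \<partial>\<mu>)"
    "(\<integral>x. (norm (\<rho> x))\<^sup>2 \<partial>\<mu>) * (\<Sum>k\<in>Basis. \<integral>x. (norm (Q k x))\<^sup>2 \<partial>\<mu>) \<le> R * DIM('b) * (\<integral>x. (norm (h x))\<^sup>2 \<partial>\<mu>)"
proof -
  define S where "S = (\<integral>x. (norm (\<rho> x))\<^sup>2 \<partial>\<mu>)"
  define s where "s = DIM('b) / S"
  have S: "S = (\<integral>x. (norm (h x))\<^sup>2 \<partial>\<mu>) + DIM('b)" unfolding S_def by (rule norm_score)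
  have S0: "S > 0" unfolding S by (rule add_nonneg_pos) auto
  have "\<forall>k. \<exists>Q. k \<in> Basis \<longrightarrow> square_integrable \<mu> Q \<and> (\<forall>b. (\<integral>x. Q x \<bullet> b \<partial>\<mu>) = 0) \<and>
    (\<forall>\<phi>. test_function \<phi> \<longrightarrow> (\<integral>x. Q x \<bullet> gradient \<phi> x \<partial>\<mu>) = - (\<integral>x. (h x \<bullet> k) * \<phi> x \<partial>\<mu>)) \<and>
    (\<integral>x. (norm (Q x))\<^sup>2 \<partial>\<mu>) \<le> R * (\<integral>x. ((s *\<^sub>R \<rho> x + x) \<bullet> k)\<^sup>2 \<partial>\<mu>)"
    (is "\<forall>k. \<exists>Q. ?G k Q")
  proof
    fix k
    show "\<exists>Q. ?G k Q"
    proof (cases "k \<in> Basis")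
      case True
      show ?thesis by (rule divergence_equation[OF True, of s]) auto
    qed auto
  qed
  from choice[OF this] obtain Q where "\<forall>k. ?G k (Q k)"
    ..
  then have Q: "\<And>k. k \<in> Basis \<Longrightarrow> square_integrable \<mu> (Q k)" "\<And>k b. k \<in> Basis \<Longrightarrow> (\<integral>x. Q k x \<bullet> b \<partial>\<mu>) = 0"
    "\<And>k \<phi>. k \<in> Basis \<Longrightarrow> test_function \<phi> \<Longrightarrow> (\<integral>x. Q k x \<bullet> gradient \<phi> x \<partial>\<mu>) = - (\<integral>x. (h x \<bullet> k) * \<phi> x \<partial>\<mu>)"
    "\<And>k. k \<in> Basis \<Longrightarrow> (\<integral>x. (norm (Q k x))\<^sup>2 \<partial>\<mu>) \<le> R * (\<integral>x. ((s *\<^sub>R \<rho> x + x) \<bullet> k)\<^sup>2 \<partial>\<mu>)"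
    by blast+
  have aL2: "square_integrable \<mu> (\<lambda>x. s *\<^sub>R \<rho> x + x)"
    by (intro L2_add L2_scale score_L2 position_L2)
  have "(\<Sum>k\<in>Basis. \<integral>x. (norm (Q k x))\<^sup>2 \<partial>\<mu>) \<le> (\<Sum>k\<in>Basis. R * (\<integral>x. ((s *\<^sub>R \<rho> x + x) \<bullet> k)\<^sup>2 \<partial>\<mu>))"
    by (intro sum_mono Q)
  also have "\<dots> = R * (s\<^sup>2 * S - 2 * s * DIM('b) + DIM('b))"
    using integral_norm_square_Basis[OF aL2] norm_affine_score[of s] by (simp add: sum_distrib_left S_def)
  finally have "S * (\<Sum>k\<in>Basis. \<integral>x. (norm (Q k x))\<^sup>2 \<partial>\<mu>) \<le> S * (R * (s\<^sup>2 * S - 2 * s * DIM('b) + DIM('b)))"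
    using S0 by (intro mult_left_mono) auto
  \<comment> \<open>With this \<open>s\<close> the bracket equals d - d^2 / S = d (S - d) / S for d
    the dimension. The factor \<open>S\<close> cancels, and S - d is the second moment of
    \<open>h\<close>.\<close>
  also have "\<dots> = R * DIM('b) * (S - DIM('b))"
    using S0 by (simp add: s_def field_simps power2_eq_square)
  finally show thesis by (intro that[OF Q(1-3)]) (simp_all add: S flip: S_def)
qed

end

section \<open>Normalised sums of independent vectors\<close>

context score_law
begin

section \<open>Integrals of functions of one or two coordinates\<close>

abbreviation law_power :: "nat set \<Rightarrow> (nat \<Rightarrow> 'b) measure" where
  "law_power I \<equiv> PiM I (\<lambda>_. \<mu>)"

abbreviation scaled_sum :: "real \<Rightarrow> nat set \<Rightarrow> (nat \<Rightarrow> 'b) \<Rightarrow> 'b" where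
  "scaled_sum c I x \<equiv> c *\<^sub>R (\<Sum>j\<in>I. x j)"

lemma prob_space_law_power: "prob_space (law_power I)"
  by (rule prob_space_PiM) (rule prob_space_axioms)

lemma product_sigma_finite_law: "product_sigma_finite (\<lambda>_::nat. \<mu>)"
  by unfold_locales

lemma component_measurable [measurable]: "i \<in> I \<Longrightarrow> (\<lambda>x. x i) \<in> borel_measurable (law_power I)"
  using measurable_component_singleton[of i I "\<lambda>_. \<mu>"]
  by (simp add: measurable_cong_sets[OF refl sets_law])

lemma product_pair:
  fixes u v :: "'b \<Rightarrow> real"
  assumes I: "finite I" "i \<in> I" "j \<in> I" "i \<noteq> j" and uv: "integrable \<mu> u" "integrable \<mu> v"
  shows "integrable (law_power I) (\<lambda>x. u (x i) * v (x j))"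
    and "(\<integral>x. u (x i) * v (x j) \<partial>law_power I) = (\<integral>x. u x \<partial>\<mu>) * (\<integral>x. v x \<partial>\<mu>)"
proof -
  interpret product_sigma_finite "\<lambda>_::nat. \<mu>" by (rule product_sigma_finite_law)
  \<comment> \<open>Padding with the constant 1 in the other coordinates makes the product formula
    over the whole index set applicable.\<close>
  define f where "f k y = (if k = i then u y else 1) * (if k = j then v y else 1)" for k y
  have fi: "integrable \<mu> (f k)" for k using uv I(4) by (cases "k = i"; cases "k = j") (auto simp: f_def[abs_def])
  have "(\<Prod>k\<in>I. f k (x k)) = u (x i) * v (x j)" for x
    using I by (simp add: f_def prod.distrib prod.delta)
  moreover have "(\<Prod>k\<in>I. \<integral>y. f k y \<partial>\<mu>) = (\<integral>x. u x \<partial>\<mu>) * (\<integral>x. v x \<partial>\<mu>)"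
  proof -
    have "(\<integral>y. f k y \<partial>\<mu>) = (if k = i then \<integral>x. u x \<partial>\<mu> else 1) * (if k = j then \<integral>x. v x \<partial>\<mu> else 1)" for k
      using I(4) by (auto simp: f_def prob_space)
    then show ?thesis using I by (simp add: prod.distrib prod.delta)
  qed
  ultimately show "integrable (law_power I) (\<lambda>x. u (x i) * v (x j))"
    "(\<integral>x. u (x i) * v (x j) \<partial>law_power I) = (\<integral>x. u x \<partial>\<mu>) * (\<integral>x. v x \<partial>\<mu>)"
    using product_integrable_prod[OF I(1), of f] product_integral_prod[OF I(1), of f] fi by auto
qed

lemma product_coordinate:
  fixes u :: "'b \<Rightarrow> real"
  assumes I: "finite I" "i \<in> I" and u: "integrable \<mu> u"
  shows "integrable (law_power I) (\<lambda>x. u (x i))"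
    and "(\<integral>x. u (x i) \<partial>law_power I) = (\<integral>x. u x \<partial>\<mu>)"
proof -
  interpret product_sigma_finite "\<lambda>_::nat. \<mu>" by (rule product_sigma_finite_law)
  define f where "f k y = (if k = i then u y else 1)" for k y
  have fi: "integrable \<mu> (f k)" for k using u by (cases "k = i") (auto simp: f_def[abs_def])
  have "(\<Prod>k\<in>I. f k (x k)) = u (x i)" for x using I by (simp add: f_def prod.delta)
  moreover have "(\<Prod>k\<in>I. \<integral>y. f k y \<partial>\<mu>) = (\<integral>x. u x \<partial>\<mu>)"
  proof -
    have "(\<integral>y. f k y \<partial>\<mu>) = (if k = i then \<integral>x. u x \<partial>\<mu> else 1)" for k
      by (auto simp: f_def prob_space)
    then show ?thesis using I by (simp add: prod.delta)
  qed
  ultimately show "integrable (law_power I) (\<lambda>x. u (x i))" "(\<integral>x. u (x i) \<partial>law_power I) = (\<integral>x. u x \<partial>\<mu>)"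
    using product_integrable_prod[OF I(1), of f] product_integral_prod[OF I(1), of f] fi by auto
qed

text \<open>Fubini in a single coordinate with all others frozen. One-variable identities for \<mu>,
  such as the score and divergence equations and the vanishing of means, enter the product space in
  this form.\<close>

lemma product_integral_eqI:
  fixes F G :: "(nat \<Rightarrow> 'b) \<Rightarrow> real"
  assumes I: "finite I" "i \<in> I" and FG: "integrable (law_power I) F" "integrable (law_power I) G"
    and eq: "\<And>x. (\<integral>y. F (x(i := y)) \<partial>\<mu>) = (\<integral>y. G (x(i := y)) \<partial>\<mu>)"
  shows "(\<integral>x. F x \<partial>law_power I) = (\<integral>x. G x \<partial>law_power I)"
proof -
  interpret product_sigma_finite "\<lambda>_::nat. \<mu>" by (rule product_sigma_finite_law)
  have J: "insert i (I - {i}) = I" "finite (I - {i})" "i \<notin> I - {i}" using I by auto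
  from product_integral_insert[OF J(2,3), unfolded J(1), OF FG(1)]
    product_integral_insert[OF J(2,3), unfolded J(1), OF FG(2)]
  show ?thesis by (simp add: eq)
qed

lemma coordinate_L2:
  assumes "finite I" "i \<in> I" "square_integrable \<mu> f"
  shows "square_integrable (law_power I) (\<lambda>x. f (x i))"
proof -
  have [measurable]: "f \<in> borel_measurable borel" using assms(3) by (simp add: square_integrable_def)
  show ?thesis
    using product_coordinate(1)[OF assms(1,2), of "\<lambda>x. (norm (f x))\<^sup>2"] assms(2,3)
    unfolding square_integrable_def by auto
qed

lemma pair_L2:
  fixes f g :: "'b \<Rightarrow> 'b"
  assumes I: "finite I" "i \<in> I" "j \<in> I" "i \<noteq> j" and f: "square_integrable \<mu> f" and g: "square_integrable \<mu> g"
  shows "square_integrable (law_power I) (\<lambda>x. f (x i) \<bullet> g (x j))"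
    and "(\<integral>x. (f (x i) \<bullet> g (x j))\<^sup>2 \<partial>law_power I) \<le> (\<integral>x. (norm (f x))\<^sup>2 \<partial>\<mu>) * (\<integral>x. (norm (g x))\<^sup>2 \<partial>\<mu>)"
proof -
  have [measurable]: "f \<in> borel_measurable borel" "g \<in> borel_measurable borel"
    using f g by (auto simp: square_integrable_def)
  have [measurable]: "(\<lambda>x. f (x i) \<bullet> g (x j)) \<in> borel_measurable (law_power I)"
    using I(2,3) by measurable
  have fg: "integrable \<mu> (\<lambda>x. (norm (f x))\<^sup>2)" "integrable \<mu> (\<lambda>x. (norm (g x))\<^sup>2)"
    using f g by (auto simp: square_integrable_def)
  note p = product_pair[OF I fg]
  have b: "(f (x i) \<bullet> g (x j))\<^sup>2 \<le> (norm (f (x i)))\<^sup>2 * (norm (g (x j)))\<^sup>2" for x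
    using Cauchy_Schwarz_ineq[of "f (x i)" "g (x j)"] by (simp add: power2_norm_eq_inner)
  show sq: "square_integrable (law_power I) (\<lambda>x. f (x i) \<bullet> g (x j))"
    unfolding square_integrable_def
  proof
    show "integrable (law_power I) (\<lambda>x. (norm (f (x i) \<bullet> g (x j)))\<^sup>2)"
      by (rule Bochner_Integration.integrable_bound[OF p(1)]) (use b in \<open>auto intro!: AE_I2\<close>)
  qed measurable
  have "(\<integral>x. (f (x i) \<bullet> g (x j))\<^sup>2 \<partial>law_power I) \<le> (\<integral>x. (norm (f (x i)))\<^sup>2 * (norm (g (x j)))\<^sup>2 \<partial>law_power I)"
    using sq by (intro integral_mono p(1) b) (simp add: square_integrable_def)
  then show "(\<integral>x. (f (x i) \<bullet> g (x j))\<^sup>2 \<partial>law_power I) \<le> (\<integral>x. (norm (f x))\<^sup>2 \<partial>\<mu>) * (\<integral>x. (norm (g x))\<^sup>2 \<partial>\<mu>)"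
    by (simp add: p(2))
qed

section \<open>Integration by parts for functions of the scaled sum\<close>

lemma scaled_sum_update:
  fixes x :: "nat \<Rightarrow> 'b"
  assumes "finite I" "i \<in> I"
  shows "scaled_sum c I (x(i := y)) = c *\<^sub>R y + scaled_sum c (I - {i}) x"
  using assms by (simp add: sum.remove[of I i] scaleR_add_right)

lemma scaled_sum_measurable [measurable]: "(\<lambda>x. scaled_sum c I x) \<in> borel_measurable (law_power I)"
  by (intro borel_measurable_scaleR borel_measurable_const borel_measurable_sum component_measurable)

lemma test_scaled_sum_L2:
  assumes t: "test_function \<phi>"
  shows "square_integrable (law_power I) (\<lambda>x. \<phi> (scaled_sum c I x))"
    and "square_integrable (law_power I) (\<lambda>x. gradient \<phi> (scaled_sum c I x))"
proof -
  interpret P: prob_space "law_power I" by (rule prob_space_law_power)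
  note [measurable] = test_measurable[OF t]
  obtain B where "\<And>x. \<bar>\<phi> x\<bar> \<le> B" "\<And>x. norm (gradient \<phi> x) \<le> B" "B \<ge> 0"
    by (rule test_bounded[OF t]) (rule that)
  then show "square_integrable (law_power I) (\<lambda>x. \<phi> (scaled_sum c I x))"
    "square_integrable (law_power I) (\<lambda>x. gradient \<phi> (scaled_sum c I x))"
    by (auto intro!: P.L2_bounded[of _ B])
qed

text \<open>With the other coordinates frozen the scaled sum is affine in \<open>x i\<close> with
  slope \<open>c\<close>, so the chain rule produces the factor \<open>c\<close>. The vector
  \<open>G x\<close> plays the part of the fixed direction \<open>e\<close> in the score identity,
  hence it must not depend on coordinate \<open>i\<close>.\<close>

lemma score_scaled_sum:
  assumes I: "finite I" "i \<in> I" and c: "c \<noteq> 0" and t: "test_function \<phi>"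
    and G: "\<And>x y. G (x(i := y)) = G x"
    and int: "integrable (law_power I) (\<lambda>x. \<phi> (scaled_sum c I x) * (\<rho> (x i) \<bullet> G x))"
      "integrable (law_power I) (\<lambda>x. gradient \<phi> (scaled_sum c I x) \<bullet> G x)"
  shows "(\<integral>x. \<phi> (scaled_sum c I x) * (\<rho> (x i) \<bullet> G x) \<partial>law_power I)
      = - (c * (\<integral>x. gradient \<phi> (scaled_sum c I x) \<bullet> G x \<partial>law_power I))"
proof -
  have "(\<integral>x. \<phi> (scaled_sum c I x) * (\<rho> (x i) \<bullet> G x) \<partial>law_power I)
      = (\<integral>x. - c * (gradient \<phi> (scaled_sum c I x) \<bullet> G x) \<partial>law_power I)"
  proof (rule product_integral_eqI[OF I int(1)])
    show "integrable (law_power I) (\<lambda>x. - c * (gradient \<phi> (scaled_sum c I x) \<bullet> G x))"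
      using int(2) by simp
    fix x :: "nat \<Rightarrow> 'b"
    define a where "a = scaled_sum c (I - {i}) x"
    have "(\<integral>y. c * (gradient \<phi> (c *\<^sub>R y + a) \<bullet> G x) \<partial>\<mu>) = - (\<integral>y. \<phi> (c *\<^sub>R y + a) * (\<rho> y \<bullet> G x) \<partial>\<mu>)"
      using score[OF test_affine[OF t c], of a "G x"] by (simp add: gradient_affine[OF test_smooth[OF t]])
    then show "(\<integral>y. \<phi> (scaled_sum c I (x(i := y))) * (\<rho> ((x(i := y)) i) \<bullet> G (x(i := y))) \<partial>\<mu>)
      = (\<integral>y. - c * (gradient \<phi> (scaled_sum c I (x(i := y))) \<bullet> G (x(i := y))) \<partial>\<mu>)"
      unfolding scaled_sum_update[OF I] G by (simp add: a_def)
  qed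
  then show ?thesis by simp
qed

text \<open>The second integration by parts, now in coordinate \<open>j\<close>. Its factor
  \<open>c\<close> is the one left behind by \<open>score_scaled_sum\<close>, so a pair term ends up
  representing the same functional as a single h (x j) \<bullet> k.\<close>

lemma divergence_scaled_sum:
  assumes I: "finite I" "j \<in> I" and c: "c \<noteq> 0" and t: "test_function \<phi>"
    and Q: "square_integrable \<mu> Q"
      "\<And>\<phi>. test_function \<phi> \<Longrightarrow> (\<integral>x. Q x \<bullet> gradient \<phi> x \<partial>\<mu>) = - (\<integral>x. (h x \<bullet> k) * \<phi> x \<partial>\<mu>)"
  shows "c * (\<integral>x. gradient \<phi> (scaled_sum c I x) \<bullet> Q (x j) \<partial>law_power I)
      = - (\<integral>x. \<phi> (scaled_sum c I x) * (h (x j) \<bullet> k) \<partial>law_power I)"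
proof -
  note tL2 = test_scaled_sum_L2[OF t, of I c]
  have "(\<integral>x. c * (gradient \<phi> (scaled_sum c I x) \<bullet> Q (x j)) \<partial>law_power I)
      = (\<integral>x. - (\<phi> (scaled_sum c I x) * (h (x j) \<bullet> k)) \<partial>law_power I)"
  proof (rule product_integral_eqI[OF I])
    show "integrable (law_power I) (\<lambda>x. c * (gradient \<phi> (scaled_sum c I x) \<bullet> Q (x j)))"
      using L2_inner[OF tL2(2) coordinate_L2[OF I Q(1)]] by simp
    show "integrable (law_power I) (\<lambda>x. - (\<phi> (scaled_sum c I x) * (h (x j) \<bullet> k)))"
      using L2_mult_integrable[OF tL2(1) L2_inner_const[OF coordinate_L2[OF I h_L2]]] by simp
    fix x :: "nat \<Rightarrow> 'b"
    define a where "a = scaled_sum c (I - {j}) x"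
    have "(\<integral>y. c * (Q y \<bullet> gradient \<phi> (c *\<^sub>R y + a)) \<partial>\<mu>) = - (\<integral>y. (h y \<bullet> k) * \<phi> (c *\<^sub>R y + a) \<partial>\<mu>)"
      using Q(2)[OF test_affine[OF t c], of a] by (simp add: gradient_affine[OF test_smooth[OF t]])
    then show "(\<integral>y. c * (gradient \<phi> (scaled_sum c I (x(j := y))) \<bullet> Q ((x(j := y)) j)) \<partial>\<mu>)
      = (\<integral>y. - (\<phi> (scaled_sum c I (x(j := y))) * (h ((x(j := y)) j) \<bullet> k)) \<partial>\<mu>)"
      unfolding scaled_sum_update[OF I] by (simp add: a_def inner_commute mult.commute)
  qed
  then show ?thesis by simp
qed

text \<open>\<open>W\<close> interpolates between the usual score of the sum, built from \<open>h (x i)\<close>, and the two-sample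
  terms \<open>\<rho> (x i) \<bullet> Q (x j)\<close>, which represent the same functional after two integrations by parts but
  are almost orthogonal, so that their normalised sum has variance of order \<open>1 / (n - 1)\<close>.\<close>

lemma representer_exists:
  assumes I: "finite I" "card I = n" "n \<ge> 2" and c: "c = 1 / sqrt n"
    and k: "k \<in> Basis" and QL2: "square_integrable \<mu> Q" and Q0: "\<And>b. (\<integral>x. Q x \<bullet> b \<partial>\<mu>) = 0"
    and Qw: "\<And>\<phi>. test_function \<phi> \<Longrightarrow> (\<integral>x. Q x \<bullet> gradient \<phi> x \<partial>\<mu>) = - (\<integral>x. (h x \<bullet> k) * \<phi> x \<partial>\<mu>)"
  obtains W where "square_integrable (law_power I) W"
    "\<And>\<phi>. test_function \<phi> \<Longrightarrow> (\<integral>x. \<phi> (scaled_sum c I x) * W x \<partial>law_power I)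
      = (\<integral>x. \<phi> (scaled_sum c I x) * ((scaled_sum c I x) \<bullet> k) \<partial>law_power I)
        - (\<integral>x. gradient \<phi> (scaled_sum c I x) \<bullet> k \<partial>law_power I)"
    "(\<integral>x. (W x)\<^sup>2 \<partial>law_power I) \<le> (1 - l)\<^sup>2 * (\<integral>x. (h x \<bullet> k)\<^sup>2 \<partial>\<mu>)
      + l\<^sup>2 * (2 * ((\<integral>x. (norm (\<rho> x))\<^sup>2 \<partial>\<mu>) * (\<integral>x. (norm (Q x))\<^sup>2 \<partial>\<mu>)) / (real n - 1))"
proof -
  interpret P: prob_space "law_power I" by (rule prob_space_law_power)
  let ?P = "law_power I" and ?Z = "\<lambda>x. scaled_sum c I x"
  define B where "B = (\<integral>x. (norm (\<rho> x))\<^sup>2 \<partial>\<mu>) * (\<integral>x. (norm (Q x))\<^sup>2 \<partial>\<mu>)"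
  define Off where "Off = (SIGMA j:I. I - {j})"
  \<comment> \<open>In a pair \<open>p\<close> the first index carries the divergence field and the
    second the score.\<close>
  define V where "V p x = \<rho> (x (snd p)) \<bullet> Q (x (fst p))" for p :: "nat \<times> nat" and x
  define u where "u y = h y \<bullet> k" for y
  define T1 where "T1 x = (\<Sum>i\<in>I. u (x i))" for x
  define T2 where "T2 x = (\<Sum>p\<in>Off. V p x)" for x
  \<comment> \<open>Each index is the first component of n - 1 pairs, so \<open>T2\<close>
    represents n - 1 times what \<open>T1\<close> represents. After division by n - 1 every value of
    \<open>l\<close> gives the same functional, and \<open>l\<close> can be used to reduce the
    variance.\<close>
  define W where "W x = ((1 - l) * c) * T1 x + (l * c / (real n - 1)) * T2 x" for x
  have c0: "c \<noteq> 0" and c2: "c\<^sup>2 * n = 1" using I(3) by (auto simp: c power_divide)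
  have n1: "real n - 1 > 0" using I(3) by simp
  have fO: "finite Off" using I(1) by (simp add: Off_def)
  have OffD: "snd p \<in> I" "fst p \<in> I" "snd p \<noteq> fst p" if "p \<in> Off" for p using that by (auto simp: Off_def)
  have sumOff: "(\<Sum>p\<in>Off. a (fst p)) = (real n - 1) * (\<Sum>j\<in>I. a j)" for a :: "nat \<Rightarrow> real"
  proof -
    have "(\<Sum>p\<in>Off. a (fst p)) = (\<Sum>j\<in>I. \<Sum>i\<in>I - {j}. a j)"
      unfolding Off_def using I(1) by (subst sum.Sigma) (auto simp: case_prod_beta)
    also have "\<dots> = (\<Sum>j\<in>I. (real n - 1) * a j)"
      using I by (intro sum.cong) (auto simp: card_Diff_singleton of_nat_diff)
    finally show ?thesis by (simp add: sum_distrib_left)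
  qed
  have cardOff: "real (card Off) = (real n - 1) * n" using sumOff[of "\<lambda>_. 1"] I by simp
  have uL2: "square_integrable \<mu> u" unfolding u_def by (rule L2_inner_const[OF h_L2])
  have uiL2: "square_integrable ?P (\<lambda>x. u (x i))" if "i \<in> I" for i by (rule coordinate_L2[OF I(1) that uL2])
  have VL2: "square_integrable ?P (V p)" if "p \<in> Off" for p
    unfolding V_def using pair_L2(1)[OF I(1) OffD[OF that] score_L2 QL2] .
  have VB: "(\<integral>x. (V p x)\<^sup>2 \<partial>?P) \<le> B" if "p \<in> Off" for p
    unfolding V_def B_def using pair_L2(2)[OF I(1) OffD[OF that] score_L2 QL2] .
  have T1L2: "square_integrable ?P T1" unfolding T1_def by (intro L2_sum uiL2)
  have T2L2: "square_integrable ?P T2" unfolding T2_def by (intro L2_sum VL2)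
  have WL2: "square_integrable ?P W"
    unfolding W_def
    by (rule L2_add[OF L2_scale[OF T1L2] L2_scale[OF T2L2], unfolded real_scaleR_def])

  have Ww: "(\<integral>x. \<phi> (?Z x) * W x \<partial>?P) = (\<integral>x. \<phi> (?Z x) * (?Z x \<bullet> k) \<partial>?P) - (\<integral>x. gradient \<phi> (?Z x) \<bullet> k \<partial>?P)"
    if t: "test_function \<phi>" for \<phi>
  proof -
    note tL2 = test_scaled_sum_L2[OF t, of I c]
    define a where "a i = (\<integral>x. \<phi> (?Z x) * u (x i) \<partial>?P)" for i
    define D where "D = (\<integral>x. gradient \<phi> (?Z x) \<bullet> k \<partial>?P)"
    have kc: "square_integrable ?P (\<lambda>x. k)" by (rule P.L2_bounded[of _ "norm k"]) auto
    have ipos: "integrable ?P (\<lambda>x. \<phi> (?Z x) * (x i \<bullet> k))" if "i \<in> I" for i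
      by (intro L2_mult_integrable tL2 L2_inner_const coordinate_L2 I position_L2 that)
    have a1: "a i = - (c * D) + (\<integral>x. \<phi> (?Z x) * (x i \<bullet> k) \<partial>?P)" if i: "i \<in> I" for i
    proof -
      have ir: "integrable ?P (\<lambda>x. \<phi> (?Z x) * (\<rho> (x i) \<bullet> k))"
        by (intro L2_mult_integrable tL2 L2_inner_const coordinate_L2 I score_L2 i)
      have "(\<integral>x. \<phi> (?Z x) * (\<rho> (x i) \<bullet> k) \<partial>?P) = - (c * D)"
        unfolding D_def by (rule score_scaled_sum[OF I(1) i c0 t _ ir L2_inner[OF tL2(2) kc]]) simp
      then show ?thesis using ir ipos[OF i] by (simp add: a_def u_def h_def inner_add_left distrib_left)
    qed
    have iT1: "(\<integral>x. \<phi> (?Z x) * T1 x \<partial>?P) = (\<Sum>i\<in>I. a i)"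
      unfolding T1_def sum_distrib_left a_def
      by (intro Bochner_Integration.integral_sum L2_mult_integrable tL2 uiL2)
    \<comment> \<open>The score in coordinate \<open>snd p\<close> is integrated by parts first;
      this leaves the gradient against the field in coordinate \<open>fst p\<close>, which the
      divergence equation turns back into \<open>h\<close>. The two minus signs and the two factors
      \<open>c\<close> cancel.\<close>
    have aV: "(\<integral>x. \<phi> (?Z x) * V p x \<partial>?P) = a (fst p)" if p: "p \<in> Off" for p
    proof -
      have "(\<integral>x. \<phi> (?Z x) * V p x \<partial>?P) = - (c * (\<integral>x. gradient \<phi> (?Z x) \<bullet> Q (x (fst p)) \<partial>?P))"
        unfolding V_def
      proof (rule score_scaled_sum[OF I(1) OffD(1)[OF p] c0 t])
        show "Q ((x(snd p := y)) (fst p)) = Q (x (fst p))" for x y using OffD(3)[OF p] by simp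
        show "integrable ?P (\<lambda>x. \<phi> (?Z x) * (\<rho> (x (snd p)) \<bullet> Q (x (fst p))))"
          using L2_mult_integrable[OF tL2(1) VL2[OF p]] by (simp add: V_def)
        show "integrable ?P (\<lambda>x. gradient \<phi> (?Z x) \<bullet> Q (x (fst p)))"
          by (intro L2_inner tL2 coordinate_L2 I OffD p QL2)
      qed
      also have "\<dots> = a (fst p)"
        using divergence_scaled_sum[OF I(1) OffD(2)[OF p] c0 t QL2 Qw] unfolding a_def u_def by linarith
      finally show ?thesis .
    qed
    have iT2: "(\<integral>x. \<phi> (?Z x) * T2 x \<partial>?P) = (real n - 1) * (\<Sum>i\<in>I. a i)"
    proof -
      have "(\<integral>x. \<phi> (?Z x) * T2 x \<partial>?P) = (\<Sum>p\<in>Off. \<integral>x. \<phi> (?Z x) * V p x \<partial>?P)"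
        unfolding T2_def sum_distrib_left
        by (intro Bochner_Integration.integral_sum L2_mult_integrable tL2 VL2)
      also have "\<dots> = (\<Sum>p\<in>Off. a (fst p))" by (intro sum.cong refl aV)
      finally show ?thesis by (simp add: sumOff)
    qed
    have "(\<integral>x. \<phi> (?Z x) * W x \<partial>?P)
        = (\<integral>x. ((1 - l) * c) * (\<phi> (?Z x) * T1 x) + (l * c / (real n - 1)) * (\<phi> (?Z x) * T2 x) \<partial>?P)"
      by (simp add: W_def algebra_simps)
    also have "\<dots> = ((1 - l) * c) * (\<Sum>i\<in>I. a i) + (l * c / (real n - 1)) * ((real n - 1) * (\<Sum>i\<in>I. a i))"
    proof -
      have "(\<integral>x. \<alpha> * (\<phi> (?Z x) * T1 x) + \<beta> * (\<phi> (?Z x) * T2 x) \<partial>?P)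
          = \<alpha> * (\<integral>x. \<phi> (?Z x) * T1 x \<partial>?P) + \<beta> * (\<integral>x. \<phi> (?Z x) * T2 x \<partial>?P)" for \<alpha> \<beta>
        using L2_mult_integrable[OF tL2(1) T1L2] L2_mult_integrable[OF tL2(1) T2L2] by simp
      then show ?thesis by (simp only: iT1 iT2)
    qed
    also have "\<dots> = c * (\<Sum>i\<in>I. a i)"
    proof -
      have "((1 - l) * c) * S + (l * c / m) * (m * S) = c * S" if "m > 0" for m S :: real
        using that by (simp add: algebra_simps)
      from this[OF n1] show ?thesis .
    qed
    also have "\<dots> = c * (\<Sum>i\<in>I. - (c * D) + (\<integral>x. \<phi> (?Z x) * (x i \<bullet> k) \<partial>?P))"
      by (intro arg_cong2[where f = "(*)"] sum.cong refl a1)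
    \<comment> \<open>Each of the n coordinates contributes - c D, and the outer factor is
      \<open>c\<close>. The normalisation makes the total coefficient exactly -1.\<close>
    also have "\<dots> = - (c\<^sup>2 * n) * D + c * (\<Sum>i\<in>I. \<integral>x. \<phi> (?Z x) * (x i \<bullet> k) \<partial>?P)"
      unfolding sum.distrib sum_constant I(2) by (simp add: algebra_simps power2_eq_square)
    also have "(\<Sum>i\<in>I. \<integral>x. \<phi> (?Z x) * (x i \<bullet> k) \<partial>?P) = (\<integral>x. (\<Sum>i\<in>I. \<phi> (?Z x) * (x i \<bullet> k)) \<partial>?P)"
      by (intro Bochner_Integration.integral_sum[symmetric] ipos)
    also have "c * \<dots> = (\<integral>x. \<phi> (?Z x) * (?Z x \<bullet> k) \<partial>?P)"
      by (simp add: inner_sum_left sum_distrib_left mult_ac flip: integral_mult_right_zero)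
    finally show ?thesis by (simp add: c2 D_def)
  qed

  have E11: "(\<integral>x. (T1 x)\<^sup>2 \<partial>?P) = n * (\<integral>x. (u x)\<^sup>2 \<partial>\<mu>)"
  proof -
    have uu: "(\<integral>x. u (x i) * u (x j) \<partial>?P) = (if j = i then \<integral>x. (u x)\<^sup>2 \<partial>\<mu> else 0)" if ij: "i \<in> I" "j \<in> I" for i j
    proof (cases "j = i")
      case True
      have "integrable \<mu> (\<lambda>x. (u x)\<^sup>2)" using uL2 by (simp add: square_integrable_def)
      from product_coordinate(2)[OF I(1) ij(1) this] show ?thesis using True by (simp add: power2_eq_square)
    next
      case False
      have "integrable \<mu> u" by (rule L2_integrable[OF uL2])
      from product_pair(2)[OF I(1) ij False[symmetric] this this] show ?thesis
        using False h_mean[of k] by (simp add: u_def[abs_def])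
    qed
    have "(T1 x)\<^sup>2 = (\<Sum>i\<in>I. \<Sum>j\<in>I. u (x i) * u (x j))" for x
      by (simp add: T1_def power2_eq_square sum_product)
    then have "(\<integral>x. (T1 x)\<^sup>2 \<partial>?P) = (\<Sum>i\<in>I. \<Sum>j\<in>I. \<integral>x. u (x i) * u (x j) \<partial>?P)"
      by (simp add: Bochner_Integration.integral_sum L2_mult_integrable uiL2)
    also have "\<dots> = (\<Sum>i\<in>I. \<Sum>j\<in>I. if j = i then \<integral>x. (u x)\<^sup>2 \<partial>\<mu> else 0)"
      by (intro sum.cong refl uu)
    finally show ?thesis using I by (simp add: sum.delta)
  qed

  \<comment> \<open>The pair term has mean zero in each of its two coordinates separately, since the
    score and the field are both centred. So any \<open>F\<close> that ignores one of them is
    orthogonal to it. A function of one coordinate always ignores one of the two, which is why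
    \<open>T1\<close> and \<open>T2\<close> are orthogonal.\<close>
  have Z1: "(\<integral>x. F x * V p x \<partial>?P) = 0"
    if F: "square_integrable ?P F" and p: "p \<in> Off" and Fc: "(\<forall>x y. F (x(snd p := y)) = F x) \<or> (\<forall>x y. F (x(fst p := y)) = F x)"
    for F :: "(nat \<Rightarrow> 'b) \<Rightarrow> real" and p
  proof -
    note i = L2_mult_integrable[OF F VL2[OF p]]
    note O = OffD[OF p]
    have "(\<integral>x. F x * V p x \<partial>?P) = (\<integral>x. 0 \<partial>?P)"
      using Fc
    proof (rule disjE)
      assume Fc: "\<forall>x y. F (x(snd p := y)) = F x"
      show ?thesis
        by (rule product_integral_eqI[OF I(1) O(1) i]) (use O(3) Fc in \<open>simp_all add: V_def score_mean\<close>)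
    next
      assume Fc: "\<forall>x y. F (x(fst p := y)) = F x"
      have "(\<integral>y. \<rho> (x (snd p)) \<bullet> Q y \<partial>\<mu>) = 0" for x using Q0[of "\<rho> (x (snd p))"] by (simp add: inner_commute)
      then show ?thesis
        by (intro product_integral_eqI[OF I(1) O(2) i]) (use O(3) Fc in \<open>simp_all add: V_def\<close>)
    qed
    then show ?thesis by simp
  qed

  have E12: "(\<integral>x. T1 x * T2 x \<partial>?P) = 0"
  proof -
    have "(\<integral>x. u (x m) * V p x \<partial>?P) = 0" if m: "m \<in> I" and p: "p \<in> Off" for m p
      by (rule Z1[OF uiL2[OF m] p]) (use OffD(3)[OF p] in \<open>cases "m = snd p"; auto\<close>)
    moreover have "(\<integral>x. T1 x * T2 x \<partial>?P) = (\<Sum>m\<in>I. \<Sum>p\<in>Off. \<integral>x. u (x m) * V p x \<partial>?P)"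
      unfolding T1_def T2_def sum_product
      by (simp add: Bochner_Integration.integral_sum L2_mult_integrable uiL2 VL2)
    ultimately show ?thesis by simp
  qed

  have E22: "(\<integral>x. (T2 x)\<^sup>2 \<partial>?P) \<le> (real n - 1) * n * (2 * B)"
  proof -
    have B0: "B \<ge> 0" by (simp add: B_def)
    \<comment> \<open>Two ordered pairs with different underlying index sets leave a coordinate of
      \<open>p\<close> untouched by \<open>q\<close>, so they are orthogonal. Only \<open>p\<close>
      and its swap remain, and this is the origin of the factor 2 in the theorem.\<close>
    have VV: "(\<integral>x. V q x * V p x \<partial>?P) \<le> (if q \<in> {p, prod.swap p} then B else 0)" if p: "p \<in> Off" and q: "q \<in> Off" for p q
    proof (cases "q \<in> {p, prod.swap p}")
      case True
      have iq: "integrable ?P (\<lambda>x. (V q x)\<^sup>2)" "integrable ?P (\<lambda>x. (V p x)\<^sup>2)"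
        using VL2[OF q] VL2[OF p] by (auto simp: square_integrable_def)
      have "(\<integral>x. V q x * V p x \<partial>?P) \<le> (\<integral>x. ((V q x)\<^sup>2 + (V p x)\<^sup>2) / 2 \<partial>?P)"
      proof (rule integral_mono[OF L2_mult_integrable[OF VL2[OF q] VL2[OF p]]])
        show "V q x * V p x \<le> ((V q x)\<^sup>2 + (V p x)\<^sup>2) / 2" for x
          using zero_le_power2[of "V q x - V p x"] by (simp add: power2_diff)
      qed (use iq in simp)
      also have "\<dots> \<le> (B + B) / 2" using iq VB[OF q] VB[OF p] by simp
      finally show ?thesis using True by simp
    next
      case False
      have "(\<integral>x. V q x * V p x \<partial>?P) = 0"
      proof (rule Z1[OF VL2[OF q] p])
        have "snd p \<notin> {fst q, snd q} \<or> fst p \<notin> {fst q, snd q}"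
          using False OffD(3)[OF p] OffD(3)[OF q] by (cases p; cases q) auto
        then show "(\<forall>x y. V q (x(snd p := y)) = V q x) \<or> (\<forall>x y. V q (x(fst p := y)) = V q x)"
          by (auto simp: V_def)
      qed
      then show ?thesis using False by simp
    qed
    have "(T2 x)\<^sup>2 = (\<Sum>p\<in>Off. \<Sum>q\<in>Off. V q x * V p x)" for x
      unfolding T2_def power2_eq_square sum_product by (rule sum.swap)
    then have "(\<integral>x. (T2 x)\<^sup>2 \<partial>?P) = (\<Sum>p\<in>Off. \<Sum>q\<in>Off. \<integral>x. V q x * V p x \<partial>?P)"
      by (simp add: Bochner_Integration.integral_sum L2_mult_integrable VL2)
    also have "\<dots> \<le> (\<Sum>p\<in>Off. \<Sum>q\<in>Off. if q \<in> {p, prod.swap p} then B else 0)"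
      by (intro sum_mono VV)
    also have "\<dots> \<le> (\<Sum>p\<in>Off. 2 * B)"
    proof (rule sum_mono)
      fix p
      have "(\<Sum>q\<in>Off. if q \<in> {p, prod.swap p} then B else 0) = (\<Sum>q\<in>Off \<inter> {p, prod.swap p}. B)"
        by (rule sum.inter_restrict[OF fO, symmetric])
      also have "\<dots> \<le> (\<Sum>q\<in>{p, prod.swap p}. B)" using B0 by (intro sum_mono2) auto
      also have "\<dots> \<le> 2 * B" using B0 by (cases "p = prod.swap p") auto
      finally show "(\<Sum>q\<in>Off. if q \<in> {p, prod.swap p} then B else 0) \<le> 2 * B" .
    qed
    finally show ?thesis by (simp add: cardOff)
  qed

  have "(\<integral>x. (W x)\<^sup>2 \<partial>?P) = ((1 - l) * c)\<^sup>2 * (\<integral>x. (T1 x)\<^sup>2 \<partial>?P) + (l * c / (real n - 1))\<^sup>2 * (\<integral>x. (T2 x)\<^sup>2 \<partial>?P)"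
  proof -
    have "(W x)\<^sup>2 = ((1 - l) * c)\<^sup>2 * (T1 x)\<^sup>2 + (2 * ((1 - l) * c) * (l * c / (real n - 1))) * (T1 x * T2 x)
        + (l * c / (real n - 1))\<^sup>2 * (T2 x)\<^sup>2" for x
      unfolding W_def power2_sum power_mult_distrib by (simp only: mult_ac)
    then show ?thesis
      using T1L2 T2L2 L2_mult_integrable[OF T1L2 T2L2] by (simp add: square_integrable_def E12)
  qed
  also have "\<dots> \<le> ((1 - l) * c)\<^sup>2 * (n * (\<integral>x. (u x)\<^sup>2 \<partial>\<mu>)) + (l * c / (real n - 1))\<^sup>2 * ((real n - 1) * n * (2 * B))"
    unfolding E11 by (intro add_left_mono mult_left_mono E22) simp
  also have "\<dots> = (c\<^sup>2 * n) * ((1 - l)\<^sup>2 * (\<integral>x. (u x)\<^sup>2 \<partial>\<mu>) + l\<^sup>2 * (2 * B / (real n - 1)))"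
  proof -
    have "((1 - l) * c)\<^sup>2 * (N * U) + (l * c / m)\<^sup>2 * (m * N * (2 * B)) = (c\<^sup>2 * N) * ((1 - l)\<^sup>2 * U + l\<^sup>2 * (2 * B / m))"
      if "m > 0" for m N U :: real
      using that by (simp add: power2_eq_square field_simps)
    from this[OF n1] show ?thesis .
  qed
  finally have "(\<integral>x. (W x)\<^sup>2 \<partial>?P) \<le> (1 - l)\<^sup>2 * (\<integral>x. (u x)\<^sup>2 \<partial>\<mu>) + l\<^sup>2 * (2 * B / (real n - 1))"
    by (simp add: c2)
  then show thesis by (intro that[OF WL2 Ww]) (auto simp: u_def B_def)
qed

end

section \<open>Fisher information and representers of the score\<close>

lemma gradient_ln_std_gaussian:
  "gradient (\<lambda>z. ln (std_gaussian_density z)) x = - (x :: 'b::euclidean_space)"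
proof (rule gradient_eqI, unfold gderiv_def)
  have "ln (std_gaussian_density z) = (\<Sum>b\<in>(Basis :: 'b set). ln (1 / sqrt (2 * pi))) - (z \<bullet> z) / 2" for z :: 'b
  proof -
    have "ln (std_gaussian_density z) = (\<Sum>b\<in>(Basis :: 'b set). ln (1 / sqrt (2 * pi)) - (z \<bullet> b)\<^sup>2 / 2)"
      unfolding std_gaussian_density_def
      by (subst ln_prod) (auto simp: std_normal_density_def ln_mult ln_div intro!: sum.cong)
    also have "\<dots> = (\<Sum>b\<in>(Basis :: 'b set). ln (1 / sqrt (2 * pi))) - (\<Sum>b\<in>Basis. (z \<bullet> b) * (z \<bullet> b)) / 2"
      by (simp only: sum_subtractf sum_divide_distrib power2_eq_square)
    finally show ?thesis by (simp only: euclidean_inner[of z z])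
  qed
  then have "(\<lambda>z. ln (std_gaussian_density z)) = (\<lambda>z :: 'b. (\<Sum>b\<in>(Basis :: 'b set). ln (1 / sqrt (2 * pi))) - (z \<bullet> z) / 2)"
    by blast
  then show "((\<lambda>z. ln (std_gaussian_density z)) has_derivative (\<lambda>h. h \<bullet> - x)) (at x)"
    by (auto intro!: derivative_eq_intros simp: inner_commute)
qed

section \<open>Fisher information of an absolutely continuous law\<close>

locale absolutely_continuous_law = prob_space \<nu> for \<nu> :: "'b::euclidean_space measure" +
  assumes sets_law [simp, measurable_cong]: "sets \<nu> = sets borel"
    and absolutely_continuous: "absolutely_continuous lborel \<nu>"
begin

definition dens :: "'b \<Rightarrow> real" where "dens x = enn2real (RN_deriv lborel \<nu> x)"

lemma borel_measurable_law [simp]: "borel_measurable \<nu> = borel_measurable borel"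
  by (rule measurable_cong_sets) auto

lemma dens_nonneg: "dens x \<ge> 0" by (simp add: dens_def)

lemma dens_measurable [measurable]: "dens \<in> borel_measurable borel"
  unfolding dens_def[abs_def] by (intro borel_measurable_enn2real) (metis borel_measurable_RN_deriv measurable_lborel2)

lemma law_eq_density: "\<nu> = density lborel (\<lambda>x. ennreal (dens x))"
proof -
  have "\<nu> = density lborel (RN_deriv lborel \<nu>)"
    using sigma_finite_measure.density_RN_deriv[OF sigma_finite_lborel absolutely_continuous] by simp
  also have "\<dots> = density lborel (\<lambda>x. ennreal (dens x))"
  proof (rule density_cong)
    have "AE x in lborel. RN_deriv lborel \<nu> x \<noteq> \<infinity>"
      by (rule sigma_finite_measure.RN_deriv_finite[OF sigma_finite_lborel]) (simp_all add: absolutely_continuous sigma_finite_measure_axioms)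
    then show "AE x in lborel. RN_deriv lborel \<nu> x = ennreal (dens x)"
      by eventually_elim (simp add: dens_def less_top)
  qed (use dens_measurable in measurable)
  finally show ?thesis .
qed

lemma law_integrable_iff:
  fixes f :: "'b \<Rightarrow> 'c::{banach, second_countable_topology}"
  assumes "f \<in> borel_measurable borel"
  shows "integrable \<nu> f \<longleftrightarrow> integrable lborel (\<lambda>x. dens x *\<^sub>R f x)"
  using assms by (subst law_eq_density, subst integrable_density) (auto simp: dens_nonneg)

lemma law_integral:
  fixes f :: "'b \<Rightarrow> 'c::{banach, second_countable_topology}"
  assumes "f \<in> borel_measurable borel"
  shows "(\<integral>x. f x \<partial>\<nu>) = (\<integral>x. dens x *\<^sub>R f x \<partial>lborel)"
  using assms by (subst law_eq_density, subst integral_density) (auto simp: dens_nonneg)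

lemma dens_locally_integrable: "locally_integrable dens"
  using law_integrable_iff[of "\<lambda>_. 1::real"] by (intro locally_integrable_integrable) simp

text \<open>Uniqueness lets any explicit \<open>g\<close> replace the chosen
  \<open>weak_gradient\<close>. The Gaussian score is -x, so the difference of scores becomes a
  sum.\<close>

lemma relative_fisher_information_eq:
  assumes Y: "distr M borel Y = \<nu>" and g: "has_weak_gradient dens g"
  shows "relative_fisher_information M Y = (\<integral>\<^sup>+x. ennreal ((norm (g x /\<^sub>R dens x + x))\<^sup>2) \<partial>\<nu>)"
proof -
  have d: "lebesgue_density M Y = dens"
    unfolding lebesgue_density_def[abs_def] dens_def[abs_def] Y ..
  have W: "dens \<in> W11_loc" using g dens_locally_integrable by (auto simp: W11_loc_def)
  have wg: "has_weak_gradient dens (weak_gradient dens)" unfolding weak_gradient_def by (rule someI[of _ g]) (rule g)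
  have gm [measurable]: "g \<in> borel_measurable borel" using g by (auto simp: has_weak_gradient_def intro: locally_integrable_measurable)
  have "relative_fisher_information M Y
      = (\<integral>\<^sup>+x. ennreal ((norm (weak_gradient dens x /\<^sub>R dens x - gradient (\<lambda>z. ln (std_gaussian_density z)) x))\<^sup>2 * dens x) \<partial>lborel)"
    using W absolutely_continuous by (simp add: relative_fisher_information_def d Y Let_def)
  also have "\<dots> = (\<integral>\<^sup>+x. ennreal (dens x) * ennreal ((norm (g x /\<^sub>R dens x + x))\<^sup>2) \<partial>lborel)"
  proof (rule nn_integral_cong_AE)
    show "AE x in lborel. ennreal ((norm (weak_gradient dens x /\<^sub>R dens x - gradient (\<lambda>z. ln (std_gaussian_density z)) x))\<^sup>2 * dens x)
      = ennreal (dens x) * ennreal ((norm (g x /\<^sub>R dens x + x))\<^sup>2)"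
      using weak_gradient_unique[OF wg g]
      by eventually_elim (simp add: gradient_ln_std_gaussian dens_nonneg mult.commute flip: ennreal_mult)
  qed
  also have "\<dots> = (\<integral>\<^sup>+x. ennreal ((norm (g x /\<^sub>R dens x + x))\<^sup>2) \<partial>\<nu>)"
    by (subst (2) law_eq_density, subst nn_integral_density) auto
  finally show ?thesis .
qed

text \<open>A field that represents the relative score in integrated form already provides a weak
  gradient, namely \<open>dens\<close> times w - x. Membership of the density in
  \<open>W11_loc\<close> is thus a conclusion here and not a hypothesis.\<close>

lemma relative_fisher_information_representer:
  assumes Y: "distr M borel Y = \<nu>" and w: "square_integrable \<nu> w" and x: "square_integrable \<nu> (\<lambda>x. x)"
    and eq: "\<And>\<phi> k. test_function \<phi> \<Longrightarrow> k \<in> Basis \<Longrightarrow>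
      (\<integral>x. gradient \<phi> x \<bullet> k \<partial>\<nu>) = - (\<integral>x. \<phi> x * ((w x - x) \<bullet> k) \<partial>\<nu>)"
  shows "relative_fisher_information M Y = ennreal (\<integral>x. (norm (w x))\<^sup>2 \<partial>\<nu>)"
proof -
  define g where "g x = dens x *\<^sub>R (w x - x)" for x
  have [measurable]: "w \<in> borel_measurable borel" using w by (simp add: square_integrable_def)
  have "integrable \<nu> (\<lambda>x. w x - x)"
    by (intro Bochner_Integration.integrable_diff L2_integrable w x)
  then have gi: "locally_integrable g"
    unfolding g_def by (intro locally_integrable_integrable) (simp add: law_integrable_iff)
  have hw: "has_weak_gradient dens g"
    unfolding has_weak_gradient_def
  proof (intro conjI gi allI impI)
    fix \<phi> :: "'b \<Rightarrow> real" assume t: "test_function \<phi>"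
    note [measurable] = test_measurable[OF t]
    note i1 = integrable_scaleR_test_gradient[OF dens_locally_integrable t] and i2 = integrable_test_scaleR[OF gi t]
    show "(\<integral>x. dens x *\<^sub>R gradient \<phi> x \<partial>lborel) = - (\<integral>x. \<phi> x *\<^sub>R g x \<partial>lborel)"
    proof (rule euclidean_eqI)
      fix k :: 'b assume k: "k \<in> Basis"
      have "(\<integral>x. dens x *\<^sub>R gradient \<phi> x \<partial>lborel) \<bullet> k = (\<integral>x. gradient \<phi> x \<bullet> k \<partial>\<nu>)"
        using i1 by (simp add: law_integral flip: integral_inner_left)
      also have "\<dots> = - (\<integral>x. \<phi> x * ((w x - x) \<bullet> k) \<partial>\<nu>)" by (rule eq[OF t k])
      also have "(\<integral>x. \<phi> x * ((w x - x) \<bullet> k) \<partial>\<nu>) = (\<integral>x. (\<phi> x *\<^sub>R g x) \<bullet> k \<partial>lborel)"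
        by (subst law_integral) (auto simp: g_def mult_ac)
      also have "- \<dots> = (- (\<integral>x. \<phi> x *\<^sub>R g x \<partial>lborel)) \<bullet> k"
        unfolding inner_minus_left by (subst integral_inner_left) (use i2 in auto)
      finally show "(\<integral>x. dens x *\<^sub>R gradient \<phi> x \<partial>lborel) \<bullet> k = (- (\<integral>x. \<phi> x *\<^sub>R g x \<partial>lborel)) \<bullet> k" .
    qed
  qed
  \<comment> \<open>The law does not charge the zero set of its own density, so the division undoes
    the multiplication almost everywhere.\<close>
  have "AE x in \<nu>. dens x \<noteq> 0"
    by (subst law_eq_density, subst AE_density) auto
  then have "(\<integral>\<^sup>+x. ennreal ((norm (g x /\<^sub>R dens x + x))\<^sup>2) \<partial>\<nu>) = (\<integral>\<^sup>+x. ennreal ((norm (w x))\<^sup>2) \<partial>\<nu>)"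
    by (intro nn_integral_cong_AE) (auto simp: g_def elim!: eventually_mono)
  also have "\<dots> = ennreal (\<integral>x. (norm (w x))\<^sup>2 \<partial>\<nu>)"
    using w by (intro nn_integral_eq_integral) (auto simp: square_integrable_def)
  finally show ?thesis using relative_fisher_information_eq[OF Y hw] by simp
qed

end

text \<open>The representer of the pushed-forward law is the conditional expectation of \<open>W\<close> given \<open>Z\<close>.\<close>

lemma (in prob_space) pushforward_representer:
  fixes Z :: "'a \<Rightarrow> 'b::euclidean_space" and W :: "'b \<Rightarrow> 'a \<Rightarrow> real"
  assumes Z [measurable]: "Z \<in> borel_measurable M" and W: "\<And>k. k \<in> Basis \<Longrightarrow> square_integrable M (W k)"
  obtains w where "square_integrable (distr M borel Z) w"
    "(\<integral>x. (norm (w x))\<^sup>2 \<partial>distr M borel Z) \<le> (\<Sum>k\<in>Basis. \<integral>z. (W k z)\<^sup>2 \<partial>M)"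
    "\<And>\<phi> k. test_function \<phi> \<Longrightarrow> k \<in> Basis \<Longrightarrow> (\<integral>x. \<phi> x * (w x \<bullet> k) \<partial>distr M borel Z) = (\<integral>z. \<phi> (Z z) * W k z \<partial>M)"
proof -
  let ?\<nu> = "distr M borel Z"
  interpret N: prob_space ?\<nu> by (rule prob_space_distr) measurable
  have tM: "square_integrable M (\<lambda>z. \<phi> (Z z))" and tN: "square_integrable ?\<nu> \<phi>" if t: "test_function \<phi>" for \<phi>
  proof -
    note [measurable] = test_measurable[OF t]
    obtain B where "\<And>x. \<bar>\<phi> x\<bar> \<le> B" "\<And>x. norm (gradient \<phi> x) \<le> B" "B \<ge> 0"
      by (rule test_bounded[OF t]) (rule that)
    then show "square_integrable M (\<lambda>z. \<phi> (Z z))" "square_integrable ?\<nu> \<phi>"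
      by (auto intro!: L2_bounded[of _ B] N.L2_bounded[of _ B])
  qed
  have iW: "integrable M (\<lambda>z. \<phi> (Z z) * W k z)" if "test_function \<phi>" "k \<in> Basis" for \<phi> k
    using L2_inner[OF tM[OF that(1)] W[OF that(2)]] by simp
  have "\<forall>k. \<exists>q. k \<in> Basis \<longrightarrow> square_integrable ?\<nu> q \<and> (\<integral>x. (q x)\<^sup>2 \<partial>?\<nu>) \<le> (\<integral>z. (W k z)\<^sup>2 \<partial>M) \<and>
      (\<forall>\<phi>. test_function \<phi> \<longrightarrow> (\<integral>x. q x * \<phi> x \<partial>?\<nu>) = (\<integral>z. \<phi> (Z z) * W k z \<partial>M))"
    (is "\<forall>k. \<exists>q. ?G k q")
  proof
    fix k
    show "\<exists>q. ?G k q"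
    proof (cases "k \<in> Basis")
      case k: True
      show ?thesis
      \<comment> \<open>Riesz with the identity in place of a differential operator. Cauchy-Schwarz
        gives the constant E[(W k)^2], so passing to a function of \<open>Z\<close> does not
        increase the second moment.\<close>
      proof (rule N.Riesz_test_functions[of "\<lambda>\<phi>. \<phi>" "\<lambda>\<phi>. \<integral>z. \<phi> (Z z) * W k z \<partial>M" "\<integral>z. (W k z)\<^sup>2 \<partial>M"])
        show "test_function \<phi> \<Longrightarrow> square_integrable ?\<nu> \<phi>" for \<phi> by (rule tN)
        show "(\<lambda>x. \<phi> x + c * \<psi> x) = (\<lambda>x. \<phi> x + c *\<^sub>R \<psi> x)" for \<phi> \<psi> :: "'b \<Rightarrow> real" and c by simp
        show "(\<integral>z. (\<phi> (Z z) + c * \<psi> (Z z)) * W k z \<partial>M) = (\<integral>z. \<phi> (Z z) * W k z \<partial>M) + c * (\<integral>z. \<psi> (Z z) * W k z \<partial>M)"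
          if "test_function \<phi>" "test_function \<psi>" for \<phi> \<psi> c
          using iW[OF that(1) k] iW[OF that(2) k] by (simp add: distrib_right mult.assoc)
        show "(\<integral>z. \<phi> (Z z) * W k z \<partial>M)\<^sup>2 \<le> (\<integral>z. (W k z)\<^sup>2 \<partial>M) * (\<integral>x. (norm (\<phi> x))\<^sup>2 \<partial>?\<nu>)" if t: "test_function \<phi>" for \<phi>
        proof -
          note [measurable] = test_measurable[OF t]
          have "(\<integral>x. (norm (\<phi> x))\<^sup>2 \<partial>?\<nu>) = (\<integral>z. (\<phi> (Z z))\<^sup>2 \<partial>M)" by (subst integral_distr) auto
          then show ?thesis using integral_Cauchy_Schwarz[OF tM[OF t] W[OF k]] by (simp add: mult.commute)
        qed
      qed auto
    qed auto
  qed
  from choice[OF this] obtain q where q: "\<forall>k. ?G k (q k)" ..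
  define w where "w x = (\<Sum>k\<in>Basis. q k x *\<^sub>R k)" for x
  have wk: "w x \<bullet> k = q k x" if "k \<in> Basis" for x k
    using that by (simp add: w_def)
  have nw: "(norm (w x))\<^sup>2 = (\<Sum>k\<in>Basis. (q k x)\<^sup>2)" for x
    unfolding power2_norm_eq_inner euclidean_inner[of "w x" "w x"] by (simp add: wk power2_eq_square)
  have qm: "q k \<in> borel_measurable ?\<nu>" "integrable ?\<nu> (\<lambda>x. (q k x)\<^sup>2)" if "k \<in> Basis" for k
    using q that by (auto simp: square_integrable_def)
  have qb: "q k \<in> borel_measurable borel" if "k \<in> Basis" for k using qm(1)[OF that] by simp
  show thesis
  proof (rule that)
    show "square_integrable ?\<nu> w"
      unfolding square_integrable_def nw
      by (intro conjI Bochner_Integration.integrable_sum qm) (auto simp: w_def[abs_def] intro!: borel_measurable_sum borel_measurable_scaleR qb)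
    have "(\<integral>x. (norm (w x))\<^sup>2 \<partial>?\<nu>) = (\<Sum>k\<in>Basis. \<integral>x. (q k x)\<^sup>2 \<partial>?\<nu>)"
      unfolding nw by (intro Bochner_Integration.integral_sum qm)
    also have "\<dots> \<le> (\<Sum>k\<in>Basis. \<integral>z. (W k z)\<^sup>2 \<partial>M)" using q by (intro sum_mono) auto
    finally show "(\<integral>x. (norm (w x))\<^sup>2 \<partial>?\<nu>) \<le> (\<Sum>k\<in>Basis. \<integral>z. (W k z)\<^sup>2 \<partial>M)" .
    show "(\<integral>x. \<phi> x * (w x \<bullet> k) \<partial>?\<nu>) = (\<integral>z. \<phi> (Z z) * W k z \<partial>M)" if "test_function \<phi>" "k \<in> Basis" for \<phi> k
      using q that by (simp add: wk mult.commute)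
  qed
qed

lemma affine_preimage_null:
  fixes A :: "'b::euclidean_space set"
  assumes A: "A \<in> null_sets lborel" and c: "c \<noteq> 0"
  shows "{y. c *\<^sub>R y + a \<in> A} \<in> null_sets lborel"
proof -
  have [measurable]: "A \<in> sets borel" using A by auto
  have "{y \<in> space borel. c *\<^sub>R y + a \<in> A} \<in> sets borel" by measurable
  then have m: "{y. c *\<^sub>R y + a \<in> A} \<in> sets borel" by simp
  have "emeasure lborel A = ennreal (\<bar>c\<bar> ^ DIM('b)) * emeasure lborel {y. c *\<^sub>R y + a \<in> A}"
    by (subst lborel_affine[OF c, of a]) (simp add: emeasure_density nn_integral_cmult emeasure_distr vimage_def add.commute)
  then have "emeasure lborel {y. c *\<^sub>R y + a \<in> A} = 0" using A c by auto
  then show ?thesis using m by auto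
qed

section \<open>The information bound for normalised sums\<close>

context score_law
begin

text \<open>One coordinate suffices: with the others frozen the sum is a nondegenerate affine image
  of a single absolutely continuous vector, so Fubini gives mass 0 to every Lebesgue null
  set.\<close>

lemma absolutely_continuous_scaled_sum:
  assumes I: "finite I" "i \<in> I" and c: "c \<noteq> 0" and ac: "absolutely_continuous lborel \<mu>"
  shows "absolutely_continuous lborel (distr (law_power I) borel (\<lambda>x. scaled_sum c I x))"
  unfolding absolutely_continuous_def
proof
  fix A :: "'b set" assume A: "A \<in> null_sets lborel"
  then have [measurable]: "A \<in> sets borel" by auto
  interpret product_sigma_finite "\<lambda>_::nat. \<mu>" by (rule product_sigma_finite_law)
  have J: "insert i (I - {i}) = I" "finite (I - {i})" "i \<notin> I - {i}" using I by auto
  let ?Z = "\<lambda>x. scaled_sum c I x"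
  have zero: "(\<integral>\<^sup>+y. indicator A (c *\<^sub>R y + a) \<partial>\<mu>) = 0" for a
  proof -
    have n: "{y. c *\<^sub>R y + a \<in> A} \<in> null_sets \<mu>"
      using affine_preimage_null[OF A c] ac by (auto simp: absolutely_continuous_def)
    have "(\<integral>\<^sup>+y. indicator A (c *\<^sub>R y + a) \<partial>\<mu>) = (\<integral>\<^sup>+y. indicator {y. c *\<^sub>R y + a \<in> A} y \<partial>\<mu>)"
      by (intro nn_integral_cong) (auto simp: indicator_def)
    also have "\<dots> = 0" using n by (simp add: null_setsD1 null_setsD2)
    finally show ?thesis .
  qed
  have "emeasure (distr (law_power I) borel ?Z) A = (\<integral>\<^sup>+x. indicator A (?Z x) \<partial>law_power I)"
    by (subst nn_integral_distr[of ?Z _ borel "indicator A", symmetric]) simp_all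
  also have "\<dots> = (\<integral>\<^sup>+x. (\<integral>\<^sup>+y. indicator A (?Z (x(i := y))) \<partial>\<mu>) \<partial>law_power (I - {i}))"
    by (rule product_nn_integral_insert[OF J(2,3), unfolded J(1)]) measurable
  also have "\<dots> = 0" unfolding scaled_sum_update[OF I] zero by simp
  finally show "A \<in> null_sets (distr (law_power I) borel ?Z)" by auto
qed

lemma fisher_information_scaled_sum:
  assumes I: "finite I" "card I = n" "n \<ge> 2" and ac: "absolutely_continuous lborel \<mu>" and R: "R > 0"
    and Y: "distr M borel Y = distr (law_power I) borel (\<lambda>x. (1 / sqrt n) *\<^sub>R (\<Sum>j\<in>I. x j))"
  shows "relative_fisher_information M Y
    \<le> ennreal (2 * DIM('b) * R / (2 * DIM('b) * R + (real n - 1)) * (\<integral>x. (norm (h x))\<^sup>2 \<partial>\<mu>))"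
proof -
  define c where "c = 1 / sqrt n"
  define \<nu> where "\<nu> = distr (law_power I) borel (\<lambda>x. scaled_sum c I x)"
  let ?P = "law_power I" and ?Z = "\<lambda>x. scaled_sum c I x"
  have c0: "c \<noteq> 0" using I by (simp add: c_def)
  interpret P: prob_space ?P by (rule prob_space_law_power)
  obtain i where i: "i \<in> I" using I by (metis card.empty equals0I not_numeral_le_zero)
  interpret N: absolutely_continuous_law \<nu>
  proof (intro absolutely_continuous_law.intro absolutely_continuous_law_axioms.intro)
    show "prob_space \<nu>" unfolding \<nu>_def by (rule P.prob_space_distr) measurable
    show "sets \<nu> = sets borel" by (simp add: \<nu>_def)
    show "absolutely_continuous lborel \<nu>"
      unfolding \<nu>_def by (rule absolutely_continuous_scaled_sum[OF I(1) i c0 ac])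
  qed
  define A where "A = 2 * DIM('b) * R"
  define m where "m = real n - 1"
  \<comment> \<open>The minimiser of (1 - l)^2 + l^2 A / m; the minimum A / (A + m) is the
    contraction factor of the theorem.\<close>
  define l where "l = m / (A + m)"
  define J where "J = (\<integral>x. (norm (h x))\<^sup>2 \<partial>\<mu>)"
  define S where "S = (\<integral>x. (norm (\<rho> x))\<^sup>2 \<partial>\<mu>)"
  have A0: "A > 0" and m0: "m > 0" using R I by (auto simp: A_def m_def)
  obtain Q where Q: "\<And>k. k \<in> Basis \<Longrightarrow> square_integrable \<mu> (Q k)"
    "\<And>k b. k \<in> Basis \<Longrightarrow> (\<integral>x. Q k x \<bullet> b \<partial>\<mu>) = 0"
    "\<And>k \<phi>. k \<in> Basis \<Longrightarrow> test_function \<phi> \<Longrightarrow> (\<integral>x. Q k x \<bullet> gradient \<phi> x \<partial>\<mu>) = - (\<integral>x. (h x \<bullet> k) * \<phi> x \<partial>\<mu>)"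
    "S * (\<Sum>k\<in>Basis. \<integral>x. (norm (Q k x))\<^sup>2 \<partial>\<mu>) \<le> R * DIM('b) * J"
    by (rule divergence_equations[folded S_def J_def]) (rule that)
  have "\<forall>k. \<exists>W. k \<in> Basis \<longrightarrow> square_integrable ?P W \<and>
    (\<forall>\<phi>. test_function \<phi> \<longrightarrow> (\<integral>x. \<phi> (?Z x) * W x \<partial>?P) = (\<integral>x. \<phi> (?Z x) * (?Z x \<bullet> k) \<partial>?P) - (\<integral>x. gradient \<phi> (?Z x) \<bullet> k \<partial>?P)) \<and>
    (\<integral>x. (W x)\<^sup>2 \<partial>?P) \<le> (1 - l)\<^sup>2 * (\<integral>x. (h x \<bullet> k)\<^sup>2 \<partial>\<mu>) + l\<^sup>2 * (2 * (S * (\<integral>x. (norm (Q k x))\<^sup>2 \<partial>\<mu>)) / m)"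
    (is "\<forall>k. \<exists>W. ?G k W")
  proof
    fix k
    show "\<exists>W. ?G k W"
    proof (cases "k \<in> Basis")
      case k: True
      show ?thesis unfolding S_def m_def
        by (rule representer_exists[OF I c_def k Q(1)[OF k] Q(2)[OF k] Q(3)[OF k]]) auto
    qed auto
  qed
  from choice[OF this] obtain W where W: "\<forall>k. ?G k (W k)" ..
  have WL2: "square_integrable ?P (W k)" if "k \<in> Basis" for k using W that by blast
  have "(\<Sum>k\<in>Basis. \<integral>x. (W k x)\<^sup>2 \<partial>?P)
      \<le> (\<Sum>k\<in>Basis. (1 - l)\<^sup>2 * (\<integral>x. (h x \<bullet> k)\<^sup>2 \<partial>\<mu>) + l\<^sup>2 * (2 * (S * (\<integral>x. (norm (Q k x))\<^sup>2 \<partial>\<mu>)) / m))"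
    using W by (intro sum_mono) blast
  also have "\<dots> = (1 - l)\<^sup>2 * J + l\<^sup>2 * (2 * (S * (\<Sum>k\<in>Basis. \<integral>x. (norm (Q k x))\<^sup>2 \<partial>\<mu>)) / m)"
    unfolding J_def integral_norm_square_Basis[OF h_L2]
    by (simp only: sum.distrib sum_distrib_left sum_divide_distrib)
  also have "\<dots> \<le> (1 - l)\<^sup>2 * J + l\<^sup>2 * (2 * (R * DIM('b) * J) / m)"
    using m0 by (intro add_left_mono mult_left_mono divide_right_mono Q(4)) auto
  also have "\<dots> = ((1 - l)\<^sup>2 + l\<^sup>2 * A / m) * J" by (simp add: A_def algebra_simps)
  also have "(1 - l)\<^sup>2 + l\<^sup>2 * A / m = A / (A + m)"
  proof -
    have 1: "1 - l = A / (A + m)" using A0 m0 by (simp add: l_def field_simps)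
    have "l\<^sup>2 * A / m = m * A / (A + m)\<^sup>2" using A0 m0 by (simp add: l_def power_divide power2_eq_square)
    moreover have "(1 - l)\<^sup>2 = A * A / (A + m)\<^sup>2" unfolding 1 by (simp add: power_divide power2_eq_square)
    moreover have "A * A / (A + m)\<^sup>2 + m * A / (A + m)\<^sup>2 = A / (A + m)"
      using A0 m0 by (simp add: power2_eq_square flip: add_divide_distrib distrib_right)
    ultimately show ?thesis by simp
  qed
  finally have sumW: "(\<Sum>k\<in>Basis. \<integral>x. (W k x)\<^sup>2 \<partial>?P) \<le> A / (A + m) * J" .
  obtain w where w: "square_integrable \<nu> w" "(\<integral>x. (norm (w x))\<^sup>2 \<partial>\<nu>) \<le> (\<Sum>k\<in>Basis. \<integral>x. (W k x)\<^sup>2 \<partial>?P)"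
    "\<And>\<phi> k. test_function \<phi> \<Longrightarrow> k \<in> Basis \<Longrightarrow> (\<integral>x. \<phi> x * (w x \<bullet> k) \<partial>\<nu>) = (\<integral>x. \<phi> (?Z x) * W k x \<partial>?P)"
    by (rule P.pushforward_representer[of ?Z W, OF scaled_sum_measurable WL2, folded \<nu>_def]) (assumption, rule that)
  have ZL2: "square_integrable ?P ?Z"
    by (intro L2_scale L2_sum) (rule coordinate_L2[OF I(1) _ position_L2])
  have xL2: "square_integrable \<nu> (\<lambda>x. x)"
    using ZL2 unfolding \<nu>_def square_integrable_def by (simp add: integrable_distr_eq)
  have "relative_fisher_information M Y = ennreal (\<integral>x. (norm (w x))\<^sup>2 \<partial>\<nu>)"
  proof (rule N.relative_fisher_information_representer[OF _ w(1) xL2])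
    show "distr M borel Y = \<nu>" by (simp add: Y \<nu>_def c_def)
    fix \<phi> :: "'b \<Rightarrow> real" and k :: 'b assume t: "test_function \<phi>" and k: "k \<in> Basis"
    note [measurable] = test_measurable[OF t]
    obtain B where B: "\<And>x. \<bar>\<phi> x\<bar> \<le> B" "\<And>x. norm (gradient \<phi> x) \<le> B" "B \<ge> 0"
      by (rule test_bounded[OF t]) (rule that)
    have tN: "square_integrable \<nu> \<phi>" using B by (intro N.L2_bounded[of _ B]) auto
    have i: "integrable \<nu> (\<lambda>x. \<phi> x * (w x \<bullet> k))" "integrable \<nu> (\<lambda>x. \<phi> x * (x \<bullet> k))"
      by (intro L2_mult_integrable tN L2_inner_const w xL2)+
    have e1: "(\<integral>x. \<phi> x * (x \<bullet> k) \<partial>\<nu>) = (\<integral>x. \<phi> (?Z x) * (?Z x \<bullet> k) \<partial>?P)"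
      unfolding \<nu>_def by (rule integral_distr) measurable
    have e2: "(\<integral>x. gradient \<phi> x \<bullet> k \<partial>\<nu>) = (\<integral>x. gradient \<phi> (?Z x) \<bullet> k \<partial>?P)"
      unfolding \<nu>_def by (rule integral_distr) measurable
    have "(\<integral>x. \<phi> (?Z x) * W k x \<partial>?P) = (\<integral>x. \<phi> (?Z x) * (?Z x \<bullet> k) \<partial>?P) - (\<integral>x. gradient \<phi> (?Z x) \<bullet> k \<partial>?P)"
      using W t k by blast
    then show "(\<integral>x. gradient \<phi> x \<bullet> k \<partial>\<nu>) = - (\<integral>x. \<phi> x * ((w x - x) \<bullet> k) \<partial>\<nu>)"
      using i by (simp only: inner_diff_left right_diff_distrib Bochner_Integration.integral_diff w(3)[OF t k] e1 e2)
  qed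
  also have "\<dots> \<le> ennreal (A / (A + m) * J)" by (intro ennreal_leI order_trans[OF w(2) sumW])
  finally show ?thesis by (simp add: A_def m_def J_def)
qed

end

section \<open>Poincare constant and moments\<close>

text \<open>This admits test functions to the Poincare inequality: a bounded gradient on the convex
  whole space gives a global Lipschitz constant.\<close>

lemma test_function_lipschitz:
  assumes "test_function \<phi>" shows "locally_lipschitz \<phi>"
proof -
  obtain B where B: "\<And>x. \<bar>\<phi> x\<bar> \<le> B" "\<And>x. norm (gradient \<phi> x) \<le> B" "B \<ge> 0"
    by (rule test_bounded[OF assms]) (rule that)
  have "B-lipschitz_on UNIV \<phi>"
  proof (rule bounded_derivative_imp_lipschitz[OF _ convex_UNIV])
    show "(\<phi> has_derivative (\<lambda>h. h \<bullet> gradient \<phi> x)) (at x within UNIV)" for x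
      using smooth_GDERIV[OF test_smooth[OF assms]] by (simp add: gderiv_def)
    show "onorm (\<lambda>h. h \<bullet> gradient \<phi> x) \<le> B" for x
    proof (rule onorm_le)
      show "norm (h \<bullet> gradient \<phi> x) \<le> B * norm h" for h
        using order_trans[OF Cauchy_Schwarz_ineq2[of h "gradient \<phi> x"] mult_left_mono[OF B(2) norm_ge_zero]]
        by (simp add: mult.commute)
    qed
  qed (rule B(3))
  then have "B-lipschitz_on (cball x 1) \<phi>" for x by (rule lipschitz_on_subset) simp
  then show ?thesis unfolding locally_lipschitz_def using zero_less_one by blast
qed

lemma inner_locally_lipschitz: "locally_lipschitz (\<lambda>x. x \<bullet> b)"
proof -
  have "(norm b)-lipschitz_on X (\<lambda>x. x \<bullet> b)" for X
  proof (rule lipschitz_onI)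
    show "dist (x \<bullet> b) (y \<bullet> b) \<le> norm b * dist x y" for x y
      using Cauchy_Schwarz_ineq2[of "x - y" b] by (simp add: dist_norm inner_diff_left mult.commute)
  qed simp
  then show ?thesis unfolding locally_lipschitz_def using zero_less_one by blast
qed

text \<open>A coordinate function has gradient of norm 1 and here variance 1, so every admissible
  constant is at least 1. The bound keeps \<open>R\<close> away from 0, where the factor of the
  theorem would degenerate.\<close>

lemma (in prob_space) poincare_constant_ge_1:
  fixes X :: "'a \<Rightarrow> 'b::euclidean_space"
  assumes b: "b \<in> Basis" "integrable M (\<lambda>z. (X z \<bullet> b)\<^sup>2)" "variance (\<lambda>z. X z \<bullet> b) = 1"
  shows "1 \<le> poincare_constant M X"
  unfolding poincare_constant_def
proof (rule Inf_greatest)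
  fix y assume "y \<in> {ennreal C | C. C > 0 \<and>
       (\<forall>f. locally_lipschitz f \<and> integrable M (\<lambda>z. (f (X z))\<^sup>2) \<longrightarrow>
          ennreal (variance (\<lambda>z. f (X z))) \<le> ennreal C * (\<integral>\<^sup>+z. ennreal ((norm (gradient f (X z)))\<^sup>2) \<partial>M))}"
  then obtain C where y: "y = ennreal C" and
    C: "\<And>f. locally_lipschitz f \<Longrightarrow> integrable M (\<lambda>z. (f (X z))\<^sup>2) \<Longrightarrow>
          ennreal (variance (\<lambda>z. f (X z))) \<le> ennreal C * (\<integral>\<^sup>+z. ennreal ((norm (gradient f (X z)))\<^sup>2) \<partial>M)"
    by blast
  have "ennreal (variance (\<lambda>z. X z \<bullet> b)) \<le> ennreal C * (\<integral>\<^sup>+z. ennreal ((norm (gradient (\<lambda>x. x \<bullet> b) (X z)))\<^sup>2) \<partial>M)"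
    by (rule C[OF inner_locally_lipschitz b(2)])
  then show "1 \<le> y" using b(1,3) by (simp add: y gradient_inner emeasure_space_1)
qed

text \<open>The definition as an infimum gives admissible constants only arbitrarily close to it.
  The inequality is therefore proved with an additive error \<open>e\<close>, which is then sent to
  0.\<close>

lemma (in prob_space) poincare_test_function:
  fixes X :: "'a \<Rightarrow> 'b::euclidean_space"
  assumes X [measurable]: "X \<in> borel_measurable M" and fin: "poincare_constant M X < \<infinity>" and t: "test_function \<phi>"
  shows "expectation (\<lambda>z. (\<phi> (X z))\<^sup>2) - (expectation (\<lambda>z. \<phi> (X z)))\<^sup>2
    \<le> enn2real (poincare_constant M X) * expectation (\<lambda>z. (norm (gradient \<phi> (X z)))\<^sup>2)"
proof -
  note [measurable] = test_measurable[OF t]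
  obtain B where B: "\<And>x. \<bar>\<phi> x\<bar> \<le> B" "\<And>x. norm (gradient \<phi> x) \<le> B" "B \<ge> 0"
    by (rule test_bounded[OF t]) (rule that)
  have i: "square_integrable M (\<lambda>z. \<phi> (X z))" "square_integrable M (\<lambda>z. gradient \<phi> (X z))"
    using B by (auto intro!: L2_bounded[of _ B])
  have i2: "integrable M (\<lambda>z. (\<phi> (X z))\<^sup>2)" and i3: "integrable M (\<lambda>z. (norm (gradient \<phi> (X z)))\<^sup>2)"
    using i by (auto simp: square_integrable_def)
  define V where "V = variance (\<lambda>z. \<phi> (X z))"
  define N where "N = expectation (\<lambda>z. (norm (gradient \<phi> (X z)))\<^sup>2)"
  define R where "R = enn2real (poincare_constant M X)"
  have V: "V = expectation (\<lambda>z. (\<phi> (X z))\<^sup>2) - (expectation (\<lambda>z. \<phi> (X z)))\<^sup>2"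
    unfolding V_def by (rule variance_eq[OF L2_integrable[OF i(1)] i2])
  have N0: "N \<ge> 0" and V0: "V \<ge> 0" by (simp_all add: N_def V_def)
  have R: "poincare_constant M X = ennreal R" using fin by (simp add: R_def less_top)
  have R0: "R \<ge> 0" by (simp add: R_def)
  have "V \<le> R * N + e" if e: "e > 0" for e
  proof -
    \<comment> \<open>Dividing by \<open>N + 1\<close> instead of \<open>N\<close> avoids a zero
      denominator and still keeps the final error below \<open>e\<close>.\<close>
    have "poincare_constant M X < ennreal (R + e / (N + 1))"
      unfolding R using e N0 R0 by (intro ennreal_lessI) (auto intro!: add_nonneg_pos divide_pos_pos)
    then obtain C where C: "C > 0" "ennreal C < ennreal (R + e / (N + 1))"
      "ennreal V \<le> ennreal C * (\<integral>\<^sup>+z. ennreal ((norm (gradient \<phi> (X z)))\<^sup>2) \<partial>M)"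
      unfolding poincare_constant_def Inf_less_iff V_def
      using test_function_lipschitz[OF t] i2 by blast
    have "(\<integral>\<^sup>+z. ennreal ((norm (gradient \<phi> (X z)))\<^sup>2) \<partial>M) = ennreal N"
      unfolding N_def using i3 by (rule nn_integral_eq_integral) simp
    then have "V \<le> C * N" using C(1,3) N0 V0 by (simp flip: ennreal_mult)
    also have "C < R + e / (N + 1)" using C(1,2) by (simp add: ennreal_less_iff)
    then have "C * N \<le> (R + e / (N + 1)) * N" using N0 by (intro mult_right_mono) auto
    also have "\<dots> \<le> R * N + e"
    proof -
      have "e * N \<le> e * (N + 1)" using e by simp
      then have "e / (N + 1) * N \<le> e" using N0 by (simp add: pos_divide_le_eq)
      then show ?thesis by (simp add: distrib_right)
    qed
    finally show ?thesis .
  qed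
  then have "V \<le> R * N" by (rule field_le_epsilon)
  then show ?thesis by (simp add: V N_def R_def)
qed

lemma covariance_identity_moments:
  fixes X :: "'a \<Rightarrow> real ^ 'n"
  assumes "prob_space M" and X [measurable]: "X \<in> borel_measurable M"
    and m: "(\<integral>z. X z \<partial>M) = 0" and cov: "covariance_matrix M X = mat 1"
  shows "integrable M (\<lambda>z. (norm (X z))\<^sup>2)"
    and "b \<in> Basis \<Longrightarrow> c \<in> Basis \<Longrightarrow> (\<integral>z. (X z \<bullet> b) * (X z \<bullet> c) \<partial>M) = (if b = c then 1 else 0)"
proof -
  interpret prob_space M by fact
  define a where "a i = expectation (\<lambda>z. X z $ i)" for i
  have C: "expectation (\<lambda>z. (X z $ i - a i) * (X z $ j - a j)) = (if i = j then 1 else 0)" for i j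
  proof -
    have "covariance_matrix M X $ i $ j = mat 1 $ i $ j" by (simp only: cov)
    then show ?thesis by (simp add: covariance_matrix_def a_def mat_def)
  qed
  have Xi: "(\<lambda>z. X z $ i) \<in> borel_measurable M" for i
  proof -
    have "(\<lambda>z. X z \<bullet> axis i 1) \<in> borel_measurable M" by measurable
    then show ?thesis by (simp add: inner_axis)
  qed
  have sq0: "square_integrable M (\<lambda>z. X z $ i - a i)" for i
    unfolding square_integrable_def
  proof
    \<comment> \<open>The diagonal entry is 1, whereas a function that is not integrable would have
      integral 0.\<close>
    have "integrable M (\<lambda>z. (X z $ i - a i) * (X z $ i - a i))"
      using C[of i i] not_integrable_integral_eq by fastforce
    then show "integrable M (\<lambda>z. (norm (X z $ i - a i))\<^sup>2)" by (simp add: power2_eq_square)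
  qed (use Xi in measurable)
  have sq: "square_integrable M (\<lambda>z. X z $ i)" for i
    using L2_add[OF sq0[of i] L2_bounded[of "\<lambda>_. a i" "\<bar>a i\<bar>"]] by simp
  have nX: "(norm (X z))\<^sup>2 = (\<Sum>i\<in>UNIV. (X z $ i)\<^sup>2)" for z
    unfolding power2_norm_eq_inner inner_vec_def by (simp add: power2_eq_square)
  show sX: "integrable M (\<lambda>z. (norm (X z))\<^sup>2)"
    unfolding nX using sq by (intro Bochner_Integration.integrable_sum) (simp add: square_integrable_def)
  have "integrable M X" using sX by (intro L2_integrable) (simp add: square_integrable_def)
  then have a0: "a i = 0" for i
    using integral_inner_left[of "axis i 1" M X] m by (simp add: a_def inner_axis)
  show "(\<integral>z. (X z \<bullet> b) * (X z \<bullet> c) \<partial>M) = (if b = c then 1 else 0)" if bc: "b \<in> Basis" "c \<in> Basis"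
  proof -
    obtain i j where "b = axis i 1" "c = axis j 1" using bc by (auto simp: Basis_vec_def)
    then show ?thesis using C[of i j] by (simp add: a0 inner_axis axis_eq_axis)
  qed
qed

section \<open>Transfer from laws to random vectors\<close>

theorem proposition3p2:
  fixes M :: "'a measure"
    and X :: "nat \<Rightarrow> 'a \<Rightarrow> real ^ 'n"
    and n :: nat
    and R :: real
  assumes "prob_space M"
    and "n \<ge> 1"
    and "prob_space.indep_vars M (\<lambda>_. borel) X {1..n}"
    and "\<And>i. i \<in> {1..n} \<Longrightarrow> distr M borel (X i) = distr M borel (X 1)"
    and "absolutely_continuous lborel (distr M borel (X 1))"
    and "(\<integral>\<omega>. X 1 \<omega> \<partial>M) = 0"
    and "covariance_matrix M (X 1) = mat 1"
    and "poincare_constant M (X 1) < \<infinity>"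
    and "R = enn2real (poincare_constant M (X 1))"
  shows "relative_fisher_information M (\<lambda>\<omega>. (1 / sqrt (real n)) *\<^sub>R (\<Sum>i=1..n. X i \<omega>))
      \<le> ennreal (2 * real CARD('n) * R / (2 * real CARD('n) * R + (real n - 1)))
          * relative_fisher_information M (X 1)"
proof -
  note One_nat_def [simp del]
  interpret prob_space M by fact
  define \<mu> where "\<mu> = distr M borel (X 1)"
  have X [measurable]: "X i \<in> borel_measurable M" if "i \<in> {1..n}" for i
    using assms(3) that by (auto simp: indep_vars_def)
  have X1 [measurable]: "X 1 \<in> borel_measurable M" using X assms(2) by simp
  note mom = covariance_identity_moments[OF assms(1) X1 assms(6,7)]
  have XL2: "square_integrable M (X 1)" unfolding square_integrable_def using X1 mom(1) by blast
  have xint: "integrable M (X 1)" by (rule L2_integrable[OF XL2])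
  have R1: "R \<ge> 1"
  proof -
    obtain b :: "real ^ 'n" where b: "b \<in> Basis" using nonempty_Basis by blast
    have m0: "expectation (\<lambda>\<omega>. X 1 \<omega> \<bullet> b) = 0" using xint assms(6) by simp
    have "integrable M (\<lambda>\<omega>. (X 1 \<omega> \<bullet> b)\<^sup>2)"
      using L2_inner_const[OF XL2, of b] by (simp add: square_integrable_def)
    moreover have "variance (\<lambda>\<omega>. X 1 \<omega> \<bullet> b) = 1"
      unfolding m0 using mom(2)[OF b b] by (simp add: power2_eq_square)
    ultimately have "1 \<le> poincare_constant M (X 1)" by (rule poincare_constant_ge_1[OF b])
    also have "\<dots> = ennreal R" using assms(8,9) by (simp add: less_top)
    finally show ?thesis by simp
  qed
  let ?c = "2 * real CARD('n) * R / (2 * real CARD('n) * R + (real n - 1))"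
  have c0: "?c > 0" using R1 assms(2) by (intro divide_pos_pos add_pos_nonneg) auto
  interpret A: absolutely_continuous_law \<mu>
    unfolding \<mu>_def using assms(5)
    by (intro absolutely_continuous_law.intro absolutely_continuous_law_axioms.intro prob_space_distr[OF X1]) simp_all
  have d: "lebesgue_density M (X 1) = A.dens"
    by (simp only: fun_eq_iff lebesgue_density_def A.dens_def \<mu>_def[symmetric]) simp
  show ?thesis
  proof (cases "relative_fisher_information M (X 1) = \<infinity>")
    case True
    \<comment> \<open>Strict positivity matters: in \<open>ennreal\<close> the product of 0 and
      \<infinity> is 0, and the right-hand side would not be infinite.\<close>
    have "ennreal a * \<infinity> = \<infinity>" if "a > 0" for a
      using that by (simp add: ennreal_mult_eq_top_iff)
    from this[OF c0] show ?thesis unfolding True by (simp only: infinity_ennreal_def top_greatest)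
  next
    case False
    then have "A.dens \<in> W11_loc" by (auto simp: relative_fisher_information_def d Let_def split: if_splits)
    then obtain g where g: "has_weak_gradient A.dens g" by (auto simp: W11_loc_def)
    then have gm [measurable]: "g \<in> borel_measurable borel"
      by (auto simp: has_weak_gradient_def intro: locally_integrable_measurable)
    define \<rho> where "\<rho> x = g x /\<^sub>R A.dens x" for x
    have \<rho>m [measurable]: "\<rho> \<in> borel_measurable borel" unfolding \<rho>_def[abs_def] by measurable
    have J: "relative_fisher_information M (X 1) = (\<integral>\<^sup>+x. ennreal ((norm (\<rho> x + x))\<^sup>2) \<partial>\<mu>)"
      unfolding \<rho>_def by (rule A.relative_fisher_information_eq[OF _ g]) (simp add: \<mu>_def)
    have xL2: "square_integrable \<mu> (\<lambda>x. x)"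
      using mom(1) by (simp add: square_integrable_def \<mu>_def integrable_distr_eq)
    have hL2: "square_integrable \<mu> (\<lambda>x. \<rho> x + x)"
      unfolding square_integrable_def
    proof
      show "integrable \<mu> (\<lambda>x. (norm (\<rho> x + x))\<^sup>2)"
      proof (rule integrableI_bounded)
        show "(\<integral>\<^sup>+x. ennreal (norm ((norm (\<rho> x + x))\<^sup>2)) \<partial>\<mu>) < \<infinity>"
          using False by (simp add: J less_top)
      qed measurable
    qed measurable
    interpret S: score_law \<mu> \<rho> R
    proof (intro score_law.intro score_law_axioms.intro)
      show "prob_space \<mu>" by (rule A.prob_space_axioms)
      show "square_integrable \<mu> \<rho>" using L2_diff[OF hL2 xL2] by simp
      show "(\<integral>x. x \<partial>\<mu>) = 0" using assms(6) by (simp add: \<mu>_def integral_distr)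
      show "(\<integral>x. (x \<bullet> b) * (x \<bullet> c) \<partial>\<mu>) = (if b = c then 1 else 0)" if "b \<in> Basis" "c \<in> Basis" for b c
        using mom(2)[OF that] by (simp add: \<mu>_def integral_distr)
      show "(\<integral>x. gradient \<phi> x \<bullet> e \<partial>\<mu>) = - (\<integral>x. \<phi> x * (\<rho> x \<bullet> e) \<partial>\<mu>)" if t: "test_function \<phi>" for \<phi> e
      proof -
        note [measurable] = test_measurable[OF t]
        have "(\<integral>x. \<phi> x * (\<rho> x \<bullet> e) \<partial>\<mu>) = (\<integral>x. A.dens x *\<^sub>R (\<phi> x * (\<rho> x \<bullet> e)) \<partial>lborel)"
          by (rule A.law_integral) measurable
        also have "\<dots> = (\<integral>x. \<phi> x * (g x \<bullet> e) \<partial>lborel)"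
        proof (rule integral_cong_AE)
          \<comment> \<open>Where the density is positive the division cancels. Where it is zero the
            left side is 0, and \<open>g\<close> vanishes almost everywhere by
            \<open>has_weak_gradient_zero_set\<close>.\<close>
          show "AE x in lborel. A.dens x *\<^sub>R (\<phi> x * (\<rho> x \<bullet> e)) = \<phi> x * (g x \<bullet> e)"
            using has_weak_gradient_zero_set[OF A.dens_locally_integrable g A.dens_nonneg]
            by eventually_elim (auto simp: \<rho>_def)
        qed measurable
        finally have "- (\<integral>x. \<phi> x * (\<rho> x \<bullet> e) \<partial>\<mu>) = (\<integral>x. A.dens x * (gradient \<phi> x \<bullet> e) \<partial>lborel)"
          using weak_gradient_integral[OF g A.dens_locally_integrable t, of e] by simp
        then show ?thesis by (subst A.law_integral) auto
      qed
      show "(\<integral>x. (\<phi> x)\<^sup>2 \<partial>\<mu>) - (\<integral>x. \<phi> x \<partial>\<mu>)\<^sup>2 \<le> R * (\<integral>x. (norm (gradient \<phi> x))\<^sup>2 \<partial>\<mu>)" if t: "test_function \<phi>" for \<phi>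
      proof -
        note [measurable] = test_measurable[OF t]
        show ?thesis using poincare_test_function[OF X1 assms(8) t] by (simp add: \<mu>_def integral_distr assms(9))
      qed
    qed (use R1 xL2 in auto)
    have Jh: "relative_fisher_information M (X 1) = ennreal (\<integral>x. (norm (S.h x))\<^sup>2 \<partial>\<mu>)"
      unfolding J S.h_def using hL2 by (intro nn_integral_eq_integral) (auto simp: square_integrable_def)
    show ?thesis
    proof (cases "n = 1")
      case True
      \<comment> \<open>With a single vector there are no pairs of distinct indices. The sum is X 1
        itself, and the factor is a positive number divided by itself, hence 1.\<close>
      then show ?thesis using R1 by simp
    next
      case False
      then have n2: "n \<ge> 2" using assms(2) by simp
      \<comment> \<open>Independence makes the law of the tuple a product, and equality of the
        marginals makes it a power of \<mu>. The normalised sum then has the law of the scaled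
        coordinate sum.\<close>
      have "distr M (PiM {1..n} (\<lambda>_. borel)) (\<lambda>\<omega>. \<lambda>i\<in>{1..n}. X i \<omega>) = PiM {1..n} (\<lambda>i. distr M borel (X i))"
        using indep_vars_iff_distr_eq_PiM'[of "{1..n}" X "\<lambda>_. borel"] assms(2,3) X by auto
      also have "\<dots> = PiM {1..n} (\<lambda>_. \<mu>)"
        by (rule PiM_cong[OF refl], unfold \<mu>_def, rule assms(4))
      finally have PM: "PiM {1..n} (\<lambda>_. \<mu>) = distr M (PiM {1..n} (\<lambda>_. borel)) (\<lambda>\<omega>. \<lambda>i\<in>{1..n}. X i \<omega>)" ..
      have Y: "distr M borel (\<lambda>\<omega>. (1 / sqrt (real n)) *\<^sub>R (\<Sum>i=1..n. X i \<omega>))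
          = distr (PiM {1..n} (\<lambda>_. \<mu>)) borel (\<lambda>x. (1 / sqrt (real n)) *\<^sub>R (\<Sum>j\<in>{1..n}. x j))"
        unfolding PM
      proof (subst distr_distr)
        show "(\<lambda>\<omega>. \<lambda>i\<in>{1..n}. X i \<omega>) \<in> M \<rightarrow>\<^sub>M PiM {1..n} (\<lambda>_. borel)"
          by (rule measurable_restrict) (rule X)
        show "(\<lambda>x :: nat \<Rightarrow> real ^ 'n. (1 / sqrt (real n)) *\<^sub>R (\<Sum>j\<in>{1..n}. x j)) \<in> PiM {1..n} (\<lambda>_. borel) \<rightarrow>\<^sub>M borel"
          by (intro borel_measurable_scaleR borel_measurable_const borel_measurable_sum measurable_component_singleton)
      qed (simp add: comp_def)
      have "relative_fisher_information M (\<lambda>\<omega>. (1 / sqrt (real n)) *\<^sub>R (\<Sum>i=1..n. X i \<omega>))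
          \<le> ennreal (2 * DIM(real ^ 'n) * R / (2 * DIM(real ^ 'n) * R + (real n - 1)) * (\<integral>x. (norm (S.h x))\<^sup>2 \<partial>\<mu>))"
        by (rule S.fisher_information_scaled_sum[OF _ _ n2 A.absolutely_continuous _ Y]) (use R1 in auto)
      also have "\<dots> = ennreal ?c * ennreal (\<integral>x. (norm (S.h x))\<^sup>2 \<partial>\<mu>)"
      proof -
        have "ennreal (a * b) = ennreal a * ennreal b" if "a > 0" for a b
          using that by (simp add: ennreal_mult')
        moreover have "real (2 * DIM(real ^ 'n)) = 2 * real CARD('n)" by simp
        ultimately show ?thesis using c0 by (simp only:)
      qed
      finally show ?thesis unfolding Jh .
    qed
  qed
qed

end
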